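(* Let $M$ be a smooth manifold of dimension $m$ and let $\mathcal{T}^n=TM\oplus\wedge^nT^*M$, with pairing $(\cdot,\cdot)$, higher-order Courant bracket $[\![\cdot,\cdot]\!]$ and projection $\rho:\mathcal{T}^n\to TM$. For all $e_1,e_2,e_3\in\Gamma(\mathcal{T}^n)$ and $f\in C^\infty(M)$: (i) $[\![e_1,[\![e_2,e_3]\!]]\!]+\mathrm{c.p.}=d\,T(e_1,e_2,e_3)$, where $T(e_1,e_2,e_3)\in\Omega^{n-1}(M)$ is defined by $$T(e_1,e_2,e_3)=-\tfrac13\big(([\![e_1,e_2]\!],e_3)+\mathrm{c.p.}\big);$$ (ii) $[\![e_1,fe_2]\!]=f[\![e_1,e_2]\!]+\rho(e_1)(f)\,e_2-df\wedge(e_1,e_2)$; (iii) $\rho[\![e_1,e_2]\!]=[\rho(e_1),\rho(e_2)]$; (iv) $L_{\rho(e_1)}(e_2,e_3)=\big([\![e_1,e_2]\!]+d(e_1,e_2),e_3\big)+\big(e_2,[\![e_1,e_3]\!]+d(e_1,e_3)\big)$.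
   Context: $M$ is a smooth $m$-dimensional manifold and $n\ge 0$ an integer (with the convention $\wedge^{-1}T^*M=0$). Sections of $\mathcal{T}^n=TM\oplus\wedge^nT^*M$ are written $X+\alpha$ with $X$ a vector field and $\alpha\in\Omega^n(M)$. The $\wedge^{n-1}T^*M$-valued symmetric pairing is $(X+\alpha,Y+\beta)=\frac12(i_X\beta+i_Y\alpha)$. The higher-order Courant bracket is $$[\![X+\alpha,Y+\beta]\!]=[X,Y]+L_X\beta-L_Y\alpha+\tfrac12(d\,i_Y\alpha-d\,i_X\beta).$$ The map $\rho$ is $\rho(X+\alpha)=X$. An element of $\Omega^n(M)$ (such as $d\,T(e_1,e_2,e_3)$, $df\wedge(e_1,e_2)$ or $d(e_1,e_2)$) is regarded as a section of $\mathcal{T}^n$ with zero vector field component. "c.p." denotes the sum of the terms obtained by cyclic permutations of $e_1,e_2,e_3$. *)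

theory Defs
  imports "HOL-Analysis.Analysis" "HOL-Library.Function_Algebras"
begin

section \<open>Smooth manifolds\<close>

text \<open>Functions of class \<open>C\<^sup>k\<close> on an open subset of a finite-dimensional normed space:
  Frechet differentiable with all directional derivatives of class \<open>C\<^sup>k\<^sup>-\<^sup>1\<close>.\<close>

primrec Ck_on :: "nat \<Rightarrow> 'b::real_normed_vector set \<Rightarrow> ('b \<Rightarrow> 'c::real_normed_vector) \<Rightarrow> bool" where
  "Ck_on 0 S f \<longleftrightarrow> continuous_on S f"
| "Ck_on (Suc k) S f \<longleftrightarrow>
     (\<forall>x\<in>S. f differentiable (at x)) \<and> (\<forall>v. Ck_on k S (\<lambda>x. frechet_derivative f (at x) v))"

definition smooth_on :: "'b::real_normed_vector set \<Rightarrow> ('b \<Rightarrow> 'c::real_normed_vector) \<Rightarrow> bool" where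
  "smooth_on S f \<longleftrightarrow> (\<forall>k. Ck_on k S f)"

text \<open>The model space is an \<open>m\<close>-dimensional Euclidean space. The class \<open>euclidean_space\<close> is not
  used because it excludes dimension 0.\<close>

definition euclidean_model :: "'b::real_inner itself \<Rightarrow> nat \<Rightarrow> bool" where
  "euclidean_model _ m \<longleftrightarrow> (\<exists>B::'b set. finite B \<and> card B = m \<and> span B = UNIV \<and>
     (\<forall>b\<in>B. norm b = 1) \<and> pairwise orthogonal B)"

text \<open>A chart is its domain together with its coordinate map; the values of the coordinate map
  outside the domain are irrelevant.\<close>

type_synonym ('a, 'b) chart = "'a set \<times> ('a \<Rightarrow> 'b)"

abbreviation cdom :: "('a, 'b) chart \<Rightarrow> 'a set" where
  "cdom c \<equiv> fst c"

abbreviation coord :: "('a, 'b) chart \<Rightarrow> 'a \<Rightarrow> 'b" where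
  "coord c \<equiv> snd c"

definition cinv :: "('a, 'b) chart \<Rightarrow> 'b \<Rightarrow> 'a" where
  "cinv c = inv_into (cdom c) (coord c)"

text \<open>The manifold is the whole (Hausdorff, second countable) type \<open>'a\<close>, with smooth structure
  given by an atlas that need not be maximal.\<close>

definition smooth_manifold ::
    "nat \<Rightarrow> ('a::{t2_space,second_countable_topology}, 'b::real_inner) chart set \<Rightarrow> bool" where
  "smooth_manifold m A \<longleftrightarrow>
     euclidean_model TYPE('b) m \<and>
     (\<Union>c\<in>A. cdom c) = UNIV \<and>
     (\<forall>c\<in>A. open (cdom c) \<and> open (coord c ` cdom c) \<and>
        homeomorphism (cdom c) (coord c ` cdom c) (coord c) (cinv c)) \<and>
     (\<forall>c\<in>A. \<forall>c'\<in>A. smooth_on (coord c ` (cdom c \<inter> cdom c')) (coord c' \<circ> cinv c))"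

definition smooth_function :: "('a, 'b::real_inner) chart set \<Rightarrow> ('a \<Rightarrow> real) \<Rightarrow> bool" where
  "smooth_function A f \<longleftrightarrow> (\<forall>c\<in>A. smooth_on (coord c ` cdom c) (f \<circ> cinv c))"


section \<open>Tangent vectors and vector fields\<close>

text \<open>A tangent vector at \<open>p\<close> is given by its component vectors in the charts at \<open>p\<close>, related by
  the derivatives of the transition maps; for definiteness, it is 0 on everything that is not a
  chart at \<open>p\<close>. Addition of tangent vectors is pointwise addition of functions.\<close>

type_synonym ('a, 'b) tvec = "('a, 'b) chart \<Rightarrow> 'b"

definition trans_deriv ::
    "('a, 'b::real_inner) chart \<Rightarrow> ('a, 'b) chart \<Rightarrow> 'a \<Rightarrow> 'b \<Rightarrow> 'b" where
  "trans_deriv c c' p = frechet_derivative (coord c' \<circ> cinv c) (at (coord c p))"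

definition tangent_space :: "('a, 'b::real_inner) chart set \<Rightarrow> 'a \<Rightarrow> ('a, 'b) tvec set" where
  "tangent_space A p = {v.
     (\<forall>c\<in>A. \<forall>c'\<in>A. p \<in> cdom c \<longrightarrow> p \<in> cdom c' \<longrightarrow> v c' = trans_deriv c c' p (v c)) \<and>
     (\<forall>c. \<not> (c \<in> A \<and> p \<in> cdom c) \<longrightarrow> v c = 0)}"

definition tv_scale :: "real \<Rightarrow> ('a, 'b::real_inner) tvec \<Rightarrow> ('a, 'b) tvec" where
  "tv_scale r v = (\<lambda>c. r *\<^sub>R v c)"

text \<open>The tangent vector at \<open>p\<close> with component vector \<open>u\<close> in the chart \<open>c\<close>, that is,
  \<open>\<Sum>\<^sub>i u\<^sub>i \<partial>/\<partial>x\<^sub>i\<close>.\<close>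

definition coord_tvec ::
    "('a, 'b::real_inner) chart set \<Rightarrow> ('a, 'b) chart \<Rightarrow> 'a \<Rightarrow> 'b \<Rightarrow> ('a, 'b) tvec" where
  "coord_tvec A c p u = (\<lambda>c'. if c' \<in> A \<and> p \<in> cdom c' then trans_deriv c c' p u else 0)"

type_synonym ('a, 'b) vfield = "'a \<Rightarrow> ('a, 'b) tvec"

definition vf_rep :: "('a, 'b::real_inner) chart \<Rightarrow> ('a, 'b) vfield \<Rightarrow> 'b \<Rightarrow> 'b" where
  "vf_rep c X = (\<lambda>x. X (cinv c x) c)"

definition vector_fields :: "('a, 'b::real_inner) chart set \<Rightarrow> ('a, 'b) vfield set" where
  "vector_fields A = {X. (\<forall>p. X p \<in> tangent_space A p) \<and>
     (\<forall>c\<in>A. smooth_on (coord c ` cdom c) (vf_rep c X))}"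

text \<open>In every chart \<open>[X,Y]\<^sup>i = \<Sum>\<^sub>j (X\<^sup>j \<partial>\<^sub>j Y\<^sup>i - Y\<^sup>j \<partial>\<^sub>j X\<^sup>i)\<close>.\<close>

definition lie_bracket ::
    "('a, 'b::real_inner) chart set \<Rightarrow> ('a, 'b) vfield \<Rightarrow> ('a, 'b) vfield \<Rightarrow> ('a, 'b) vfield" where
  "lie_bracket A X Y = (\<lambda>p c. if c \<in> A \<and> p \<in> cdom c
     then frechet_derivative (vf_rep c Y) (at (coord c p)) (X p c)
        - frechet_derivative (vf_rep c X) (at (coord c p)) (Y p c)
     else 0)"

text \<open>\<open>X(f)\<close>\<close>

definition vf_apply ::
    "('a, 'b::real_inner) chart set \<Rightarrow> ('a, 'b) vfield \<Rightarrow> ('a \<Rightarrow> real) \<Rightarrow> 'a \<Rightarrow> real" where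
  "vf_apply A X f = (\<lambda>p. let c = (SOME c. c \<in> A \<and> p \<in> cdom c) in
     frechet_derivative (f \<circ> cinv c) (at (coord c p)) (X p c))"


section \<open>Differential forms\<close>

text \<open>A form of degree \<open>k\<close> takes a point \<open>p\<close> and a list of \<open>k\<close> tangent vectors at \<open>p\<close>; for
  definiteness, it vanishes on all other lists. The degree is an integer, so that the only form of
  degree \<open>-1\<close> is 0.\<close>

type_synonym ('a, 'b) form = "'a \<Rightarrow> ('a, 'b) tvec list \<Rightarrow> real"

definition form_rep ::
    "('a, 'b::real_inner) chart set \<Rightarrow> ('a, 'b) chart \<Rightarrow> ('a, 'b) form \<Rightarrow> 'b list \<Rightarrow> 'b \<Rightarrow> real" where
  "form_rep A c \<alpha> us = (\<lambda>x. \<alpha> (cinv c x) (map (coord_tvec A c (cinv c x)) us))"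

definition alternating_multilinear ::
    "('a, 'b::real_inner) tvec set \<Rightarrow> int \<Rightarrow> (('a, 'b) tvec list \<Rightarrow> real) \<Rightarrow> bool" where
  "alternating_multilinear V k a \<longleftrightarrow>
     (\<forall>vs. \<not> (int (length vs) = k \<and> set vs \<subseteq> V) \<longrightarrow> a vs = 0) \<and>
     (\<forall>us ws. \<forall>v\<in>V. \<forall>w\<in>V. set us \<subseteq> V \<longrightarrow> set ws \<subseteq> V \<longrightarrow>
        a (us @ (v + w) # ws) = a (us @ v # ws) + a (us @ w # ws)) \<and>
     (\<forall>us ws r. \<forall>v\<in>V. set us \<subseteq> V \<longrightarrow> set ws \<subseteq> V \<longrightarrow>
        a (us @ tv_scale r v # ws) = r * a (us @ v # ws)) \<and>
     (\<forall>vs. \<not> distinct vs \<longrightarrow> a vs = 0)"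

definition forms :: "('a, 'b::real_inner) chart set \<Rightarrow> int \<Rightarrow> ('a, 'b) form set" where
  "forms A k = {\<alpha>. (\<forall>p. alternating_multilinear (tangent_space A p) k (\<alpha> p)) \<and>
     (\<forall>c\<in>A. \<forall>us. smooth_on (coord c ` cdom c) (form_rep A c \<alpha> us))}"

definition form_scale :: "real \<Rightarrow> ('a, 'b) form \<Rightarrow> ('a, 'b) form" where
  "form_scale r \<alpha> = (\<lambda>p vs. r * \<alpha> p vs)"

definition function_form :: "('a \<Rightarrow> real) \<Rightarrow> ('a, 'b) form" where
  "function_form f = (\<lambda>p vs. if vs = [] then f p else 0)"

definition omit :: "nat \<Rightarrow> 'c list \<Rightarrow> 'c list" where
  "omit i xs = take i xs @ drop (Suc i) xs"

text \<open>Exterior derivative, in coordinates: \<open>d(\<Sum>\<^sub>I \<alpha>\<^sub>I dx\<^sup>I) = \<Sum>\<^sub>I d\<alpha>\<^sub>I \<and> dx\<^sup>I\<close>, evaluated on vectors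
  with components \<open>u\<^sub>0, \<dots>, u\<^sub>k\<close>. The result does not depend on the chart at \<open>p\<close>. The degree is
  determined by the length of the list of arguments.\<close>

definition ext_deriv :: "('a, 'b::real_inner) chart set \<Rightarrow> ('a, 'b) form \<Rightarrow> ('a, 'b) form" where
  "ext_deriv A \<alpha> = (\<lambda>p vs. if set vs \<subseteq> tangent_space A p
     then let c = (SOME c. c \<in> A \<and> p \<in> cdom c); us = map (\<lambda>v. v c) vs in
       \<Sum>i<length us. (-1) ^ i *
         frechet_derivative (form_rep A c \<alpha> (omit i us)) (at (coord c p)) (us ! i)
     else 0)"

definition interior_prod :: "('a, 'b) vfield \<Rightarrow> ('a, 'b) form \<Rightarrow> ('a, 'b) form" where
  "interior_prod X \<alpha> = (\<lambda>p vs. \<alpha> p (X p # vs))"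

text \<open>Lie derivative: \<open>(L\<^sub>X \<alpha>)(Y\<^sub>1, \<dots>, Y\<^sub>k) = X(\<alpha>(Y\<^sub>1, \<dots>, Y\<^sub>k)) - \<Sum>\<^sub>i \<alpha>(Y\<^sub>1, \<dots>, [X, Y\<^sub>i], \<dots>, Y\<^sub>k)\<close>,
  written out in a chart for constant coordinate vector fields \<open>Y\<^sub>i = u\<^sub>i\<close>, for which
  \<open>[X, u\<^sub>i] = - DX(u\<^sub>i)\<close>. The result does not depend on the chart at \<open>p\<close>.\<close>

definition lie_deriv ::
    "('a, 'b::real_inner) chart set \<Rightarrow> ('a, 'b) vfield \<Rightarrow> ('a, 'b) form \<Rightarrow> ('a, 'b) form" where
  "lie_deriv A X \<alpha> = (\<lambda>p vs. if set vs \<subseteq> tangent_space A p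
     then let c = (SOME c. c \<in> A \<and> p \<in> cdom c); us = map (\<lambda>v. v c) vs; x = coord c p in
       frechet_derivative (form_rep A c \<alpha> us) (at x) (X p c) +
       (\<Sum>i<length us.
          form_rep A c \<alpha> (us[i := frechet_derivative (vf_rep c X) (at x) (us ! i)]) x)
     else 0)"

text \<open>Wedge product of a 1-form with a form of arbitrary degree, with the convention
  \<open>(\<theta> \<and> \<beta>)(v\<^sub>0, \<dots>, v\<^sub>k) = \<Sum>\<^sub>i (-1)\<^sup>i \<theta>(v\<^sub>i) \<beta>(v\<^sub>0, \<dots>, v\<^sub>i\<^sub>-\<^sub>1, v\<^sub>i\<^sub>+\<^sub>1, \<dots>, v\<^sub>k)\<close>,
  under which \<open>d(f\<beta>) = df \<and> \<beta> + f d\<beta>\<close>.\<close>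

definition one_form_wedge :: "('a, 'b) form \<Rightarrow> ('a, 'b) form \<Rightarrow> ('a, 'b) form" where
  "one_form_wedge \<theta> \<beta> = (\<lambda>p vs. \<Sum>i<length vs. (-1) ^ i * \<theta> p [vs ! i] * \<beta> p (omit i vs))"


section \<open>The bundle \<open>TM \<oplus> \<Lambda>\<^sup>n T\<^sup>*M\<close>\<close>

text \<open>Addition and subtraction of sections are those of pairs of functions.\<close>

type_synonym ('a, 'b) csection = "('a, 'b) vfield \<times> ('a, 'b) form"

definition sections :: "('a, 'b::real_inner) chart set \<Rightarrow> nat \<Rightarrow> ('a, 'b) csection set" where
  "sections A n = vector_fields A \<times> forms A (int n)"

definition anchor :: "('a, 'b) csection \<Rightarrow> ('a, 'b) vfield" where
  "anchor e = fst e"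

definition form_section :: "('a, 'b::real_inner) form \<Rightarrow> ('a, 'b) csection" where
  "form_section \<alpha> = (0, \<alpha>)"

definition section_scale ::
    "('a \<Rightarrow> real) \<Rightarrow> ('a, 'b::real_inner) csection \<Rightarrow> ('a, 'b) csection" where
  "section_scale f e = (\<lambda>p. tv_scale (f p) (fst e p), \<lambda>p vs. f p * snd e p vs)"

definition pairing :: "('a, 'b) csection \<Rightarrow> ('a, 'b) csection \<Rightarrow> ('a, 'b) form" where
  "pairing e1 e2 =
     form_scale (1/2) (interior_prod (fst e1) (snd e2) + interior_prod (fst e2) (snd e1))"

definition courant_bracket ::
    "('a, 'b::real_inner) chart set \<Rightarrow> ('a, 'b) csection \<Rightarrow> ('a, 'b) csection \<Rightarrow> ('a, 'b) csection" where
  "courant_bracket A e1 e2 =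
     (lie_bracket A (fst e1) (fst e2),
      lie_deriv A (fst e1) (snd e2) - lie_deriv A (fst e2) (snd e1) +
      form_scale (1/2) (ext_deriv A (interior_prod (fst e2) (snd e1))
                      - ext_deriv A (interior_prod (fst e1) (snd e2))))"

definition courant_T ::
    "('a, 'b::real_inner) chart set \<Rightarrow> ('a, 'b) csection \<Rightarrow> ('a, 'b) csection \<Rightarrow> ('a, 'b) csection
      \<Rightarrow> ('a, 'b) form" where
  "courant_T A e1 e2 e3 = form_scale (- (1/3))
     (pairing (courant_bracket A e1 e2) e3 +
      pairing (courant_bracket A e2 e3) e1 +
      pairing (courant_bracket A e3 e1) e2)"

end

(* In a chart, a form is a family of functions on an open set of the model space indexed by lists of
   constant vectors. Contracting with a constant field u lowers the degree, and the coordinate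
   formulas for L_X and d become the recursions
     i_u L_X = L_X i_u + i_[u,X]   and   i_u d = L_u - d i_u.
   The Cartan identities for arbitrary fields therefore follow by induction on the degree from the
   symmetry of second derivatives. Independence of the chart needs no further computation: the same
   induction, with u pushed forward along the transition map to a nonconstant field, shows that L_X
   and d commute with changes of coordinates. The four claims are then formal consequences of the
   Cartan identities in each chart. *)
theory Submission
  imports Defs
begin

section \<open>Smooth functions on open sets\<close>


text \<open>A vector is constant only relative to a chart, and a transition map destroys constancy.
  Hence the Cartan identities must be available for arbitrary fields before charts are compared. An
  orthonormal basis leads from constant to arbitrary fields: \<open>contract X a\<close> is the
  combination of the \<open>contract_const b a\<close> with coefficient functions
  \<open>X x \<bullet> b\<close>, and the derivatives of these coefficients supply the missing half
  of the Lie bracket. The inductions run over the argument list with the form and its degree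
  generalized, since each step replaces the form by a contraction. The constant -1/3 in T is found
  by counting. When the brackets on both sides of (i) are expanded, the terms without d cancel
  because [L_X, L_Y] = L_[X,Y], and so do all terms d i_[X,Y] c. What remains of the Jacobiator is
  1/4 (d i_Y L_X c - d i_X L_Y c) and its cyclic images, while d of the sum of the three pairings
  leaves 3/4 (d i_X L_Y c - d i_Y L_X c) and its cyclic images.\<close>

lemma Ck_on_cong:
  assumes "open S" "\<And>x. x \<in> S \<Longrightarrow> f x = g x" "Ck_on k S f"
  shows "Ck_on k S g"
  using assms(2,3)
proof (induction k arbitrary: f g)
  case 0
  then show ?case by (simp cong: continuous_on_cong)
next
  case (Suc k)
  have D: "f differentiable (at x)" if "x \<in> S" for x
    using Suc.prems that by simp
  have eq: "frechet_derivative f (at x) = frechet_derivative g (at x)" if "x \<in> S" for x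
    using D[OF that] assms(1) that Suc.prems(1) by (rule frechet_derivative_transform_within_open)
  have "g differentiable (at x)" if "x \<in> S" for x
  proof -
    obtain f' where "(f has_derivative f') (at x)"
      using D \<open>x \<in> S\<close> unfolding differentiable_def by blast
    then have "(g has_derivative f') (at x)"
      by (rule has_derivative_transform_within_open[OF _ assms(1) \<open>x \<in> S\<close>
        Suc.prems(1)])
    then show ?thesis unfolding differentiable_def by blast
  qed
  moreover have "Ck_on k S (\<lambda>x. frechet_derivative g (at x) v)" for v
    using Suc.IH[of "\<lambda>x. frechet_derivative f (at x) v" "\<lambda>x. frechet_derivative g
      (at x) v"] eq Suc.prems(2) by simp
  ultimately show ?case by simp
qed

lemma Ck_on_Suc_imp: "Ck_on (Suc k) S f \<Longrightarrow> Ck_on k S f"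
proof (induction k arbitrary: f)
  case 0
  then show ?case
    by (auto intro!: differentiable_imp_continuous_on simp: differentiable_on_def
      differentiable_at_withinI)
next
  case (Suc k)
  then show ?case by (metis Ck_on.simps(2))
qed

lemma Ck_on_const: "Ck_on k S (\<lambda>x. c)"
  by (induction k arbitrary: c) auto

lemma Ck_on_add:
  assumes "open S"
  shows "Ck_on k S f \<Longrightarrow> Ck_on k S g \<Longrightarrow> Ck_on k S (\<lambda>x. f x + g
    x)"
proof (induction k arbitrary: f g)
  case 0
  then show ?case by (simp add: continuous_on_add)
next
  case (Suc k)
  have eq: "frechet_derivative (\<lambda>x. f x + g x) (at x) v
      = frechet_derivative f (at x) v + frechet_derivative g (at x) v" if "x \<in> S" for x v
  proof -
    have "(f has_derivative frechet_derivative f (at x)) (at x)"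
      "(g has_derivative frechet_derivative g (at x)) (at x)"
      using Suc.prems that by (auto simp: frechet_derivative_works[symmetric])
    from frechet_derivative_at[OF has_derivative_add[OF this]] show ?thesis by metis
  qed
  have "Ck_on k S (\<lambda>x. frechet_derivative (\<lambda>x. f x + g x) (at x) v)" for v
    using Suc by (intro Ck_on_cong[OF assms eq[symmetric]] Suc.IH) auto
  then show ?case using Suc.prems by auto
qed

lemma Ck_on_linear:
  assumes "open S" "bounded_linear h"
  shows "Ck_on k S f \<Longrightarrow> Ck_on k S (\<lambda>x. h (f x))"
proof (induction k arbitrary: f)
  case 0
  then show ?case by (simp add: bounded_linear.continuous_on[OF assms(2)])
next
  case (Suc k)
  have der: "((\<lambda>x. h (f x)) has_derivative (\<lambda>v. h (frechet_derivative f (at x) v)))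
    (at x)"
    if "x \<in> S" for x
    using Suc.prems that by (intro bounded_linear.has_derivative[OF assms(2)])
      (simp add: frechet_derivative_works)
  have eq: "frechet_derivative (\<lambda>x. h (f x)) (at x) v = h (frechet_derivative f (at x) v)"
    if "x \<in> S" for x v
    using frechet_derivative_at[OF der[OF that]] by metis
  have "Ck_on k S (\<lambda>x. frechet_derivative (\<lambda>x. h (f x)) (at x) v)" for v
    using Suc by (intro Ck_on_cong[OF assms(1) eq[symmetric]] Suc.IH) auto
  then show ?case using der by (auto simp: differentiable_def)
qed

lemma has_derivative_scaleR_at:
  fixes g :: "'b::real_normed_vector \<Rightarrow> 'c::real_normed_vector"
  assumes "f differentiable (at x)" "g differentiable (at x)"
  shows "((\<lambda>x. f x *\<^sub>R g x) has_derivative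
    (\<lambda>v. f x *\<^sub>R frechet_derivative g (at x) v + frechet_derivative f (at x) v
      *\<^sub>R g x)) (at x)"
  using assms by (intro has_derivative_scaleR) (auto simp: frechet_derivative_works)

lemma Ck_on_scaleR:
  fixes g :: "'b::real_normed_vector \<Rightarrow> 'c::real_normed_vector"
  assumes "open S"
  shows "Ck_on k S f \<Longrightarrow> Ck_on k S g \<Longrightarrow> Ck_on k S (\<lambda>x. f x
    *\<^sub>R g x)"
proof (induction k arbitrary: f g)
  case 0
  then show ?case by (simp add: continuous_on_scaleR)
next
  case (Suc k)
  have der: "((\<lambda>x. f x *\<^sub>R g x) has_derivative
    (\<lambda>v. f x *\<^sub>R frechet_derivative g (at x) v + frechet_derivative f (at x) v
      *\<^sub>R g x)) (at x)"
    if "x \<in> S" for x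
    using Suc.prems that by (intro has_derivative_scaleR_at) auto
  have eq: "frechet_derivative (\<lambda>x. f x *\<^sub>R g x) (at x) v
      = f x *\<^sub>R frechet_derivative g (at x) v + frechet_derivative f (at x) v *\<^sub>R g x"
        if "x \<in> S" for x v
    using frechet_derivative_at[OF der[OF that]] by metis
  \<comment> \<open>The product rule multiplies the derivative of one factor by the other factor
    itself, so both factors are also needed at the lower order k.\<close>
  have "Ck_on k S (\<lambda>x. frechet_derivative (\<lambda>x. f x *\<^sub>R g x) (at x) v)" for v
    using Suc.prems Ck_on_Suc_imp[OF Suc.prems(1)] Ck_on_Suc_imp[OF Suc.prems(2)]
    by (intro Ck_on_cong[OF assms eq[symmetric]] Ck_on_add[OF assms] Suc.IH) auto
  then show ?case using der by (auto simp: differentiable_def)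
qed

lemma smooth_on_cong:
  assumes "open S" "\<And>x. x \<in> S \<Longrightarrow> f x = g x" "smooth_on S f"
  shows "smooth_on S g"
  using assms unfolding smooth_on_def by (metis Ck_on_cong)

lemma smooth_on_const [simp]: "smooth_on S (\<lambda>x. c)"
  by (simp add: smooth_on_def Ck_on_const)

lemma smooth_on_add: "open S \<Longrightarrow> smooth_on S f \<Longrightarrow> smooth_on S g
  \<Longrightarrow> smooth_on S (\<lambda>x. f x + g x)"
  by (simp add: smooth_on_def Ck_on_add)

lemma smooth_on_linear: "open S \<Longrightarrow> bounded_linear h \<Longrightarrow> smooth_on S f
  \<Longrightarrow> smooth_on S (\<lambda>x. h (f x))"
  by (simp add: smooth_on_def Ck_on_linear)

lemma smooth_on_inner: "open S \<Longrightarrow> smooth_on S f \<Longrightarrow> smooth_on S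
  (\<lambda>x. f x \<bullet> b)"
  by (rule smooth_on_linear[OF _ bounded_linear_inner_left])

lemma smooth_on_scaleR:
  "open S \<Longrightarrow> smooth_on S f \<Longrightarrow> smooth_on S g \<Longrightarrow>
    smooth_on S (\<lambda>x. f x *\<^sub>R g x)"
  by (simp add: smooth_on_def Ck_on_scaleR)

lemma smooth_on_mult:
  fixes f g :: "'b::real_normed_vector \<Rightarrow> real"
  shows "open S \<Longrightarrow> smooth_on S f \<Longrightarrow> smooth_on S g \<Longrightarrow>
    smooth_on S (\<lambda>x. f x * g x)"
  using smooth_on_scaleR[of S f g] by simp

lemma smooth_on_minus: "open S \<Longrightarrow> smooth_on S f \<Longrightarrow> smooth_on S
  (\<lambda>x. - f x)"
  by (rule smooth_on_linear[OF _ bounded_linear_minus[OF bounded_linear_ident]])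

lemma smooth_on_diff: "open S \<Longrightarrow> smooth_on S f \<Longrightarrow> smooth_on S g
  \<Longrightarrow> smooth_on S (\<lambda>x. f x - g x)"
  using smooth_on_add[of S f "\<lambda>x. - g x"] smooth_on_minus[of S g] by simp

lemma smooth_on_sum:
  "open S \<Longrightarrow> (\<And>i. i \<in> I \<Longrightarrow> smooth_on S (f i))
    \<Longrightarrow> smooth_on S (\<lambda>x. \<Sum>i\<in>I. f i x)"
  by (induction I rule: infinite_finite_induct) (auto intro: smooth_on_add)

lemma smooth_on_frechet_derivative:
  "smooth_on S f \<Longrightarrow> smooth_on S (\<lambda>x. frechet_derivative f (at x) v)"
  unfolding smooth_on_def by (metis Ck_on.simps(2))

lemma smooth_on_differentiable: "smooth_on S f \<Longrightarrow> x \<in> S \<Longrightarrow> f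
  differentiable (at x)"
  unfolding smooth_on_def by (metis Ck_on.simps(2))

lemma smooth_on_has_derivative:
  "smooth_on S f \<Longrightarrow> x \<in> S \<Longrightarrow> (f has_derivative frechet_derivative
    f (at x)) (at x)"
  using smooth_on_differentiable frechet_derivative_works by blast

lemma smooth_on_subset: "smooth_on S f \<Longrightarrow> T \<subseteq> S \<Longrightarrow>
  smooth_on T f"
proof -
  have "Ck_on k S f \<Longrightarrow> T \<subseteq> S \<Longrightarrow> Ck_on k T f" for k
    by (induction k arbitrary: f) (auto intro: continuous_on_subset)
  then show "smooth_on S f \<Longrightarrow> T \<subseteq> S \<Longrightarrow> smooth_on T f" by
    (simp add: smooth_on_def)
qed

lemma smooth_on_continuous: "smooth_on S f \<Longrightarrow> continuous_on S f"
  unfolding smooth_on_def by (metis Ck_on.simps(1))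

section \<open>Symmetry of second derivatives\<close>

lemma has_derivative_along_line:
  assumes "smooth_on S f" "y + t *\<^sub>R v \<in> S"
  shows "((\<lambda>t. f (y + t *\<^sub>R v)) has_derivative
    (\<lambda>h. h *\<^sub>R frechet_derivative f (at (y + t *\<^sub>R v)) v)) (at t)"
proof -
  let ?D = "frechet_derivative f (at (y + t *\<^sub>R v))"
  have "(f \<circ> (\<lambda>t. y + t *\<^sub>R v) has_derivative ?D \<circ> (\<lambda>h. h
    *\<^sub>R v)) (at t)"
    by (rule diff_chain_at) (auto intro!: derivative_eq_intros smooth_on_has_derivative[OF assms])
  moreover have "linear ?D"
    using smooth_on_differentiable[OF assms] by (rule linear_frechet_derivative)
  ultimately show ?thesis
    by (simp add: o_def linear_scale)
qed

text \<open>The mean value theorem is applied twice: in direction u to the increment of f along h v,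
  then in direction v to the derivative \<open>Du\<close>. The left-hand side is symmetric in u and
  v, the right-hand side is not visibly so; this yields the symmetry of second derivatives.\<close>

lemma second_difference:
  fixes f :: "'b::real_normed_vector \<Rightarrow> real"
  assumes "smooth_on S f" "0 < h" "ball x r \<subseteq> S" "h * (norm u + norm v) < r"
  shows "\<exists>s t. 0 < s \<and> s < h \<and> 0 < t \<and> t < h \<and>
    f (x + h *\<^sub>R u + h *\<^sub>R v) - f (x + h *\<^sub>R u) - f (x + h *\<^sub>R v) + f x =
    h * h * frechet_derivative (\<lambda>y. frechet_derivative f (at y) u) (at (x + s *\<^sub>R u +
      t *\<^sub>R v)) v"
proof -
  have inS: "x + s *\<^sub>R u + t *\<^sub>R v \<in> S" if "0 \<le> s" "s \<le> h" "0 \<le> t" "t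
    \<le> h" for s t
  proof -
    have "norm (s *\<^sub>R u + t *\<^sub>R v) \<le> s * norm u + t * norm v"
      using norm_triangle_ineq[of "s *\<^sub>R u" "t *\<^sub>R v"] that by simp
    also have "\<dots> \<le> h * norm u + h * norm v"
      using that by (intro add_mono mult_right_mono) auto
    finally have "norm (s *\<^sub>R u + t *\<^sub>R v) < r" using assms(4) by (simp add:
      distrib_left)
    then have "x + (s *\<^sub>R u + t *\<^sub>R v) \<in> ball x r"
      by (metis add_diff_cancel_left' dist_commute dist_norm mem_ball)
    then show ?thesis using assms(3) by (auto simp: add.assoc)
  qed
  define g where "g s = f (x + h *\<^sub>R v + s *\<^sub>R u) - f (x + s *\<^sub>R u)" for s
  define Du where "Du y = frechet_derivative f (at y) u" for y
  have "\<exists>s. 0 < s \<and> s < h \<and> g h - g 0 = (h - 0) * (Du (x + h *\<^sub>R v + s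
    *\<^sub>R u) - Du (x + s *\<^sub>R u))"
  proof (rule MVT2[OF assms(2)])
    fix s assume s: "0 \<le> s" "s \<le> h"
    have 1: "x + h *\<^sub>R v + s *\<^sub>R u \<in> S" "x + s *\<^sub>R u \<in> S"
      using inS[of s h] inS[of s 0] s assms(2) by (simp_all add: ac_simps)
    show "DERIV g s :> Du (x + h *\<^sub>R v + s *\<^sub>R u) - Du (x + s *\<^sub>R u)"
      unfolding g_def Du_def has_field_derivative_def
      by (rule has_derivative_eq_rhs,
          rule has_derivative_diff[OF has_derivative_along_line[OF assms(1) 1(1)]
            has_derivative_along_line[OF assms(1) 1(2)]])
         (auto simp: fun_eq_iff algebra_simps)
  qed
  then obtain s where s: "0 < s" "s < h"
    "g h - g 0 = h * (Du (x + h *\<^sub>R v + s *\<^sub>R u) - Du (x + s *\<^sub>R u))" by auto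
  have smD: "smooth_on S Du" unfolding Du_def by (rule smooth_on_frechet_derivative[OF assms(1)])
  have "\<exists>t. 0 < t \<and> t < h \<and> Du (x + s *\<^sub>R u + h *\<^sub>R v) - Du (x + s
    *\<^sub>R u + 0 *\<^sub>R v)
      = (h - 0) * frechet_derivative Du (at (x + s *\<^sub>R u + t *\<^sub>R v)) v"
  proof (rule MVT2[OF assms(2)])
    fix t assume t: "0 \<le> t" "t \<le> h"
    show "DERIV (\<lambda>t. Du (x + s *\<^sub>R u + t *\<^sub>R v)) t :> frechet_derivative Du (at
      (x + s *\<^sub>R u + t *\<^sub>R v)) v"
      unfolding has_field_derivative_def
      by (rule has_derivative_eq_rhs, rule has_derivative_along_line[OF smD])
         (use inS[of s t] t s in \<open>auto simp: fun_eq_iff\<close>)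
  qed
  then obtain t where t: "0 < t" "t < h" "Du (x + s *\<^sub>R u + h *\<^sub>R v) - Du (x + s
    *\<^sub>R u)
      = h * frechet_derivative Du (at (x + s *\<^sub>R u + t *\<^sub>R v)) v" by auto
  have "f (x + h *\<^sub>R u + h *\<^sub>R v) - f (x + h *\<^sub>R u) - f (x + h *\<^sub>R v) + f x
    = g h - g 0"
    by (simp add: g_def ac_simps)
  also have "\<dots> = h * h * frechet_derivative Du (at (x + s *\<^sub>R u + t *\<^sub>R v)) v"
    using s(3) t(3) by (simp add: ac_simps)
  finally show ?thesis using s t unfolding Du_def by blast
qed

text \<open>The same second difference is expressed in both orders of differentiation. Dividing by
  the square of h shows that the two mixed derivatives agree at points which tend to x with h, and
  continuity carries the equality to x.\<close>

lemma second_derivative_symmetric_real: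
  fixes f :: "'b::real_normed_vector \<Rightarrow> real"
  assumes "open S" "smooth_on S f" "x \<in> S"
  shows "frechet_derivative (\<lambda>y. frechet_derivative f (at y) u) (at x) v
       = frechet_derivative (\<lambda>y. frechet_derivative f (at y) v) (at x) u" (is "?F x = ?G x")
proof -
  obtain r where r: "r > 0" "ball x r \<subseteq> S" using assms openE by blast
  \<comment> \<open>The added 1 avoids a zero denominator if u = v = 0, the factor 1/2 makes the
    bound \<open>hr\<close> strict, and the last factor makes the sequence tend to 0.\<close>
  define h where "h n = r / (norm u + norm v + 1) / 2 * inverse (real (Suc n))" for n
  have h0: "h n > 0" for n using r by (simp add: h_def add_nonneg_pos)
  have hr: "h n * (norm u + norm v) < r" for n
  proof -
    have p: "norm u + norm v + 1 > 0" by (simp add: add_nonneg_pos)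
    have "h n * (norm u + norm v) \<le> h n * (norm u + norm v + 1)" using h0[of n] by simp
    also have "\<dots> = r / 2 * inverse (real (Suc n))"
    proof -
      have "r / c / 2 * i * c = r / 2 * i" if "c > 0" for c i :: real using that by simp
      from this[OF p] show ?thesis unfolding h_def .
    qed
    also have "\<dots> \<le> r / 2 * 1" using r by (intro mult_left_mono) (auto simp: divide_simps)
    also have "\<dots> < r" using r by simp
    finally show ?thesis .
  qed
  have "\<exists>s t. 0 < s \<and> s < h n \<and> 0 < t \<and> t < h n \<and> (\<exists>s' t'. 0 <
    s' \<and> s' < h n \<and> 0 < t' \<and> t' < h n \<and>
     ?F (x + s *\<^sub>R u + t *\<^sub>R v) = ?G (x + s' *\<^sub>R v + t' *\<^sub>R u))" for n
  proof -
    have hr': "h n * (norm v + norm u) < r" using hr[of n] by (simp add: add.commute)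
    obtain s t where st: "0 < s" "s < h n" "0 < t" "t < h n"
      "f (x + h n *\<^sub>R u + h n *\<^sub>R v) - f (x + h n *\<^sub>R u) - f (x + h n *\<^sub>R
        v) + f x =
       h n * h n * ?F (x + s *\<^sub>R u + t *\<^sub>R v)"
      using second_difference[OF assms(2) h0 r(2) hr] by blast
    obtain s' t' where st': "0 < s'" "s' < h n" "0 < t'" "t' < h n"
      "f (x + h n *\<^sub>R v + h n *\<^sub>R u) - f (x + h n *\<^sub>R v) - f (x + h n *\<^sub>R
        u) + f x =
       h n * h n * ?G (x + s' *\<^sub>R v + t' *\<^sub>R u)"
      using second_difference[OF assms(2) h0 r(2) hr'] by blast
    have "h n * h n * ?F (x + s *\<^sub>R u + t *\<^sub>R v) = h n * h n * ?G (x + s' *\<^sub>R v +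
      t' *\<^sub>R u)"
      unfolding st(5)[symmetric] st'(5)[symmetric] by (simp add: ac_simps)
    then have "?F (x + s *\<^sub>R u + t *\<^sub>R v) = ?G (x + s' *\<^sub>R v + t' *\<^sub>R u)"
      using h0[of n] by simp
    with st(1-4) st'(1-4) show ?thesis by blast
  qed
  then obtain s t s' t' where
    st: "\<And>n. 0 < s n \<and> s n < h n \<and> 0 < t n \<and> t n < h n" "\<And>n. 0 < s' n
      \<and> s' n < h n \<and> 0 < t' n \<and> t' n < h n" and
    eq: "\<And>n. ?F (x + s n *\<^sub>R u + t n *\<^sub>R v) = ?G (x + s' n *\<^sub>R v + t' n
      *\<^sub>R u)" by metis
  have hlim: "h \<longlonglongrightarrow> 0"
    unfolding h_def by (rule tendsto_mult_right_zero[OF LIMSEQ_inverse_real_of_nat])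
  have small: "q \<longlonglongrightarrow> 0" if "\<And>n. 0 < q n \<and> q n < h n" for q
    by (rule tendsto_sandwich[OF _ _ tendsto_const hlim]) (use that in \<open>auto intro!:
      always_eventually less_imp_le\<close>)
  have lim: "(\<lambda>n. x + q n *\<^sub>R a + q' n *\<^sub>R b) \<longlonglongrightarrow> x"
    if "\<And>n. 0 < q n \<and> q n < h n \<and> 0 < q' n \<and> q' n < h n" for q q' :: "nat
      \<Rightarrow> real" and a b
  proof -
    have "(\<lambda>n. x + q n *\<^sub>R a + q' n *\<^sub>R b) \<longlonglongrightarrow> x + 0
      *\<^sub>R a + 0 *\<^sub>R b"
      using that by (intro tendsto_intros small) auto
    then show ?thesis by simp
  qed
  have cont: "isCont ?F x" "isCont ?G x"
    using smooth_on_continuous[OF smooth_on_frechet_derivative[OF smooth_on_frechet_derivative[OF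
      assms(2)]]]
      assms continuous_on_eq_continuous_at by blast+
  have "(\<lambda>n. ?F (x + s n *\<^sub>R u + t n *\<^sub>R v)) \<longlonglongrightarrow> ?F x"
    using st by (intro isCont_tendsto_compose[OF cont(1)] lim) auto
  moreover have "(\<lambda>n. ?F (x + s n *\<^sub>R u + t n *\<^sub>R v)) \<longlonglongrightarrow>
    ?G x"
    unfolding eq using st by (intro isCont_tendsto_compose[OF cont(2)] lim) auto
  ultimately show ?thesis by (rule LIMSEQ_unique)
qed

lemma frechet_derivative_inner:
  assumes "f differentiable (at x)"
  shows "frechet_derivative (\<lambda>x. f x \<bullet> b) (at x) v = frechet_derivative f (at x) v
    \<bullet> b"
proof -
  have "((\<lambda>x. f x \<bullet> b) has_derivative (\<lambda>v. frechet_derivative f (at x) v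
    \<bullet> b)) (at x)"
    using assms by (intro has_derivative_inner_left) (simp add: frechet_derivative_works)
  then show ?thesis using frechet_derivative_at by metis
qed

text \<open>Inner products with a fixed vector commute with differentiation, and a vector is
  determined by its inner products; this reduces the claim to real functions.\<close>

lemma second_derivative_symmetric:
  fixes f :: "'b::real_normed_vector \<Rightarrow> 'c::real_inner"
  assumes "open S" "smooth_on S f" "x \<in> S"
  shows "frechet_derivative (\<lambda>y. frechet_derivative f (at y) u) (at x) v
       = frechet_derivative (\<lambda>y. frechet_derivative f (at y) v) (at x) u" (is "?l = ?r")
proof -
  have *: "frechet_derivative (\<lambda>y. frechet_derivative (\<lambda>x. f x \<bullet> b) (at y)
    u) (at x) v
      = frechet_derivative (\<lambda>y. frechet_derivative f (at y) u) (at x) v \<bullet> b" for b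
        u v
  proof -
    have d: "(\<lambda>y. frechet_derivative f (at y) u) differentiable (at x)"
      using smooth_on_differentiable smooth_on_frechet_derivative assms by blast
    have "frechet_derivative (\<lambda>y. frechet_derivative (\<lambda>x. f x \<bullet> b) (at y)
      u) (at x)
      = frechet_derivative (\<lambda>y. frechet_derivative f (at y) u \<bullet> b) (at x)"
    proof (rule sym, rule frechet_derivative_transform_within_open[OF _ assms(1,3)])
      show "(\<lambda>y. frechet_derivative f (at y) u \<bullet> b) differentiable (at x)"
        using d by simp
      show "frechet_derivative f (at y) u \<bullet> b = frechet_derivative (\<lambda>x. f x
        \<bullet> b) (at y) u"
        if "y \<in> S" for y
        using smooth_on_differentiable[OF assms(2) that] by (simp add: frechet_derivative_inner)
    qed
    then show ?thesis using frechet_derivative_inner[OF d] by simp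
  qed
  have "?l \<bullet> b = ?r \<bullet> b" for b
    using second_derivative_symmetric_real[OF assms(1) smooth_on_inner[OF assms(1,2)] assms(3), of
      b u v]
    unfolding * .
  then show ?thesis by (metis inner_commute vector_eq_rdot)
qed

section \<open>Vector fields on an open set\<close>


lemma sum_fun_apply: "(\<Sum>i\<in>I. F i) x = (\<Sum>i\<in>I. F i x)"
  by (induction I rule: infinite_finite_induct) auto

text \<open>Derivatives, brackets and forms on \<open>S\<close> vanish outside \<open>S\<close>, so that identities on \<open>S\<close> are
  equations between functions.\<close>

definition lie :: "'b::real_normed_vector set \<Rightarrow> ('b \<Rightarrow> 'b) \<Rightarrow> ('b
  \<Rightarrow> 'c::real_normed_vector) \<Rightarrow> 'b \<Rightarrow> 'c" where
  "lie S X f = (\<lambda>x. if x \<in> S then frechet_derivative f (at x) (X x) else 0)"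

definition vbracket :: "'b::real_normed_vector set \<Rightarrow> ('b \<Rightarrow> 'b)
  \<Rightarrow> ('b \<Rightarrow> 'b) \<Rightarrow> 'b \<Rightarrow> 'b" where
  "vbracket S X Y = lie S X Y - lie S Y X"

definition supported_smooth :: "'b::real_normed_vector set \<Rightarrow> ('b \<Rightarrow>
  'c::real_normed_vector) \<Rightarrow> bool" where
  "supported_smooth S f \<longleftrightarrow> smooth_on S f \<and> (\<forall>x. x \<notin> S
    \<longrightarrow> f x = 0)"

text \<open>The list contains the constant vectors into which the form is evaluated; the point comes last.\<close>

type_synonym 'b lform = "'b list \<Rightarrow> 'b \<Rightarrow> real"

definition fun_scale :: "('b \<Rightarrow> real) \<Rightarrow> 'b lform \<Rightarrow> 'b lform"
  where
  "fun_scale f a = (\<lambda>us. f * a us)"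

definition contract :: "('b \<Rightarrow> 'b) \<Rightarrow> 'b lform \<Rightarrow> 'b lform" where
  "contract X a = (\<lambda>us x. a (X x # us) x)"

definition contract_const :: "'b \<Rightarrow> 'b lform \<Rightarrow> 'b lform" where
  "contract_const u a = (\<lambda>us. a (u # us))"

text \<open>The Lie and exterior derivatives are defined by recursion on the arguments instead of by sums
  over all arguments; see \<open>lie_form_eq_sum\<close> and \<open>ext_d_eq_sum\<close>.\<close>

fun lie_form :: "'b::real_normed_vector set \<Rightarrow> ('b \<Rightarrow> 'b) \<Rightarrow> 'b
  lform \<Rightarrow> 'b lform" where
  "lie_form S X a [] = lie S X (a [])"
| "lie_form S X a (u # us) = lie_form S X (contract_const u a) us + contract (lie S (\<lambda>_. u)
  X) a us"

fun ext_d :: "'b::real_normed_vector set \<Rightarrow> 'b lform \<Rightarrow> 'b lform" where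
  "ext_d S a [] = 0"
| "ext_d S a (u # us) = lie S (\<lambda>_. u) (a us) - ext_d S (contract_const u a) us"

text \<open>This is df \<and> a, given by the recursion i_u (df \<and> a) = u(f) a - df \<and> i_u
  a.\<close>

fun wedge_d :: "'b::real_normed_vector set \<Rightarrow> ('b \<Rightarrow> real) \<Rightarrow> 'b
  lform \<Rightarrow> 'b lform" where
  "wedge_d S f a [] = 0"
| "wedge_d S f a (u # us) = lie S (\<lambda>_. u) f * a us - wedge_d S f (contract_const u a) us"

text \<open>The forms in \<open>alt_forms S k\<close> have degree \<open>k - 1\<close>, as degree \<open>-1\<close> is needed as well.\<close>

primrec alt_forms :: "'b::real_normed_vector set \<Rightarrow> nat \<Rightarrow> 'b lform set" where
  "alt_forms S 0 = {0}"
| "alt_forms S (Suc k) = {a. supported_smooth S (a []) \<and> (k \<noteq> 0 \<longrightarrow> a []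
  = 0) \<and>
     (\<forall>u v. contract_const (u + v) a = contract_const u a + contract_const v a) \<and>
       (\<forall>r u. contract_const (r *\<^sub>R u) a = fun_scale (\<lambda>_. r) (contract_const
         u a)) \<and>
     (\<forall>u. contract_const u a \<in> alt_forms S k) \<and> (\<forall>u. contract_const u
       (contract_const u a) = 0)}"

lemma fun_scale_apply [simp]: "fun_scale f a us x = f x * a us x"
  by (simp add: fun_scale_def)

lemma contract_const_apply [simp]: "contract_const u a us = a (u # us)"
  by (simp add: contract_const_def)

lemma contract_apply [simp]: "contract X a us x = a (X x # us) x"
  by (simp add: contract_def)

lemma contract_const: "contract (\<lambda>_. u) a = contract_const u a"
  by (simp add: fun_eq_iff)

lemma contract_const_simps [simp]: "contract_const u (a + b) = contract_const u a + contract_const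
  u b" "contract_const u (a - b) = contract_const u a - contract_const u b"
  "contract_const u (- a) = - contract_const u a" "contract_const u 0 = 0" "contract_const u
    (fun_scale f a) = fun_scale f (contract_const u a)"
  by (simp_all add: fun_eq_iff)

lemma lie_outside [simp]: "x \<notin> S \<Longrightarrow> lie S X f x = 0"
  by (simp add: lie_def)

lemma lie_const [simp]: "lie S X (\<lambda>_. c) = 0" "lie S X 0 = 0"
  by (simp_all add: lie_def fun_eq_iff zero_fun_def)

lemma supported_smooth_zero [simp]: "supported_smooth S 0"
  by (simp add: supported_smooth_def zero_fun_def)

text \<open>An orthonormal basis enters through the expansion identity, which makes every field a
  combination of constant fields with functions as coefficients.\<close>

locale local_calculus =
  fixes B :: "'b::real_inner set" and S :: "'b set"
  assumes finite_B: "finite B" and expand: "\<And>x. (\<Sum>b\<in>B. (x \<bullet> b) *\<^sub>R b) =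
    x" and open_S: "open S"
begin

lemmas smooth_intros = smooth_on_add[OF open_S] smooth_on_minus[OF open_S] smooth_on_diff[OF open_S]
  smooth_on_mult[OF open_S] smooth_on_scaleR[OF open_S] smooth_on_sum[OF open_S] smooth_on_inner[OF
    open_S]

section \<open>Derivatives along vector fields\<close>

lemma lie_eqI:
  assumes "x \<in> S" "(f has_derivative f') (at x)"
  shows "lie S X f x = f' (X x)"
  using assms frechet_derivative_at[OF assms(2)] by (simp add: lie_def)

lemma has_derivative_lie:
  assumes "smooth_on S f" "x \<in> S"
  shows "(f has_derivative (\<lambda>v. lie S (\<lambda>_. v) f x)) (at x)"
  using smooth_on_has_derivative[OF assms] assms(2) by (simp add: lie_def)

lemma lie_at: "lie S X f x = lie S (\<lambda>_. X x) f x"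
  by (simp add: lie_def)

lemma lie_add:
  assumes "smooth_on S f" "smooth_on S g"
  shows "lie S X (f + g) = lie S X f + lie S X g"
proof
  fix x show "lie S X (f + g) x = (lie S X f + lie S X g) x"
  proof (cases "x \<in> S")
    case True
    show ?thesis
      using lie_eqI[OF True has_derivative_add[OF has_derivative_lie[OF assms(1) True]
        has_derivative_lie[OF assms(2) True]], of X]
      by (simp add: plus_fun_def lie_at[of X])
  qed simp
qed

lemma lie_linear:
  assumes "smooth_on S f" "bounded_linear h"
  shows "lie S X (\<lambda>x. h (f x)) = (\<lambda>x. h (lie S X f x))"
proof
  fix x show "lie S X (\<lambda>x. h (f x)) x = h (lie S X f x)"
  proof (cases "x \<in> S")
    case True
    show ?thesis
      using lie_eqI[OF True bounded_linear.has_derivative[OF assms(2) has_derivative_lie[OF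
        assms(1) True]], of X]
      by (simp add: lie_at[of X])
  next
    case False
    then show ?thesis using assms(2) by (simp add: linear_simps)
  qed
qed

lemma lie_inner: "smooth_on S f \<Longrightarrow> lie S X (\<lambda>x. f x \<bullet> b) =
  (\<lambda>x. lie S X f x \<bullet> b)"
  by (rule lie_linear[OF _ bounded_linear_inner_left])

lemma lie_minus: "smooth_on S f \<Longrightarrow> lie S X (- f) = - lie S X f"
  using lie_linear[OF _ bounded_linear_minus[OF bounded_linear_ident], of f X] by (simp add:
    fun_Compl_def)

lemma lie_diff:
  assumes "smooth_on S f" "smooth_on S g"
  shows "lie S X (f - g) = lie S X f - lie S X g"
proof -
  have "smooth_on S (- g)" using smooth_on_minus[OF open_S assms(2)] by (simp add: fun_Compl_def)
  from lie_add[OF assms(1) this, of X] show ?thesis by (simp add: lie_minus assms)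
qed

lemma lie_scaleR:
  assumes "smooth_on S f" "smooth_on S g"
  shows "lie S X (\<lambda>x. f x *\<^sub>R g x) = (\<lambda>x. lie S X f x *\<^sub>R g x + f x
    *\<^sub>R lie S X g x)"
proof
  fix x show "lie S X (\<lambda>x. f x *\<^sub>R g x) x = lie S X f x *\<^sub>R g x + f x *\<^sub>R
    lie S X g x"
  proof (cases "x \<in> S")
    case True
    show ?thesis
      using lie_eqI[OF True has_derivative_scaleR[OF has_derivative_lie[OF assms(1) True]
        has_derivative_lie[OF assms(2) True]], of X]
      by (simp add: lie_at[of X])
  qed simp
qed

lemma lie_mult:
  fixes f g :: "'b \<Rightarrow> real"
  assumes "smooth_on S f" "smooth_on S g"
  shows "lie S X (f * g) = lie S X f * g + f * lie S X g"
  using lie_scaleR[OF assms, of X] by (simp add: times_fun_def plus_fun_def)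

lemma lie_sum:
  assumes "\<And>i. i \<in> I \<Longrightarrow> smooth_on S (f i)"
  shows "lie S X (\<lambda>x. \<Sum>i\<in>I. f i x) = (\<lambda>x. \<Sum>i\<in>I. lie S X (f i) x)"
  using assms
proof (induction I rule: infinite_finite_induct)
  case (insert i I)
  have "smooth_on S (\<lambda>x. \<Sum>i\<in>I. f i x)" using insert by (intro smooth_intros) auto
  then show ?case
    using lie_add[of "f i" "\<lambda>x. \<Sum>i\<in>I. f i x" X] insert by (simp add: plus_fun_def)
qed (simp_all add: zero_fun_def)

lemma lie_linear_field:
  assumes "smooth_on S f"
  shows "lie S (\<lambda>x. X x + Y x) f x = lie S X f x + lie S Y f x"
    and "lie S (\<lambda>x. X x - Y x) f x = lie S X f x - lie S Y f x"
    and "lie S (\<lambda>x. g x *\<^sub>R X x) f x = g x *\<^sub>R lie S X f x"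
    and "lie S (\<lambda>x. \<Sum>i\<in>I. Z i x) f x = (\<Sum>i\<in>I. lie S (Z i) f x)"
proof -
  have "linear (frechet_derivative f (at x))" if "x \<in> S"
    using linear_frechet_derivative smooth_on_differentiable[OF assms that] by blast
  then show "lie S (\<lambda>x. X x + Y x) f x = lie S X f x + lie S Y f x"
    and "lie S (\<lambda>x. X x - Y x) f x = lie S X f x - lie S Y f x"
    and "lie S (\<lambda>x. g x *\<^sub>R X x) f x = g x *\<^sub>R lie S X f x"
    and "lie S (\<lambda>x. \<Sum>i\<in>I. Z i x) f x = (\<Sum>i\<in>I. lie S (Z i) f x)"
    by (auto simp: lie_def linear_add linear_diff linear_scale linear_sum)
qed

text \<open>This form isolates the dependence on X in scalar coefficients, so that a further
  derivative can be taken by the product rule.\<close>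

lemma lie_expand:
  assumes "smooth_on S f"
  shows "lie S X f x = (\<Sum>b\<in>B. (X x \<bullet> b) *\<^sub>R lie S (\<lambda>_. b) f x)"
proof -
  have "lie S X f x = lie S (\<lambda>x. \<Sum>b\<in>B. (X x \<bullet> b) *\<^sub>R b) f x" by
    (simp add: expand)
  then show ?thesis by (simp only: lie_linear_field[OF assms])
qed

lemma smooth_lie_const: "smooth_on S f \<Longrightarrow> smooth_on S (lie S (\<lambda>_. v) f)"
  by (rule smooth_on_cong[OF open_S _ smooth_on_frechet_derivative[of S f v]]) (simp_all add:
    lie_def)

text \<open>\<open>Ck_on\<close> speaks of derivatives in a fixed direction. The varying direction
  \<open>X x\<close> is expanded in \<open>B\<close> to reduce to such derivatives.\<close>

lemma smooth_lie:
  assumes "smooth_on S X" "smooth_on S f"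
  shows "smooth_on S (lie S X f)"
  by (rule smooth_on_cong[OF open_S lie_expand[OF assms(2), symmetric]])
    (intro smooth_intros smooth_lie_const assms)

lemma supported_smooth_lie: "smooth_on S X \<Longrightarrow> smooth_on S f \<Longrightarrow>
  supported_smooth S (lie S X f)"
  by (simp add: supported_smooth_def smooth_lie)

lemma smooth_vbracket: "smooth_on S X \<Longrightarrow> smooth_on S Y \<Longrightarrow> smooth_on S
  (vbracket S X Y)"
  by (simp add: vbracket_def fun_diff_def smooth_intros smooth_lie)

section \<open>Commutators and the Jacobi identity for vector fields\<close>

lemma lie_commute_const:
  fixes f :: "'b \<Rightarrow> 'c::real_inner"
  assumes "smooth_on S f"
  shows "lie S (\<lambda>_. u) (lie S (\<lambda>_. v) f) = lie S (\<lambda>_. v) (lie S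
    (\<lambda>_. u) f)"
proof
  fix x show "lie S (\<lambda>_. u) (lie S (\<lambda>_. v) f) x = lie S (\<lambda>_. v) (lie S
    (\<lambda>_. u) f) x"
  proof (cases "x \<in> S")
    case True
    have "frechet_derivative (lie S (\<lambda>_. v) f) (at x) = frechet_derivative (\<lambda>y.
      frechet_derivative f (at y) v) (at x)" for v
      by (rule frechet_derivative_transform_within_open[OF _ open_S True])
        (simp_all add: lie_def smooth_on_differentiable[OF smooth_lie_const[OF assms] True,
          unfolded lie_def])
    then show ?thesis using True second_derivative_symmetric[OF open_S assms True]
      by (simp add: lie_def[of S _ "lie _ _ _"])
  qed simp
qed

text \<open>Expanding Y in the basis splits X(Y f) into the derivative of f along
  \<open>lie S X Y\<close> and a double sum of second derivatives. The double sum is symmetric in X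
  and Y and drops out of the commutator. The values of f are vectors, so f may itself be a field or
  a change of coordinates.\<close>

lemma lie_lie:
  fixes f :: "'b \<Rightarrow> 'c::real_inner"
  assumes "smooth_on S X" "smooth_on S Y" "smooth_on S f"
  shows "lie S X (lie S Y f) - lie S Y (lie S X f) = lie S (vbracket S X Y) f"
proof -
  have main: "lie S X (lie S Y f) x = lie S (lie S X Y) f x +
    (\<Sum>b\<in>B. \<Sum>c\<in>B. ((Y x \<bullet> b) * (X x \<bullet> c)) *\<^sub>R lie S
      (\<lambda>_. c) (lie S (\<lambda>_. b) f) x)"
    if "smooth_on S X" "smooth_on S Y" for X Y x
  proof -
    have "lie S Y f = (\<lambda>x. \<Sum>b\<in>B. (Y x \<bullet> b) *\<^sub>R lie S (\<lambda>_. b)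
      f x)"
      using lie_expand[OF assms(3)] by blast
    then have "lie S X (lie S Y f) x = (\<Sum>b\<in>B. (lie S X Y x \<bullet> b) *\<^sub>R lie S
      (\<lambda>_. b) f x +
        (Y x \<bullet> b) *\<^sub>R lie S X (lie S (\<lambda>_. b) f) x)"
      using that assms
      by (simp add: lie_sum lie_scaleR smooth_intros smooth_lie_const lie_inner)
    also have "\<dots> = lie S (lie S X Y) f x + (\<Sum>b\<in>B. (Y x \<bullet> b) *\<^sub>R lie S
      X (lie S (\<lambda>_. b) f) x)"
      by (simp add: sum.distrib lie_expand[OF assms(3), of "lie S X Y"])
    also have "(\<Sum>b\<in>B. (Y x \<bullet> b) *\<^sub>R lie S X (lie S (\<lambda>_. b) f) x) =
      (\<Sum>b\<in>B. \<Sum>c\<in>B. ((Y x \<bullet> b) * (X x \<bullet> c)) *\<^sub>R lie S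
        (\<lambda>_. c) (lie S (\<lambda>_. b) f) x)"
      by (simp add: lie_expand[OF smooth_lie_const[OF assms(3)], of X] scaleR_sum_right)
    finally show ?thesis .
  qed
  have sym: "(\<Sum>b\<in>B. \<Sum>c\<in>B. ((Y x \<bullet> b) * (X x \<bullet> c)) *\<^sub>R lie S
    (\<lambda>_. c) (lie S (\<lambda>_. b) f) x) =
    (\<Sum>b\<in>B. \<Sum>c\<in>B. ((X x \<bullet> b) * (Y x \<bullet> c)) *\<^sub>R lie S
      (\<lambda>_. c) (lie S (\<lambda>_. b) f) x)" for x
    by (subst sum.swap) (simp add: lie_commute_const[OF assms(3)] mult.commute)
  show ?thesis
  proof
    fix x
    show "(lie S X (lie S Y f) - lie S Y (lie S X f)) x = lie S (vbracket S X Y) f x"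
      using main[OF assms(1,2), of x] main[OF assms(2,1), of x] sym[of x]
        lie_linear_field(2)[OF assms(3), of "lie S X Y" "lie S Y X" x]
      by (simp add: vbracket_def fun_diff_def)
  qed
qed

lemma vbracket_const: "vbracket S (\<lambda>_. u) X = lie S (\<lambda>_. u) X"
  by (simp add: vbracket_def)

text \<open>Since [u, X] is \<open>lie S (\<lambda>_. u) X\<close> for constant u, this is the
  Jacobi identity in derivation form, ready for splitting off an argument vector in
  \<open>lie_form_lie_form\<close>.\<close>

lemma lie_vbracket:
  assumes "smooth_on S X" "smooth_on S Y"
  shows "lie S (\<lambda>_. u) (vbracket S X Y) = vbracket S X (lie S (\<lambda>_. u) Y) - vbracket
    S Y (lie S (\<lambda>_. u) X)"
  using lie_lie[OF smooth_on_const assms, of u] lie_lie[OF smooth_on_const assms(2,1), of u] assms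
  by (simp add: vbracket_const) (simp add: vbracket_def lie_diff smooth_lie algebra_simps)

text \<open>By \<open>lie_lie\<close>, applied to the components of a field as f, a double bracket
  becomes four iterated derivatives without brackets. The twelve terms of the cyclic sum cancel in
  pairs.\<close>

lemma vbracket_jacobi:
  assumes "smooth_on S X" "smooth_on S Y" "smooth_on S Z"
  shows "vbracket S X (vbracket S Y Z) + vbracket S Y (vbracket S Z X) + vbracket S Z (vbracket S X
    Y) = 0"
proof -
  have *: "vbracket S X (vbracket S Y Z) = lie S X (lie S Y Z) - lie S X (lie S Z Y)
      - lie S Y (lie S Z X) + lie S Z (lie S Y X)" if "smooth_on S X" "smooth_on S Y" "smooth_on S
        Z"
    for X Y Z
    using lie_lie[OF that(2,3,1)] that lie_diff[of "lie S Y Z" "lie S Z Y" X]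
    by (simp add: vbracket_def smooth_lie algebra_simps)
  show ?thesis using assms by (simp add: *)
qed

end

section \<open>Cartan calculus on an open set\<close>


text \<open>Higher-order unification eta-expands zero forms to \<open>\<lambda>us x. 0\<close>.\<close>

lemma zero_fun_fold [simp]: "(\<lambda>x. 0) = 0"
  by (simp add: zero_fun_def)

context local_calculus
begin

section \<open>Algebra of alternating forms\<close>

lemma alt_forms_zero [simp]: "0 \<in> alt_forms S k"
proof -
  have "a = 0 \<Longrightarrow> a \<in> alt_forms S k" for a
  proof (induction k arbitrary: a)
    case (Suc k)
    have "fun_scale (\<lambda>_. r) (0 :: 'b lform) = 0" for r by (simp add: fun_eq_iff)
    then show ?case using Suc by simp
  qed simp
  then show ?thesis by blast
qed

lemma alt_forms_smooth: "a \<in> alt_forms S k \<Longrightarrow> supported_smooth S (a us)"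
proof (induction us arbitrary: a k)
  case Nil
  then show ?case by (cases k) auto
next
  case (Cons u us)
  then show ?case
  proof (cases k)
    case (Suc j)
    then have "contract_const u a \<in> alt_forms S j" using Cons.prems by simp
    from Cons.IH[OF this] show ?thesis by simp
  qed (use Cons.prems in auto)
qed

lemma alt_forms_smooth_on [simp]: "a \<in> alt_forms S k \<Longrightarrow> smooth_on S (a us)"
  using alt_forms_smooth by (auto simp: supported_smooth_def)

lemma alt_forms_outside: "a \<in> alt_forms S k \<Longrightarrow> x \<notin> S \<Longrightarrow> a
  us x = 0"
  using alt_forms_smooth by (auto simp: supported_smooth_def)

lemma alt_forms_length: "a \<in> alt_forms S k \<Longrightarrow> Suc (length us) \<noteq> k
  \<Longrightarrow> a us = 0"
proof (induction us arbitrary: a k)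
  case Nil
  then show ?case by (cases k) auto
next
  case (Cons u us)
  then show ?case
  proof (cases k)
    case (Suc j)
    then have "contract_const u a \<in> alt_forms S j" using Cons.prems by simp
    from Cons.IH[OF this] Cons.prems Suc show ?thesis by simp
  qed (use Cons.prems in auto)
qed

lemma smooth_plus [simp]: "smooth_on S f \<Longrightarrow> smooth_on S g \<Longrightarrow>
  smooth_on S (f + g)"
  using smooth_intros(1)[of f g] by (simp add: plus_fun_def)

lemma smooth_times [simp]:
  fixes f g :: "'b \<Rightarrow> real"
  shows "smooth_on S f \<Longrightarrow> smooth_on S g \<Longrightarrow> smooth_on S (f * g)"
  using smooth_intros(4)[of f g] by (simp add: times_fun_def)

lemma alt_forms_SucI:
  assumes "supported_smooth S (a [])" "k \<noteq> 0 \<Longrightarrow> a [] = 0"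
    "\<And>u v us x. a ((u + v) # us) x = a (u # us) x + a (v # us) x"
    "\<And>r u us x. a (r *\<^sub>R u # us) x = r * a (u # us) x"
    "\<And>u. contract_const u a \<in> alt_forms S k" "\<And>u us x. a (u # u # us) x = 0"
  shows "a \<in> alt_forms S (Suc k)"
  using assms by (auto simp: fun_eq_iff)

lemma alt_forms_SucD:
  assumes "a \<in> alt_forms S (Suc k)"
  shows "supported_smooth S (a [])" "k \<noteq> 0 \<Longrightarrow> a [] = 0"
    "a ((u + v) # us) x = a (u # us) x + a (v # us) x"
    "a (r *\<^sub>R u # us) x = r * a (u # us) x"
    "contract_const u a \<in> alt_forms S k" "a (u # u # us) x = 0"
proof -
  have "contract_const (u + v) a = contract_const u a + contract_const v a" "contract_const (r
    *\<^sub>R u) a = fun_scale (\<lambda>_. r) (contract_const u a)" "contract_const u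
      (contract_const u a) = 0"
    using assms by simp_all
  then show "a ((u + v) # us) x = a (u # us) x + a (v # us) x"
    "a (r *\<^sub>R u # us) x = r * a (u # us) x" "a (u # u # us) x = 0"
    by (metis contract_const_apply plus_fun_apply, metis contract_const_apply fun_scale_apply,
      metis contract_const_apply zero_fun_apply)
qed (use assms in auto)

lemma alt_forms_add: "a \<in> alt_forms S k \<Longrightarrow> b \<in> alt_forms S k
  \<Longrightarrow> a + b \<in> alt_forms S k"
proof (induction k arbitrary: a b)
  case (Suc k)
  note a = alt_forms_SucD[OF Suc.prems(1)] and b = alt_forms_SucD[OF Suc.prems(2)]
  have contract_const: "contract_const u a + contract_const u b \<in> alt_forms S k" for u by (rule
    Suc.IH[OF a(5) b(5)])
  show ?case
    by (rule alt_forms_SucI[of "a + b"])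
      (use a(1,2) b(1,2) contract_const in \<open>simp_all add: supported_smooth_def a(3,4,6)
        b(3,4,6) distrib_left\<close>)
qed simp

lemma alt_forms_fun_scale: "smooth_on S f \<Longrightarrow> a \<in> alt_forms S k \<Longrightarrow>
  fun_scale f a \<in> alt_forms S k"
proof (induction k arbitrary: a)
  case 0
  then show ?case by (simp add: fun_eq_iff)
next
  case (Suc k)
  note a = alt_forms_SucD[OF Suc.prems(2)]
  have contract_const: "fun_scale f (contract_const u a) \<in> alt_forms S k" for u by (rule
    Suc.IH[OF Suc.prems(1) a(5)])
  show ?case
    by (rule alt_forms_SucI[of "fun_scale f a"])
      (use a(1,2) contract_const Suc.prems(1) in
        \<open>simp_all add: supported_smooth_def a(3,4,6) distrib_left\<close>, simp_all add:
          fun_scale_def)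
qed

lemma alt_forms_uminus: "a \<in> alt_forms S k \<Longrightarrow> - a \<in> alt_forms S k"
proof -
  assume "a \<in> alt_forms S k"
  then have "fun_scale (\<lambda>_. - 1) a \<in> alt_forms S k" by (rule alt_forms_fun_scale[OF
    smooth_on_const])
  also have "fun_scale (\<lambda>_. - 1) a = - a" by (simp add: fun_eq_iff)
  finally show ?thesis .
qed

lemma alt_forms_diff: "a \<in> alt_forms S k \<Longrightarrow> b \<in> alt_forms S k
  \<Longrightarrow> a - b \<in> alt_forms S k"
  using alt_forms_add[of a k "- b"] alt_forms_uminus[of b k] by simp

lemma alt_forms_sum: "(\<And>i. i \<in> I \<Longrightarrow> F i \<in> alt_forms S k)
  \<Longrightarrow> (\<Sum>i\<in>I. F i) \<in> alt_forms S k"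
  by (induction I rule: infinite_finite_induct) (auto intro: alt_forms_add)

text \<open>The truncated difference k - 1 is also right at k = 0, where the only form is 0.\<close>

lemma alt_forms_contract_const [simp]: "a \<in> alt_forms S k \<Longrightarrow> contract_const u a
  \<in> alt_forms S (k - 1)"
  by (cases k) auto

lemma alt_forms_head_add: "a \<in> alt_forms S k \<Longrightarrow> a ((u + v) # us) x = a (u # us)
  x + a (v # us) x"
proof (cases k)
  case (Suc j)
  assume "a \<in> alt_forms S k"
  then have "contract_const (u + v) a us x = (contract_const u a + contract_const v a) us x" using
    Suc by simp
  then show ?thesis by simp
qed auto

lemma alt_forms_head_scale: "a \<in> alt_forms S k \<Longrightarrow> a (r *\<^sub>R u # us) x = r *
  a (u # us) x"
proof (cases k)
  case (Suc j)
  assume "a \<in> alt_forms S k"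
  then have "contract_const (r *\<^sub>R u) a us x = fun_scale (\<lambda>_. r) (contract_const u a)
    us x" using Suc by simp
  then show ?thesis by simp
qed auto

lemma alt_forms_head_linear: "a \<in> alt_forms S k \<Longrightarrow> linear (\<lambda>u. a (u #
  us) x)"
  by (rule linearI) (simp_all add: alt_forms_head_add alt_forms_head_scale)

lemma alt_forms_double: "a \<in> alt_forms S k \<Longrightarrow> a (u # u # us) x = 0"
proof (cases k)
  case (Suc j)
  assume "a \<in> alt_forms S k"
  then have "contract_const u (contract_const u a) us x = 0" using Suc by simp
  then show ?thesis by simp
qed auto

lemma alt_forms_swap:
  assumes "a \<in> alt_forms S k"
  shows "a (u # v # us) x = - a (v # u # us) x"
proof -
  have "contract_const w a (y # us) x = a (w # y # us) x" for w y by simp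
  then have 1: "a (w # (y + z) # us) x = a (w # y # us) x + a (w # z # us) x" for w y z
    using alt_forms_head_add[OF alt_forms_contract_const[OF assms], of w y z us x] by simp
  have "a ((u + v) # (u + v) # us) x = 0" by (rule alt_forms_double[OF assms])
  then show ?thesis
    using alt_forms_double[OF assms, of u us x] alt_forms_double[OF assms, of v us x]
    by (simp add: alt_forms_head_add[OF assms] 1)
qed

lemma alt_forms_head_expand:
  assumes "a \<in> alt_forms S k"
  shows "a (w # us) x = (\<Sum>b\<in>B. (w \<bullet> b) * a (b # us) x)"
proof -
  have "a (w # us) x = a ((\<Sum>b\<in>B. (w \<bullet> b) *\<^sub>R b) # us) x" by (simp add:
    expand)
  also have "\<dots> = (\<Sum>b\<in>B. (w \<bullet> b) * a (b # us) x)"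
    by (simp add: linear_sum[OF alt_forms_head_linear[OF assms]] alt_forms_head_scale[OF assms])
  finally show ?thesis .
qed

text \<open>Reduces contraction with a field to contractions with constant vectors, on which the
  recursive definitions act directly, at the price of function coefficients.\<close>

lemma contract_expand:
  assumes "a \<in> alt_forms S k"
  shows "contract X a = (\<Sum>b\<in>B. fun_scale (\<lambda>x. X x \<bullet> b) (contract_const b
    a))"
proof (intro ext)
  fix us x show "contract X a us x = (\<Sum>b\<in>B. fun_scale (\<lambda>x. X x \<bullet> b)
    (contract_const b a)) us x"
    using alt_forms_head_expand[OF assms, of "X x" us x] by (simp add: sum_fun_apply)
qed

lemma alt_forms_contract [simp]: "smooth_on S X \<Longrightarrow> a \<in> alt_forms S k
  \<Longrightarrow> contract X a \<in> alt_forms S (k - 1)"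
  by (simp only: contract_expand) (intro alt_forms_sum alt_forms_fun_scale smooth_intros
    alt_forms_contract_const)

lemma contract_add: "contract X (a + b) = contract X a + contract X b"
  and contract_diff: "contract X (a - b) = contract X a - contract X b"
  and contract_fun_scale: "contract X (fun_scale f a) = fun_scale f (contract X a)"
  by (simp_all add: fun_eq_iff)

lemma fun_scale_diff: "fun_scale f (a - b) = fun_scale f a - fun_scale f b"
  and fun_scale_add: "fun_scale f (a + b) = fun_scale f a + fun_scale f b"
  by (simp_all add: fun_eq_iff algebra_simps)

lemma contract_swap: "a \<in> alt_forms S k \<Longrightarrow> contract X (contract Y a) = -
  contract Y (contract X a)"
  by (auto simp: fun_eq_iff intro: alt_forms_swap)

lemma contract_field:
  assumes "a \<in> alt_forms S k"
  shows "contract (X + Y) a = contract X a + contract Y a" "contract (X - Y) a = contract X a -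
    contract Y a"
    "contract (\<lambda>x. f x *\<^sub>R X x) a = fun_scale f (contract X a)"
  using linear_diff[OF alt_forms_head_linear[OF assms]]
  by (simp_all add: fun_eq_iff alt_forms_head_add[OF assms] alt_forms_head_scale[OF assms])

lemma alt_forms_contract_const_linear:
  assumes "a \<in> alt_forms S k"
  shows "contract_const (u + v) a = contract_const u a + contract_const v a" "contract_const (r
    *\<^sub>R u) a = fun_scale (\<lambda>_. r) (contract_const u a)" "contract_const u
      (contract_const u a) = 0"
  by (simp_all add: fun_eq_iff alt_forms_head_add[OF assms] alt_forms_head_scale[OF assms]
    alt_forms_double[OF assms])

declare alt_forms.simps(2) [simp del]

section \<open>Linearity and product rules for the Lie and exterior derivatives\<close>

lemma lie_form_add:
  "a \<in> alt_forms S k \<Longrightarrow> b \<in> alt_forms S k \<Longrightarrow> lie_form S X (a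
    + b) = lie_form S X a + lie_form S X b"
proof
  fix us show "a \<in> alt_forms S k \<Longrightarrow> b \<in> alt_forms S k \<Longrightarrow>
    lie_form S X (a + b) us = (lie_form S X a + lie_form S X b) us"
  proof (induction us arbitrary: a b k)
    case (Cons u us)
    have "lie_form S X (contract_const u a + contract_const u b) us = lie_form S X (contract_const
      u a) us + lie_form S X (contract_const u b) us"
      using Cons.IH[OF alt_forms_contract_const[OF Cons.prems(1)] alt_forms_contract_const[OF
        Cons.prems(2)], of u u]
      unfolding plus_fun_apply .
    then show "lie_form S X (a + b) (u # us) = (lie_form S X a + lie_form S X b) (u # us)"
      by (simp add: contract_add)
  qed (simp add: lie_add)
qed

lemma lie_form_zero [simp]: "lie_form S X 0 = 0"
proof
  fix us show "lie_form S X 0 us = 0 us" by (induction us) (auto simp: fun_eq_iff)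
qed

lemma lie_form_fun_scale:
  assumes "smooth_on S f" "a \<in> alt_forms S k"
  shows "lie_form S X (fun_scale f a) = fun_scale f (lie_form S X a) + fun_scale (lie S X f) a"
proof
  fix us show "lie_form S X (fun_scale f a) us = (fun_scale f (lie_form S X a) + fun_scale (lie S X
    f) a) us"
    using assms(2)
  proof (induction us arbitrary: a k)
    case Nil
    have "lie S X (f * a []) = lie S X f * a [] + f * lie S X (a [])"
      by (rule lie_mult[OF assms(1) alt_forms_smooth_on[OF Nil]])
    then show ?case by (simp only: lie_form.simps fun_scale_def plus_fun_apply add.commute)
  next
    case (Cons u us)
    have "lie_form S X (fun_scale f (contract_const u a)) us = f * lie_form S X (contract_const u
      a) us + lie S X f * a (u # us)"
      using Cons.IH[OF alt_forms_contract_const[OF Cons.prems], of u] unfolding plus_fun_apply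
        fun_scale_def contract_const_apply .
    then show "lie_form S X (fun_scale f a) (u # us) = (fun_scale f (lie_form S X a) + fun_scale
      (lie S X f) a) (u # us)"
      unfolding lie_form.simps plus_fun_apply contract_const_simps contract_fun_scale by (simp add:
        fun_scale_def algebra_simps)
  qed
qed

lemma lie_form_uminus: "a \<in> alt_forms S k \<Longrightarrow> lie_form S X (- a) = - lie_form S X
  a"
  using lie_form_add[of a k "- a" X] by (metis lie_form_zero add.right_inverse alt_forms_uminus
    minus_unique)

lemma lie_form_diff: "a \<in> alt_forms S k \<Longrightarrow> b \<in> alt_forms S k
  \<Longrightarrow> lie_form S X (a - b) = lie_form S X a - lie_form S X b"
  using lie_form_add[of a k "- b" X] by (simp add: alt_forms_uminus lie_form_uminus)

lemma lie_form_sum: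
  "(\<And>i. i \<in> I \<Longrightarrow> F i \<in> alt_forms S k) \<Longrightarrow> lie_form S X
    (\<Sum>i\<in>I. F i) = (\<Sum>i\<in>I. lie_form S X (F i))"
  by (induction I rule: infinite_finite_induct) (auto simp: lie_form_add[of _ k] alt_forms_sum)

lemma contract_const_lie_form: "contract_const u (lie_form S X a) = lie_form S X (contract_const u
  a) + contract (lie S (\<lambda>_. u) X) a"
  by (simp add: fun_eq_iff)

lemma alt_forms_lie_form [simp]: "smooth_on S X \<Longrightarrow> a \<in> alt_forms S k
  \<Longrightarrow> lie_form S X a \<in> alt_forms S k"
proof (induction k arbitrary: a)
  case 0
  then show ?case by simp
next
  case (Suc k)
  note X = Suc.prems(1) and a = Suc.prems(2)
  have ica: "contract_const u a \<in> alt_forms S k" for u using alt_forms_contract_const[OF a] by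
    simp
  have contract_const: "contract_const u (lie_form S X a) \<in> alt_forms S k" for u
    unfolding contract_const_lie_form using alt_forms_add[OF Suc.IH[OF X ica] alt_forms_contract[OF
      smooth_lie[OF smooth_on_const X] a, simplified]] .
  show ?case
  proof (rule alt_forms_SucI)
    show "supported_smooth S (lie_form S X a [])"
      using supported_smooth_lie[OF X alt_forms_smooth_on[OF a]] by simp
    show "lie_form S X a [] = 0" if "k \<noteq> 0"
      using alt_forms_SucD(2)[OF a that] by simp
    show "contract_const u (lie_form S X a) \<in> alt_forms S k" for u by (rule contract_const)
    show "lie_form S X a ((u + v) # us) x = lie_form S X a (u # us) x + lie_form S X a (v # us) x"
      for u v us x
    proof -
      note alt_forms_contract_const_linear(1)[OF a, of u v]
      then show ?thesis
        using lie_linear_field(1)[OF X, of "\<lambda>_. u" "\<lambda>_. v"]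
        by (simp add: lie_form_add[OF ica ica] alt_forms_head_add[OF a])
    qed
    show "lie_form S X a (r *\<^sub>R u # us) x = r * lie_form S X a (u # us) x" for r u us x
    proof -
      note alt_forms_contract_const_linear(2)[OF a, of r u]
      then show ?thesis
        using lie_linear_field(3)[OF X, of "\<lambda>_. r" "\<lambda>_. u"]
        by (simp add: lie_form_fun_scale[OF smooth_on_const ica] alt_forms_head_scale[OF a]
          algebra_simps)
    qed
    \<comment> \<open>The recursion leaves a on ([u,X], u) and a on (u, [u,X]), which cancel by
      antisymmetry; the remaining term is the Lie derivative of i_u i_u a = 0.\<close>
    show "lie_form S X a (u # u # us) x = 0" for u us x
    proof -
      note alt_forms_contract_const_linear(3)[OF a, of u]
      then show ?thesis using alt_forms_swap[OF a, of u] by simp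
    qed
  qed
qed

text \<open>A constant field commutes with the constant argument vectors, so that no bracket terms
  appear.\<close>

lemma lie_form_const: "a \<in> alt_forms S k \<Longrightarrow> lie_form S (\<lambda>_. u) a us =
  lie S (\<lambda>_. u) (a us)"
proof (induction us arbitrary: a k)
  case (Cons v us)
  have "a (0 # us) x = 0" for us x using alt_forms_head_scale[OF Cons.prems, of 0] by simp
  then have "contract 0 a us = 0" by (simp add: fun_eq_iff)
  moreover have "lie_form S (\<lambda>_. u) (contract_const v a) us = lie S (\<lambda>_. u)
    (contract_const v a us)"
    by (rule Cons.IH[OF alt_forms_contract_const[OF Cons.prems]])
  ultimately show "lie_form S (\<lambda>_. u) a (v # us) = lie S (\<lambda>_. u) (a (v # us))" by
    simp
qed simp

lemma ext_d_zero [simp]: "ext_d S 0 = 0"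
proof
  fix us show "ext_d S 0 us = 0 us" by (induction us) (auto simp: fun_eq_iff)
qed

lemma ext_d_add: "a \<in> alt_forms S k \<Longrightarrow> b \<in> alt_forms S k \<Longrightarrow>
  ext_d S (a + b) = ext_d S a + ext_d S b"
proof
  fix us show "a \<in> alt_forms S k \<Longrightarrow> b \<in> alt_forms S k \<Longrightarrow>
    ext_d S (a + b) us = (ext_d S a + ext_d S b) us"
  proof (induction us arbitrary: a b k)
    case (Cons u us)
    have "ext_d S (contract_const u a + contract_const u b) us = ext_d S (contract_const u a) us +
      ext_d S (contract_const u b) us"
      using Cons.IH[OF alt_forms_contract_const[OF Cons.prems(1)] alt_forms_contract_const[OF
        Cons.prems(2)], of u u]
      unfolding plus_fun_apply .
    then show "ext_d S (a + b) (u # us) = (ext_d S a + ext_d S b) (u # us)"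
      using lie_add[OF alt_forms_smooth_on[OF Cons.prems(1)] alt_forms_smooth_on[OF Cons.prems(2)]]
        by simp
  qed simp
qed

lemma ext_d_uminus: "a \<in> alt_forms S k \<Longrightarrow> ext_d S (- a) = - ext_d S a"
  using ext_d_add[of a k "- a"] by (metis ext_d_zero add.right_inverse alt_forms_uminus
    minus_unique)

lemma ext_d_diff: "a \<in> alt_forms S k \<Longrightarrow> b \<in> alt_forms S k \<Longrightarrow>
  ext_d S (a - b) = ext_d S a - ext_d S b"
  using ext_d_add[of a k "- b"] by (simp add: alt_forms_uminus ext_d_uminus)

lemma ext_d_fun_scale:
  assumes "smooth_on S f" "a \<in> alt_forms S k"
  shows "ext_d S (fun_scale f a) = fun_scale f (ext_d S a) + wedge_d S f a"
proof
  fix us show "ext_d S (fun_scale f a) us = (fun_scale f (ext_d S a) + wedge_d S f a) us"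
    using assms(2)
  proof (induction us arbitrary: a k)
    case Nil
    then show ?case by (simp add: fun_scale_def)
  next
    case (Cons u us)
    have 1: "lie S (\<lambda>_. u) (fun_scale f a us) = lie S (\<lambda>_. u) f * a us + f * lie S
      (\<lambda>_. u) (a us)"
      using lie_mult[OF assms(1), of "a us"] Cons.prems by (simp add: fun_scale_def)
    have 2: "ext_d S (fun_scale f (contract_const u a)) us x = f x * ext_d S (contract_const u a)
      us x + wedge_d S f (contract_const u a) us x" for x
      using fun_cong[OF Cons.IH[OF alt_forms_contract_const[OF Cons.prems]]] unfolding
        plus_fun_apply fun_scale_apply .
    show "ext_d S (fun_scale f a) (u # us) = (fun_scale f (ext_d S a) + wedge_d S f a) (u # us)"
    proof
      fix x show "ext_d S (fun_scale f a) (u # us) x = (fun_scale f (ext_d S a) + wedge_d S f a) (u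
        # us) x"
        using fun_cong[OF 1, of x] 2[of x] by (simp add: algebra_simps)
    qed
  qed
qed

lemma ext_d_scale: "a \<in> alt_forms S k \<Longrightarrow> ext_d S (fun_scale (\<lambda>_. r) a) =
  fun_scale (\<lambda>_. r) (ext_d S a)"
proof -
  have "wedge_d S (\<lambda>_. r) a us = 0" for us a by (induction us arbitrary: a) (auto simp:
    fun_eq_iff)
  then show "a \<in> alt_forms S k \<Longrightarrow> ext_d S (fun_scale (\<lambda>_. r) a) =
    fun_scale (\<lambda>_. r) (ext_d S a)"
    by (simp add: ext_d_fun_scale fun_eq_iff)
qed

lemma lie_form_scale: "a \<in> alt_forms S k \<Longrightarrow> lie_form S X (fun_scale (\<lambda>_.
  r) a) = fun_scale (\<lambda>_. r) (lie_form S X a)"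
  by (simp add: lie_form_fun_scale fun_eq_iff)

lemma contract_const_ext_d: "a \<in> alt_forms S k \<Longrightarrow> contract_const u (ext_d S a) =
  lie_form S (\<lambda>_. u) a - ext_d S (contract_const u a)"
  by (simp add: fun_eq_iff lie_form_const)

lemma alt_forms_ext_d [simp]: "a \<in> alt_forms S k \<Longrightarrow> ext_d S a \<in> alt_forms S
  (Suc k)"
proof (induction k arbitrary: a)
  case 0
  then have "ext_d S a = 0" by simp
  then show ?case by (metis alt_forms_zero)
next
  case (Suc k)
  note a = Suc.prems
  have ica: "contract_const u a \<in> alt_forms S k" for u using alt_forms_contract_const[OF a] by
    simp
  show ?case
  proof (rule alt_forms_SucI)
    show "contract_const u (ext_d S a) \<in> alt_forms S (Suc k)" for u
      unfolding contract_const_ext_d[OF a] by (rule alt_forms_diff[OF alt_forms_lie_form[OF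
        smooth_on_const a] Suc.IH[OF ica]])
    show "ext_d S a ((u + v) # us) x = ext_d S a (u # us) x + ext_d S a (v # us) x" for u v us x
    proof -
      note alt_forms_contract_const_linear(1)[OF a, of u v]
      then show ?thesis
        using lie_linear_field(1)[OF alt_forms_smooth_on[OF a], of "\<lambda>_. u" "\<lambda>_. v"
          us]
        by (simp add: ext_d_add[OF ica ica])
    qed
    show "ext_d S a (r *\<^sub>R u # us) x = r * ext_d S a (u # us) x" for r u us x
    proof -
      note alt_forms_contract_const_linear(2)[OF a, of r u]
      then show ?thesis
        using lie_linear_field(3)[OF alt_forms_smooth_on[OF a], of "\<lambda>_. r" "\<lambda>_. u"
          us]
        by (simp add: ext_d_scale[OF ica] algebra_simps)
    qed
    show "ext_d S a (u # u # us) x = 0" for u us x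
    proof -
      note alt_forms_contract_const_linear(3)[OF a, of u]
      then show ?thesis by simp
    qed
  qed auto
qed

section \<open>Cartan identities for arbitrary fields\<close>

text \<open>With Y expanded in the basis, the two halves of [X,Y] have different origins: the
  product rule differentiates the coefficients of Y and gives \<open>lie S X Y\<close>, while
  commuting L_X with each i_b gives \<open>lie S Y X\<close> with the opposite sign.\<close>

theorem lie_form_contract:
  assumes "smooth_on S X" "smooth_on S Y" "a \<in> alt_forms S k"
  shows "lie_form S X (contract Y a) = contract Y (lie_form S X a) + contract (vbracket S X Y) a"
proof (intro ext)
  fix us x
  have Yb: "smooth_on S (\<lambda>x. Y x \<bullet> b)" for b by (rule smooth_on_inner[OF open_S
    assms(2)])
  have "lie_form S X (contract Y a) = (\<Sum>b\<in>B. lie_form S X (fun_scale (\<lambda>x. Y x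
    \<bullet> b) (contract_const b a)))"
    unfolding contract_expand[OF assms(3)]
    by (rule lie_form_sum[OF alt_forms_fun_scale[OF Yb alt_forms_contract_const[OF assms(3)]]])
  also have "\<dots> = (\<Sum>b\<in>B. fun_scale (\<lambda>x. Y x \<bullet> b) (contract_const b
    (lie_form S X a)) - fun_scale (\<lambda>x. Y x \<bullet> b) (contract (lie S (\<lambda>_. b) X)
      a)
      + fun_scale (\<lambda>x. lie S X Y x \<bullet> b) (contract_const b a))"
  proof (intro sum.cong refl)
    fix b
    have "lie_form S X (contract_const b a) = contract_const b (lie_form S X a) - contract (lie S
      (\<lambda>_. b) X) a" by (simp only: contract_const_lie_form add_diff_cancel_right')
    then show "lie_form S X (fun_scale (\<lambda>x. Y x \<bullet> b) (contract_const b a)) =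
      fun_scale (\<lambda>x. Y x \<bullet> b) (contract_const b (lie_form S X a))
      - fun_scale (\<lambda>x. Y x \<bullet> b) (contract (lie S (\<lambda>_. b) X) a) + fun_scale
        (\<lambda>x. lie S X Y x \<bullet> b) (contract_const b a)"
      by (simp only: lie_form_fun_scale[OF Yb alt_forms_contract_const[OF assms(3)]] lie_inner[OF
        assms(2)] fun_scale_diff)
  qed
  finally have eq: "lie_form S X (contract Y a) = (\<Sum>b\<in>B. fun_scale (\<lambda>x. Y x
    \<bullet> b) (contract_const b (lie_form S X a))
      - fun_scale (\<lambda>x. Y x \<bullet> b) (contract (lie S (\<lambda>_. b) X) a) + fun_scale
        (\<lambda>x. lie S X Y x \<bullet> b) (contract_const b a))" .
  have "lie_form S X (contract Y a) us x = contract Y (lie_form S X a) us x - (\<Sum>b\<in>B. (Y x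
    \<bullet> b) * a (lie S (\<lambda>_. b) X x # us) x)
      + contract (lie S X Y) a us x"
    unfolding eq sum_fun_apply plus_fun_apply fun_diff_def fun_scale_apply contract_apply
      contract_const_apply
      alt_forms_head_expand[OF assms(3), of "lie S X Y x"] alt_forms_head_expand[OF
        alt_forms_lie_form[OF assms(1,3)], of "Y x"]
    by (simp only: sum.distrib sum_subtractf)
  also have "(\<Sum>b\<in>B. (Y x \<bullet> b) * a (lie S (\<lambda>_. b) X x # us) x) = a (lie S Y
    X x # us) x"
    by (simp only: lie_expand[OF assms(1), of Y x] linear_sum[OF alt_forms_head_linear[OF
      assms(3)]] alt_forms_head_scale[OF assms(3)])
  also have "contract Y (lie_form S X a) us x - a (lie S Y X x # us) x + contract (lie S X Y) a us x
     = (contract Y (lie_form S X a) + contract (vbracket S X Y) a) us x"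
    by (simp only: vbracket_def plus_fun_apply fun_diff_def contract_apply linear_diff[OF
      alt_forms_head_linear[OF assms(3)]])
  finally show "lie_form S X (contract Y a) us x = (contract Y (lie_form S X a) + contract
    (vbracket S X Y) a) us x" .
qed

text \<open>Contract both sides with a constant u. Since i_u anticommutes with i_X, the recursion
  for d gives i_u i_X d a = i_X d i_u a - i_X L_u a, and \<open>lie_form_contract\<close> gives i_u
  d i_X a = i_X L_u a + i_[u,X] a + d i_X i_u a. The sum is the claim for i_u a plus i_[u,X] a, as
  the recursion for L_X demands.\<close>

theorem cartan:
  assumes "smooth_on S X" "a \<in> alt_forms S k"
  shows "lie_form S X a = contract X (ext_d S a) + ext_d S (contract X a)"
proof
  fix us show "lie_form S X a us = (contract X (ext_d S a) + ext_d S (contract X a)) us"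
    using assms(2)
  proof (induction us arbitrary: a k)
    case Nil
    have "contract X (ext_d S a) [] x = lie S X (a []) x" for x
      by (simp add: lie_at[of X])
    then show ?case by (simp add: fun_eq_iff)
  next
    case (Cons u us)
    note a = Cons.prems
    have "contract X (ext_d S a) (u # us) = - contract X (contract_const u (ext_d S a)) us"
    proof
      fix x show "contract X (ext_d S a) (u # us) x = (- contract X (contract_const u (ext_d S a))
        us) x"
        using alt_forms_swap[OF alt_forms_ext_d[OF a], of "X x" u us x] by (simp del: ext_d.simps)
    qed
    also have "\<dots> = contract X (ext_d S (contract_const u a)) us - contract X (lie_form S
      (\<lambda>_. u) a) us"
      unfolding contract_const_ext_d[OF a] contract_diff by simp
    finally have 1: "contract X (ext_d S a) (u # us) = contract X (ext_d S (contract_const u a)) us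
      - contract X (lie_form S (\<lambda>_. u) a) us" .
    have contract_const: "contract_const u (contract X a) = - contract X (contract_const u a)"
    proof (intro ext)
      fix us x show "contract_const u (contract X a) us x = (- contract X (contract_const u a)) us
        x"
        using alt_forms_swap[OF a, of "X x" u us x] by simp
    qed
    have "ext_d S (contract X a) (u # us) = contract_const u (ext_d S (contract X a)) us" by (simp
      only: contract_const_apply)
    also have "\<dots> = contract X (lie_form S (\<lambda>_. u) a) us + contract (lie S
      (\<lambda>_. u) X) a us + ext_d S (contract X (contract_const u a)) us"
      unfolding contract_const_ext_d[OF alt_forms_contract[OF assms(1) a]] lie_form_contract[OF
        smooth_on_const assms(1) a] contract_const vbracket_const
        ext_d_uminus[OF alt_forms_contract[OF assms(1) alt_forms_contract_const[OF a]]] by simp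
    finally have 2: "ext_d S (contract X a) (u # us) = \<dots>" .
    have IH: "lie_form S X (contract_const u a) us = contract X (ext_d S (contract_const u a)) us +
      ext_d S (contract X (contract_const u a)) us"
      using Cons.IH[OF alt_forms_contract_const[OF a]] unfolding plus_fun_apply .
    \<comment> \<open>Here s is i_X L_u a, which occurs once with each sign.\<close>
    have "p + q + r = (p - s) + (s + r + q)" for p q r s :: "'b \<Rightarrow> real" by simp
    then show "lie_form S X a (u # us) = (contract X (ext_d S a) + ext_d S (contract X a)) (u # us)"
      by (simp only: plus_fun_apply[of "contract X (ext_d S a)"] 1 2 lie_form.simps IH)
  qed
qed

text \<open>After contraction with u, the mixed terms i_[u,Y] L_X a and i_[u,X] L_Y a occur in both
  orders and cancel. What is left besides the claim for i_u a is i_[X,[u,Y]] a - i_[Y,[u,X]] a,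
  which is i_[u,[X,Y]] a by \<open>lie_vbracket\<close>.\<close>

theorem lie_form_lie_form:
  assumes "smooth_on S X" "smooth_on S Y" "a \<in> alt_forms S k"
  shows "lie_form S X (lie_form S Y a) - lie_form S Y (lie_form S X a) = lie_form S (vbracket S X
    Y) a"
proof
  fix us show "(lie_form S X (lie_form S Y a) - lie_form S Y (lie_form S X a)) us = lie_form S
    (vbracket S X Y) a us"
    using assms(3)
  proof (induction us arbitrary: a k)
    case Nil
    show "(lie_form S X (lie_form S Y a) - lie_form S Y (lie_form S X a)) [] = lie_form S (vbracket
      S X Y) a []"
      using lie_lie[OF assms(1,2) alt_forms_smooth_on[OF Nil], of "[]"] by (simp only:
        lie_form.simps minus_apply[of "lie_form _ _ _"])
  next
    case (Cons u us)
    note a = Cons.prems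
    let ?D = "lie S (\<lambda>_. u)"
    have step: "lie_form S X (lie_form S Y a) (u # us) = (lie_form S X (lie_form S Y
      (contract_const u a)) + contract (?D Y) (lie_form S X a)
        + contract (vbracket S X (?D Y)) a + contract (?D X) (lie_form S Y a)) us"
      if XY: "smooth_on S X" "smooth_on S Y" for X Y
    proof -
      have DY: "smooth_on S (?D Y)" by (rule smooth_lie[OF smooth_on_const XY(2)])
      have "lie_form S X (lie_form S Y (contract_const u a) + contract (?D Y) a) = lie_form S X
        (lie_form S Y (contract_const u a)) + lie_form S X (contract (?D Y) a)"
        using lie_form_add[OF alt_forms_lie_form[OF XY(2) alt_forms_contract_const[OF a]]
          alt_forms_contract[OF DY a]] .
      then show ?thesis by (simp add: contract_const_lie_form lie_form_contract[OF XY(1) DY a]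
        add.assoc)
    qed
    have "lie_form S (vbracket S X Y) a (u # us) = lie_form S (vbracket S X Y) (contract_const u a)
      us + contract (vbracket S X (?D Y)) a us - contract (vbracket S Y (?D X)) a us"
      by (simp only: lie_form.simps lie_vbracket[OF assms(1,2)] contract_field(2)[OF a]
        minus_apply[of "contract _ _"] add_diff_eq)
    moreover have "lie_form S X (lie_form S Y (contract_const u a)) us - lie_form S Y (lie_form S X
      (contract_const u a)) us = lie_form S (vbracket S X Y) (contract_const u a) us"
      using Cons.IH[OF alt_forms_contract_const[OF a]] unfolding minus_apply[of "lie_form _ _ _"] .
    ultimately have "lie_form S X (lie_form S Y a) (u # us) x - lie_form S Y (lie_form S X a) (u #
      us) x = lie_form S (vbracket S X Y) a (u # us) x" for x
      unfolding step[OF assms(1,2)] step[OF assms(2,1)] fun_eq_iff plus_fun_apply minus_apply by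
        (simp add: algebra_simps)
    then show "(lie_form S X (lie_form S Y a) - lie_form S Y (lie_form S X a)) (u # us) = lie_form
      S (vbracket S X Y) a (u # us)"
      by (intro ext) (simp only: minus_apply)
  qed
qed

text \<open>This precedes d d = 0, which is derived from it. After contraction with u, the
  difference of the two sides involves [L_u, L_X] a = L_[u,X] a, and Cartan's formula for the field
  [u,X] supplies exactly the terms i_[u,X] d a and d i_[u,X] a that the recursions produce.\<close>

theorem lie_form_ext_d:
  assumes "smooth_on S X" "a \<in> alt_forms S k"
  shows "lie_form S X (ext_d S a) = ext_d S (lie_form S X a)"
proof
  fix us show "lie_form S X (ext_d S a) us = ext_d S (lie_form S X a) us"
    using assms(2)
  proof (induction us arbitrary: a k)
    case (Cons u us)
    note a = Cons.prems and ica = alt_forms_contract_const[OF Cons.prems, of u] and X = assms(1)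
    let ?u = "\<lambda>_::'b. u"
    have D: "smooth_on S (lie S ?u X)" by (rule smooth_lie[OF smooth_on_const X])
    have icd: "contract_const u (ext_d S a) = lie_form S ?u a - ext_d S (contract_const u a)" by
      (rule contract_const_ext_d[OF a])
    \<comment> \<open>The index Suc (k - 1) of this form differs from k only at k = 0, where the
      form is 0.\<close>
    have mem: "ext_d S (contract_const u a) \<in> alt_forms S k"
    proof (cases k)
      case 0
      then show ?thesis using a by simp
    next
      case (Suc j)
      then show ?thesis using alt_forms_ext_d[OF ica] by simp
    qed
    have "lie_form S X (contract_const u (ext_d S a)) = lie_form S X (lie_form S ?u a) - lie_form S
      X (ext_d S (contract_const u a))"
      unfolding icd by (rule lie_form_diff[OF alt_forms_lie_form[OF smooth_on_const a] mem])
    moreover have "lie_form S X (ext_d S (contract_const u a)) us = ext_d S (lie_form S X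
      (contract_const u a)) us" by (rule Cons.IH[OF ica])
    ultimately have l: "lie_form S X (ext_d S a) (u # us) =
       lie_form S X (lie_form S ?u a) us - ext_d S (lie_form S X (contract_const u a)) us +
         contract (lie S ?u X) (ext_d S a) us"
      by (simp only: lie_form.simps minus_apply[of "lie_form _ _ _"])
    have "contract_const u (ext_d S (lie_form S X a)) = lie_form S ?u (lie_form S X a) - ext_d S
      (contract_const u (lie_form S X a))"
      by (rule contract_const_ext_d[OF alt_forms_lie_form[OF X a]])
    also have "ext_d S (contract_const u (lie_form S X a)) = ext_d S (lie_form S X (contract_const
      u a)) + ext_d S (contract (lie S ?u X) a)"
      unfolding contract_const_lie_form by (rule ext_d_add[OF alt_forms_lie_form[OF X ica]
        alt_forms_contract[OF D a]])
    finally have "contract_const u (ext_d S (lie_form S X a)) us =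
      (lie_form S ?u (lie_form S X a) - (ext_d S (lie_form S X (contract_const u a)) + ext_d S
        (contract (lie S ?u X) a))) us" by (rule fun_cong)
    then have r: "ext_d S (lie_form S X a) (u # us) =
      lie_form S ?u (lie_form S X a) us - (ext_d S (lie_form S X (contract_const u a)) us + ext_d S
        (contract (lie S ?u X) a) us)"
      by (simp only: contract_const_apply minus_apply[of "lie_form _ _ _"] plus_fun_apply[of "ext_d
        _ _"])
    have "lie_form S ?u (lie_form S X a) - lie_form S X (lie_form S ?u a) = contract (lie S ?u X)
      (ext_d S a) + ext_d S (contract (lie S ?u X) a)"
      unfolding lie_form_lie_form[OF smooth_on_const X a] vbracket_const by (rule cartan[OF D a])
    from fun_cong[OF this, of us]
    have "lie_form S ?u (lie_form S X a) us - lie_form S X (lie_form S ?u a) us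
      = contract (lie S ?u X) (ext_d S a) us + ext_d S (contract (lie S ?u X) a) us"
      by (simp only: minus_apply[of "lie_form _ _ _"] plus_fun_apply[of "contract _ _"])
    moreover have "p - q + s = t - (q + v)" if "t - p = s + v" for p q s t v :: "'b \<Rightarrow>
      real"
    proof
      fix x show "(p - q + s) x = (t - (q + v)) x" using fun_cong[OF that, of x] by simp
    qed
    ultimately show "lie_form S X (ext_d S a) (u # us) = ext_d S (lie_form S X a) (u # us)"
      unfolding l r by blast
  qed simp
qed

text \<open>i_u d d a = L_u d a - d i_u d a = (L_u d a - d L_u a) + d d i_u a; the parenthesis is 0
  by \<open>lie_form_ext_d\<close> for the constant field u, and the rest is the induction
  hypothesis.\<close>

theorem ext_d_ext_d:
  assumes "a \<in> alt_forms S k"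
  shows "ext_d S (ext_d S a) = 0"
proof
  fix us show "ext_d S (ext_d S a) us = 0 us"
    using assms
  proof (induction us arbitrary: a k)
    case (Cons u us)
    note a = Cons.prems and ica = alt_forms_contract_const[OF Cons.prems, of u]
    let ?u = "\<lambda>_::'b. u"
    have mem: "ext_d S (contract_const u a) \<in> alt_forms S k"
    proof (cases k)
      case 0
      then show ?thesis using a by simp
    next
      case (Suc j)
      then show ?thesis using alt_forms_ext_d[OF ica] by simp
    qed
    have "contract_const u (ext_d S (ext_d S a)) = lie_form S ?u (ext_d S a) - ext_d S
      (contract_const u (ext_d S a))"
      by (rule contract_const_ext_d[OF alt_forms_ext_d[OF a]])
    also have "\<dots> = ext_d S (ext_d S (contract_const u a))"
      unfolding contract_const_ext_d[OF a] ext_d_diff[OF alt_forms_lie_form[OF smooth_on_const a]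
        mem] lie_form_ext_d[OF smooth_on_const a] by simp
    finally have "contract_const u (ext_d S (ext_d S a)) us = ext_d S (ext_d S (contract_const u
      a)) us" by (rule fun_cong)
    moreover have "ext_d S (ext_d S (contract_const u a)) us = 0 us" by (rule Cons.IH[OF ica])
    ultimately show "ext_d S (ext_d S a) (u # us) = 0 (u # us)" by (simp only: contract_const_apply
      zero_fun_apply)
  qed simp
qed

end

section \<open>The Courant bracket on an open set\<close>


context local_calculus
begin

definition courant_form :: "('b \<Rightarrow> 'b) \<Rightarrow> 'b lform \<Rightarrow> ('b
  \<Rightarrow> 'b) \<Rightarrow> 'b lform \<Rightarrow> 'b lform" where
  "courant_form X a Y b = lie_form S X b - lie_form S Y a + fun_scale (\<lambda>_. 1/2) (ext_d S
    (contract Y a) - ext_d S (contract X b))"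

definition local_pairing :: "('b \<Rightarrow> 'b) \<Rightarrow> 'b lform \<Rightarrow> ('b
  \<Rightarrow> 'b) \<Rightarrow> 'b lform \<Rightarrow> 'b lform" where
  "local_pairing X a Y b = fun_scale (\<lambda>_. 1/2) (contract X b + contract Y a)"

lemma alt_forms_contract_Suc: "smooth_on S X \<Longrightarrow> a \<in> alt_forms S (Suc n)
  \<Longrightarrow> contract X a \<in> alt_forms S n"
  using alt_forms_contract[of X a "Suc n"] by simp

lemma alt_forms_courant_form:
  assumes "smooth_on S X" "smooth_on S Y" "a \<in> alt_forms S (Suc n)" "b \<in> alt_forms S (Suc
    n)"
  shows "courant_form X a Y b \<in> alt_forms S (Suc n)"
  unfolding courant_form_def
  by (intro alt_forms_add alt_forms_diff alt_forms_fun_scale alt_forms_lie_form alt_forms_ext_d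
    alt_forms_contract_Suc smooth_on_const assms)

lemma alt_forms_local_pairing:
  assumes "smooth_on S X" "smooth_on S Y" "a \<in> alt_forms S (Suc n)" "b \<in> alt_forms S (Suc
    n)"
  shows "local_pairing X a Y b \<in> alt_forms S n"
  unfolding local_pairing_def
  by (intro alt_forms_add alt_forms_fun_scale alt_forms_contract_Suc smooth_on_const assms)

text \<open>Evaluation at a list and a point turns an identity of forms into a linear identity
  between real numbers with rational coefficients, which is left to \<open>algebra\<close>.\<close>

lemmas pointwise = plus_fun_apply minus_apply uminus_apply fun_scale_apply

section \<open>Invariance of the pairing\<close>

text \<open>The right-hand side is the form part of the Dorfman bracket. The d of the pairing
  doubles 1/2 d i_Y a and removes 1/2 d i_X b, and Cartan's formula contracts - L_Y a + d i_Y a to -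
  i_Y d a.\<close>

lemma courant_form_add_ext_d_local_pairing:
  assumes "smooth_on S X" "smooth_on S Y" "a \<in> alt_forms S (Suc n)" "b \<in> alt_forms S (Suc
    n)"
  shows "courant_form X a Y b + ext_d S (local_pairing X a Y b) = lie_form S X b - contract Y
    (ext_d S a)"
proof (intro ext)
  fix us x
  have P: "ext_d S (local_pairing X a Y b) = fun_scale (\<lambda>_. 1/2) (ext_d S (contract X b) +
    ext_d S (contract Y a))"
    unfolding local_pairing_def using assms
    by (simp only: ext_d_scale[OF alt_forms_add[OF alt_forms_contract_Suc alt_forms_contract_Suc]]
      ext_d_add[OF alt_forms_contract_Suc alt_forms_contract_Suc])
  show "(courant_form X a Y b + ext_d S (local_pairing X a Y b)) us x = (lie_form S X b - contract
    Y (ext_d S a)) us x"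
    unfolding P courant_form_def cartan[OF assms(2,3)] by (simp only: pointwise) algebra
qed

text \<open>In terms of Dorfman brackets the claim is L_X i_Y c = i_Y L_X c + i_[X,Y] c and its
  analogue for Z and b. The additional terms i_Z i_Y d a and i_Y i_Z d a cancel because d a is
  alternating.\<close>

theorem lie_form_local_pairing:
  assumes X: "smooth_on S X" "smooth_on S Y" "smooth_on S Z"
    and a: "a \<in> alt_forms S (Suc n)" "b \<in> alt_forms S (Suc n)" "c \<in> alt_forms S (Suc n)"
  shows "lie_form S X (local_pairing Y b Z c) =
    local_pairing (vbracket S X Y) (courant_form X a Y b + ext_d S (local_pairing X a Y b)) Z c +
    local_pairing Y b (vbracket S X Z) (courant_form X a Z c + ext_d S (local_pairing X a Z c))"
proof (intro ext)
  fix us x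
  have P: "lie_form S X (local_pairing Y b Z c) = fun_scale (\<lambda>_. 1/2) (lie_form S X
    (contract Y c) + lie_form S X (contract Z b))"
    unfolding local_pairing_def using assms
    by (simp only: lie_form_scale[OF alt_forms_add[OF alt_forms_contract_Suc
      alt_forms_contract_Suc]] lie_form_add[OF alt_forms_contract_Suc alt_forms_contract_Suc])
  have sw: "contract Z (contract Y (ext_d S a)) = - contract Y (contract Z (ext_d S a))"
    by (rule contract_swap[OF alt_forms_ext_d[OF a(1)]])
  show "lie_form S X (local_pairing Y b Z c) us x =
    (local_pairing (vbracket S X Y) (courant_form X a Y b + ext_d S (local_pairing X a Y b)) Z c +
    local_pairing Y b (vbracket S X Z) (courant_form X a Z c + ext_d S (local_pairing X a Z c))) us
      x"
    unfolding P courant_form_add_ext_d_local_pairing[OF X(1,2) a(1,2)]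
      courant_form_add_ext_d_local_pairing[OF X(1,3) a(1,3)]
      lie_form_contract[OF X(1,2) a(3)] lie_form_contract[OF X(1,3) a(2)]
    unfolding local_pairing_def contract_diff sw
    by (simp only: pointwise) algebra
qed

section \<open>The bracket and multiplication by functions\<close>

lemma wedge_d_add: "wedge_d S f (a + b) = wedge_d S f a + wedge_d S f b"
proof
  fix us show "wedge_d S f (a + b) us = (wedge_d S f a + wedge_d S f b) us"
  proof (induction us arbitrary: a b)
    case (Cons u us)
    have IH: "wedge_d S f (contract_const u a + contract_const u b) us = wedge_d S f
      (contract_const u a) us + wedge_d S f (contract_const u b) us"
      using Cons.IH unfolding plus_fun_apply .
    show "wedge_d S f (a + b) (u # us) = (wedge_d S f a + wedge_d S f b) (u # us)"
      by (simp only: wedge_d.simps contract_const_simps IH plus_fun_apply[of _ _ "_ # _"]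
        plus_fun_apply[of a b]
          plus_fun_apply[of "wedge_d _ _ _"]) (simp only: algebra_simps)
  qed simp
qed

lemma wedge_d_scale: "wedge_d S f (fun_scale (\<lambda>_. r) a) = fun_scale (\<lambda>_. r)
  (wedge_d S f a)"
proof
  fix us show "wedge_d S f (fun_scale (\<lambda>_. r) a) us = fun_scale (\<lambda>_. r) (wedge_d S
    f a) us"
  proof (induction us arbitrary: a)
    case (Cons u us)
    have IH: "wedge_d S f (fun_scale (\<lambda>_. r) (contract_const u a)) us = fun_scale
      (\<lambda>_. r) (wedge_d S f (contract_const u a)) us"
      by (rule Cons.IH)
    show "wedge_d S f (fun_scale (\<lambda>_. r) a) (u # us) = fun_scale (\<lambda>_. r) (wedge_d S
      f a) (u # us)"
    proof
      fix x show "wedge_d S f (fun_scale (\<lambda>_. r) a) (u # us) x = fun_scale (\<lambda>_. r)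
        (wedge_d S f a) (u # us) x"
        by (simp add: IH algebra_simps)
    qed
  qed (simp add: fun_eq_iff)
qed

text \<open>By Cartan's formula the failure of linearity over functions comes from d (f i_X a)
  alone, whose product rule contributes df \<and> i_X a.\<close>

lemma lie_form_scaleR_field:
  assumes "smooth_on S f" "smooth_on S X" "a \<in> alt_forms S (Suc n)"
  shows "lie_form S (\<lambda>x. f x *\<^sub>R X x) a = fun_scale f (lie_form S X a) + wedge_d S f
    (contract X a)"
proof -
  have fX: "smooth_on S (\<lambda>x. f x *\<^sub>R X x)" by (rule smooth_on_scaleR[OF open_S
    assms(1,2)])
  show ?thesis
    unfolding cartan[OF fX assms(3)] cartan[OF assms(2,3)] contract_field(3)[OF assms(3)]
      contract_field(3)[OF alt_forms_ext_d[OF assms(3)]] ext_d_fun_scale[OF assms(1)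
        alt_forms_contract_Suc[OF assms(2,3)]] fun_scale_add
    by (simp only: add.assoc)
qed

lemma vbracket_scaleR:
  assumes "smooth_on S f" "smooth_on S X" "smooth_on S Y"
  shows "vbracket S X (\<lambda>x. f x *\<^sub>R Y x) = (\<lambda>x. f x *\<^sub>R vbracket S X Y x
    + lie S X f x *\<^sub>R Y x)"
  unfolding vbracket_def lie_scaleR[OF assms(1,3)]
  by (rule ext, simp only: minus_apply lie_linear_field(3)[OF assms(2)] scaleR_diff_right) simp

text \<open>The df-terms are - df \<and> i_Y a from the Lie derivative along f Y, and 1/2 df \<and>
  i_Y a and - 1/2 df \<and> i_X b from the exact part. They add up to - df \<and> (e1, e2).\<close>

theorem courant_form_scaleR:
  assumes f: "smooth_on S f" and X: "smooth_on S X" "smooth_on S Y"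
    and a: "a \<in> alt_forms S (Suc n)" "b \<in> alt_forms S (Suc n)"
  shows "courant_form X a (\<lambda>x. f x *\<^sub>R Y x) (fun_scale f b) =
    fun_scale f (courant_form X a Y b) + fun_scale (lie S X f) b - wedge_d S f (local_pairing X a Y
      b)"
proof (intro ext)
  fix us x
  show "courant_form X a (\<lambda>x. f x *\<^sub>R Y x) (fun_scale f b) us x =
    (fun_scale f (courant_form X a Y b) + fun_scale (lie S X f) b - wedge_d S f (local_pairing X a
      Y b)) us x"
    unfolding courant_form_def local_pairing_def lie_form_fun_scale[OF f a(2)]
      lie_form_scaleR_field[OF f X(2) a(1)] contract_field(3)[OF a(1)]
      contract_fun_scale ext_d_fun_scale[OF f alt_forms_contract_Suc[OF X(2) a(1)]]
        ext_d_fun_scale[OF f alt_forms_contract_Suc[OF X(1) a(2)]]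
      wedge_d_scale wedge_d_add
    by (simp only: pointwise) algebra
qed

section \<open>The Jacobi identity up to an exact form\<close>

text \<open>Cartan's formula, with the summand d i_Z w annihilated by d.\<close>

lemma ext_d_contract_ext_d:
  assumes "smooth_on S Z" "w \<in> alt_forms S k"
  shows "ext_d S (contract Z (ext_d S w)) = ext_d S (lie_form S Z w)"
proof -
  have "contract Z (ext_d S w) \<in> alt_forms S k" using alt_forms_contract[OF assms(1)
    alt_forms_ext_d[OF assms(2)]] by simp
  moreover have "ext_d S (contract Z w) \<in> alt_forms S k"
  proof (cases k)
    case 0
    then have "w = 0" using assms(2) by simp
    moreover have "contract Z 0 = 0" by (intro ext) simp
    ultimately show ?thesis by (simp only: ext_d_zero alt_forms_zero)
  next
    case (Suc j)
    then show ?thesis using alt_forms_ext_d[OF alt_forms_contract[OF assms]] by simp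
  qed
  ultimately show ?thesis
    unfolding cartan[OF assms]
    by (simp only: ext_d_add ext_d_ext_d[OF alt_forms_contract[OF assms]] add_0_right)
qed

lemma ext_d_lie_form_contract:
  assumes "smooth_on S X" "smooth_on S Z" "b \<in> alt_forms S (Suc n)"
  shows "ext_d S (lie_form S X (contract Z b)) = ext_d S (contract Z (lie_form S X b)) + ext_d S
    (contract (vbracket S X Z) b)"
  unfolding lie_form_contract[OF assms]
  by (rule ext_d_add[OF alt_forms_contract_Suc[OF assms(2) alt_forms_lie_form[OF assms(1,3)]]
    alt_forms_contract_Suc[OF smooth_vbracket[OF assms(1,2)] assms(3)]])

text \<open>A normal form: every summand is d i_V L_V' or d i_[V,V'] applied to one of the original
  forms. Once all exact terms in the Jacobi identity have this shape, the two sides can be compared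
  coefficient by coefficient.\<close>

lemma ext_d_contract_courant_form:
  assumes X: "smooth_on S X" "smooth_on S Y" "smooth_on S Z"
    and a: "b \<in> alt_forms S (Suc n)" "c \<in> alt_forms S (Suc n)"
  shows "ext_d S (contract X (courant_form Y b Z c)) = ext_d S (contract X (lie_form S Y c)) -
    ext_d S (contract X (lie_form S Z b)) +
    fun_scale (\<lambda>_. 1/2) ((ext_d S (contract Z (lie_form S X b)) + ext_d S (contract
      (vbracket S X Z) b))
                  - (ext_d S (contract Y (lie_form S X c)) + ext_d S (contract (vbracket S X Y)
                    c)))"
proof -
  note contract = alt_forms_contract_Suc[OF X(1)]
  have m: "contract X (lie_form S Y c) \<in> alt_forms S n" "contract X (lie_form S Z b) \<in>
    alt_forms S n"
    "contract X (ext_d S (contract Z b)) \<in> alt_forms S n" "contract X (ext_d S (contract Y c))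
      \<in> alt_forms S n"
    by (intro contract alt_forms_lie_form alt_forms_ext_d alt_forms_contract_Suc X a)+
  have "ext_d S (contract X (courant_form Y b Z c)) = ext_d S (contract X (lie_form S Y c)) - ext_d
    S (contract X (lie_form S Z b)) +
    fun_scale (\<lambda>_. 1/2) (ext_d S (contract X (ext_d S (contract Z b))) - ext_d S (contract
      X (ext_d S (contract Y c))))"
    unfolding courant_form_def contract_add contract_diff contract_fun_scale
      ext_d_add[OF alt_forms_diff[OF m(1,2)] alt_forms_fun_scale[OF smooth_on_const
        alt_forms_diff[OF m(3,4)]]]
      ext_d_diff[OF m(1,2)] ext_d_scale[OF alt_forms_diff[OF m(3,4)]] ext_d_diff[OF m(3,4)] ..
  then show ?thesis
    unfolding ext_d_contract_ext_d[OF X(1) alt_forms_contract_Suc[OF X(3) a(1)]]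
      ext_d_contract_ext_d[OF X(1) alt_forms_contract_Suc[OF X(2) a(2)]]
      ext_d_lie_form_contract[OF X(1,3) a(1)] ext_d_lie_form_contract[OF X(1,2) a(2)] .
qed

text \<open>The factor 1/4 is 1/2 - 1/4: L_X applied to the exact part of the inner bracket
  contributes 1/2, and the outer term - 1/2 d i_X of the inner bracket takes half of it
  back.\<close>

lemma courant_form_courant_form:
  assumes X: "smooth_on S X" "smooth_on S Y" "smooth_on S Z"
    and a: "a \<in> alt_forms S (Suc n)" "b \<in> alt_forms S (Suc n)" "c \<in> alt_forms S (Suc n)"
  shows "courant_form X a (vbracket S Y Z) (courant_form Y b Z c) =
    lie_form S X (lie_form S Y c) - lie_form S X (lie_form S Z b) - lie_form S (vbracket S Y Z) a +
    fun_scale (\<lambda>_. 1/2) (ext_d S (contract (vbracket S Y Z) a) - ext_d S (contract X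
      (lie_form S Y c)) + ext_d S (contract X (lie_form S Z b))) +
    fun_scale (\<lambda>_. 1/4) ((ext_d S (contract Z (lie_form S X b)) + ext_d S (contract
      (vbracket S X Z) b))
                  - (ext_d S (contract Y (lie_form S X c)) + ext_d S (contract (vbracket S X Y)
                    c)))"
proof -
  have m: "lie_form S Y c \<in> alt_forms S (Suc n)" "lie_form S Z b \<in> alt_forms S (Suc n)"
    "ext_d S (contract Z b) \<in> alt_forms S (Suc n)" "ext_d S (contract Y c) \<in> alt_forms S
      (Suc n)"
    by (intro alt_forms_lie_form alt_forms_ext_d alt_forms_contract_Suc X a)+
  have e: "lie_form S X (courant_form Y b Z c) = lie_form S X (lie_form S Y c) - lie_form S X
    (lie_form S Z b) +
    fun_scale (\<lambda>_. 1/2) (lie_form S X (ext_d S (contract Z b)) - lie_form S X (ext_d S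
      (contract Y c)))"
    unfolding courant_form_def lie_form_add[OF alt_forms_diff[OF m(1,2)] alt_forms_fun_scale[OF
      smooth_on_const alt_forms_diff[OF m(3,4)]]]
      lie_form_diff[OF m(1,2)] lie_form_scale[OF alt_forms_diff[OF m(3,4)]] lie_form_diff[OF
        m(3,4)] ..
  show ?thesis
  proof (intro ext)
    fix us x
    show "courant_form X a (vbracket S Y Z) (courant_form Y b Z c) us x =
    (lie_form S X (lie_form S Y c) - lie_form S X (lie_form S Z b) - lie_form S (vbracket S Y Z) a +
    fun_scale (\<lambda>_. 1/2) (ext_d S (contract (vbracket S Y Z) a) - ext_d S (contract X
      (lie_form S Y c)) + ext_d S (contract X (lie_form S Z b))) +
    fun_scale (\<lambda>_. 1/4) ((ext_d S (contract Z (lie_form S X b)) + ext_d S (contract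
      (vbracket S X Z) b))
                  - (ext_d S (contract Y (lie_form S X c)) + ext_d S (contract (vbracket S X Y)
                    c)))) us x"
      unfolding courant_form_def[of X a "vbracket S Y Z"] e ext_d_contract_courant_form[OF X a(2,3)]
        lie_form_ext_d[OF X(1) alt_forms_contract_Suc[OF X(3) a(2)]] lie_form_ext_d[OF X(1)
          alt_forms_contract_Suc[OF X(2) a(3)]]
        ext_d_lie_form_contract[OF X(1,3) a(2)] ext_d_lie_form_contract[OF X(1,2) a(3)]
      by (simp only: pointwise) algebra
  qed
qed

lemma ext_d_local_pairing_courant_form:
  assumes X: "smooth_on S X" "smooth_on S Y" "smooth_on S Z"
    and a: "a \<in> alt_forms S (Suc n)" "b \<in> alt_forms S (Suc n)" "c \<in> alt_forms S (Suc n)"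
  shows "ext_d S (local_pairing (vbracket S X Y) (courant_form X a Y b) Z c) = fun_scale
    (\<lambda>_. 1/2)
    (ext_d S (contract (vbracket S X Y) c) + (ext_d S (contract Z (lie_form S X b)) - ext_d S
      (contract Z (lie_form S Y a)) +
    fun_scale (\<lambda>_. 1/2) ((ext_d S (contract Y (lie_form S Z a)) + ext_d S (contract
      (vbracket S Z Y) a))
                  - (ext_d S (contract X (lie_form S Z b)) + ext_d S (contract (vbracket S Z X)
                    b)))))"
proof -
  have m: "contract (vbracket S X Y) c \<in> alt_forms S n" "contract Z (courant_form X a Y b)
    \<in> alt_forms S n"
    by (intro alt_forms_contract_Suc alt_forms_courant_form smooth_vbracket X a)+
  show ?thesis
    unfolding local_pairing_def ext_d_scale[OF alt_forms_add[OF m]] ext_d_add[OF m]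
      ext_d_contract_courant_form[OF X(3,1,2) a(1,2)] ..
qed

lemma ext_d_contract_vbracket_swap:
  assumes "smooth_on S X" "smooth_on S Y" "a \<in> alt_forms S (Suc n)"
  shows "ext_d S (contract (vbracket S Y X) a) = - ext_d S (contract (vbracket S X Y) a)"
proof -
  have "contract (vbracket S Y X) a = - contract (vbracket S X Y) a"
    unfolding vbracket_def contract_field(2)[OF assms(3)] by simp
  then show ?thesis
    using ext_d_uminus[OF alt_forms_contract_Suc[OF smooth_vbracket[OF assms(1,2)] assms(3)]] by
      simp
qed

definition local_T :: "('b \<Rightarrow> 'b) \<Rightarrow> 'b lform \<Rightarrow> ('b \<Rightarrow>
  'b) \<Rightarrow> 'b lform \<Rightarrow> ('b \<Rightarrow> 'b) \<Rightarrow> 'b lform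
    \<Rightarrow> 'b lform" where
  "local_T X a Y b Z c = fun_scale (\<lambda>_. - (1/3)) (local_pairing (vbracket S X Y)
    (courant_form X a Y b) Z c +
      local_pairing (vbracket S Y Z) (courant_form Y b Z c) X a + local_pairing (vbracket S Z X)
        (courant_form Z c X a) Y b)"

text \<open>By cyclic symmetry it suffices to count the terms in c. On the left, d i_X L_Y c has
  coefficient -1/2 + 1/4 from the first two brackets, d i_Y L_X c the negative of this, and d
  i_[X,Y] c has -1/4 - 1/4 + 1/2. In d of the three pairings the coefficients are 1/2 + 1/4, -1/4 -
  1/2 and 1/2 - 1/4 - 1/4.\<close>

theorem courant_form_jacobi:
  assumes X: "smooth_on S X" "smooth_on S Y" "smooth_on S Z"
    and a: "a \<in> alt_forms S (Suc n)" "b \<in> alt_forms S (Suc n)" "c \<in> alt_forms S (Suc n)"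
  shows "courant_form X a (vbracket S Y Z) (courant_form Y b Z c) + courant_form Y b (vbracket S Z
    X) (courant_form Z c X a) +
    courant_form Z c (vbracket S X Y) (courant_form X a Y b) = ext_d S (local_T X a Y b Z c)"
proof (intro ext)
  fix us x
  have m: "local_pairing (vbracket S X Y) (courant_form X a Y b) Z c \<in> alt_forms S n"
    "local_pairing (vbracket S Y Z) (courant_form Y b Z c) X a \<in> alt_forms S n"
    "local_pairing (vbracket S Z X) (courant_form Z c X a) Y b \<in> alt_forms S n"
    by (intro alt_forms_local_pairing alt_forms_courant_form smooth_vbracket X a)+
  have T: "ext_d S (local_T X a Y b Z c) = fun_scale (\<lambda>_. - (1/3)) (ext_d S (local_pairing
    (vbracket S X Y) (courant_form X a Y b) Z c) +
      ext_d S (local_pairing (vbracket S Y Z) (courant_form Y b Z c) X a) + ext_d S (local_pairing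
        (vbracket S Z X) (courant_form Z c X a) Y b))"
    unfolding local_T_def ext_d_scale[OF alt_forms_add[OF alt_forms_add[OF m(1,2)] m(3)]]
      ext_d_add[OF alt_forms_add[OF m(1,2)] m(3)] ext_d_add[OF m(1,2)] ..
  show "(courant_form X a (vbracket S Y Z) (courant_form Y b Z c) + courant_form Y b (vbracket S Z
    X) (courant_form Z c X a) +
    courant_form Z c (vbracket S X Y) (courant_form X a Y b)) us x = ext_d S (local_T X a Y b Z c)
      us x"
    unfolding T courant_form_courant_form[OF X a] courant_form_courant_form[OF X(2,3,1) a(2,3,1)]
      courant_form_courant_form[OF X(3,1,2) a(3,1,2)]
      ext_d_local_pairing_courant_form[OF X a] ext_d_local_pairing_courant_form[OF X(2,3,1)
        a(2,3,1)] ext_d_local_pairing_courant_form[OF X(3,1,2) a(3,1,2)]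
      lie_form_lie_form[OF X(2,3) a(1), symmetric] lie_form_lie_form[OF X(3,1) a(2), symmetric]
        lie_form_lie_form[OF X(1,2) a(3), symmetric]
      ext_d_contract_vbracket_swap[OF X(2,3) a(1)] ext_d_contract_vbracket_swap[OF X(3,1) a(2)]
        ext_d_contract_vbracket_swap[OF X(1,2) a(3)]
    by (simp only: pointwise) algebra
qed

end

section \<open>Naturality under diffeomorphisms\<close>


lemma Ck_on_sum:
  assumes "open S" "\<And>i. i \<in> I \<Longrightarrow> Ck_on k S (f i)"
  shows "Ck_on k S (\<lambda>x. \<Sum>i\<in>I. f i x)"
  using assms(2)
  by (induction I rule: infinite_finite_induct) (simp_all add: Ck_on_const Ck_on_add[OF assms(1)]
    del: zero_fun_fold)

context local_calculus
begin

text \<open>The chain rule differentiates f in a direction that varies with x. Expanding this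
  direction in \<open>B\<close> leaves derivatives of f in fixed directions, to which the induction
  hypothesis applies.\<close>

lemma Ck_on_compose:
  assumes W: "open W" "smooth_on W \<phi>" "\<phi> ` W \<subseteq> S"
  shows "Ck_on k S f \<Longrightarrow> Ck_on k W (\<lambda>x. f (\<phi> x))"
proof (induction k arbitrary: f)
  case 0
  then show ?case
    using continuous_on_compose2[OF _ smooth_on_continuous[OF W(2)] W(3)] by simp
next
  case (Suc k)
  let ?D = "\<lambda>x v. \<Sum>b\<in>B. (frechet_derivative \<phi> (at x) v \<bullet> b) *\<^sub>R
    frechet_derivative f (at (\<phi> x)) b"
  have der: "((\<lambda>x. f (\<phi> x)) has_derivative ?D x) (at x)" if "x \<in> W" for x
  proof -
    have f: "(f has_derivative frechet_derivative f (at (\<phi> x))) (at (\<phi> x))"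
      using Suc.prems W(3) that by (auto simp: frechet_derivative_works)
    have e: "frechet_derivative f (at (\<phi> x)) w = (\<Sum>b\<in>B. (w \<bullet> b) *\<^sub>R
      frechet_derivative f (at (\<phi> x)) b)" for w
    proof -
      have lin: "linear (frechet_derivative f (at (\<phi> x)))"
        using f has_derivative_linear by blast
      have "frechet_derivative f (at (\<phi> x)) w = frechet_derivative f (at (\<phi> x))
        (\<Sum>b\<in>B. (w \<bullet> b) *\<^sub>R b)"
        by (simp only: expand)
      also have "\<dots> = (\<Sum>b\<in>B. (w \<bullet> b) *\<^sub>R frechet_derivative f (at
        (\<phi> x)) b)"
        by (simp only: linear_sum[OF lin] linear_scale[OF lin])
      finally show ?thesis .
    qed
    have "?D x = frechet_derivative f (at (\<phi> x)) \<circ> frechet_derivative \<phi> (at x)"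
      by (rule ext, subst o_apply, rule e[symmetric])
    then show ?thesis
      using diff_chain_at[OF smooth_on_has_derivative[OF W(2) that] f] by (simp only: o_def)
  qed
  have "Ck_on k W (\<lambda>x. ?D x v)" for v
  proof (intro Ck_on_sum[OF W(1)] Ck_on_scaleR[OF W(1)])
    fix b
    show "Ck_on k W (\<lambda>x. frechet_derivative \<phi> (at x) v \<bullet> b)"
      using smooth_on_inner[OF W(1) smooth_on_frechet_derivative[OF W(2)]] by (simp add:
        smooth_on_def)
    show "Ck_on k W (\<lambda>x. frechet_derivative f (at (\<phi> x)) b)"
      using Suc.prems by (intro Suc.IH) auto
  qed
  moreover have "?D x v = frechet_derivative (\<lambda>x. f (\<phi> x)) (at x) v" if "x \<in> W"
    for x v
    by (rule fun_cong[OF frechet_derivative_at[OF der[OF that]]])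
  ultimately have "Ck_on k W (\<lambda>x. frechet_derivative (\<lambda>x. f (\<phi> x)) (at x) v)"
    for v
    using Ck_on_cong[OF W(1), of "\<lambda>x. ?D x v" "\<lambda>x. frechet_derivative (\<lambda>x.
      f (\<phi> x)) (at x) v" k] by blast
  then show ?case using der by (auto simp: differentiable_def)
qed

lemma smooth_on_compose:
  "open W \<Longrightarrow> smooth_on W \<phi> \<Longrightarrow> \<phi> ` W \<subseteq> S
    \<Longrightarrow> smooth_on S f \<Longrightarrow> smooth_on W (\<lambda>x. f (\<phi> x))"
  unfolding smooth_on_def using Ck_on_compose[of W \<phi> _ f] by (auto simp: smooth_on_def)

section \<open>Restriction to smaller open sets\<close>

lemma lie_cong:
  assumes "W \<subseteq> S" "open W" "\<And>x. x \<in> W \<Longrightarrow> f x = g x" "x \<in> W"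
    "smooth_on S f"
  shows "lie S X f x = lie W X g x"
proof -
  have "frechet_derivative f (at x) = frechet_derivative g (at x)"
    using frechet_derivative_transform_within_open[OF smooth_on_differentiable[OF assms(5)]
      assms(2,4,3)] assms by blast
  then show ?thesis using assms by (auto simp: lie_def)
qed

text \<open>Members of \<open>alt_forms W k\<close> vanish outside W, so a form on S has to be cut
  off before it becomes a form on W.\<close>

definition restrict_form :: "'b set \<Rightarrow> 'b lform \<Rightarrow> 'b lform" where
  "restrict_form W a = (\<lambda>us x. if x \<in> W then a us x else 0)"

lemma restrict_form_apply: "x \<in> W \<Longrightarrow> restrict_form W a us x = a us x"
  by (simp add: restrict_form_def)

lemma contract_const_restrict_form: "contract_const u (restrict_form W a) = restrict_form W
  (contract_const u a)"
  by (simp add: contract_const_def restrict_form_def)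

lemma contract_restrict_form: "contract X (restrict_form W a) = restrict_form W (contract X a)"
  by (simp add: contract_def restrict_form_def)

lemma alt_forms_restrict_form:
  assumes W: "open W" "W \<subseteq> S"
  shows "a \<in> alt_forms S k \<Longrightarrow> restrict_form W a \<in> alt_forms W k"
proof (induction k arbitrary: a)
  case 0
  then show "restrict_form W a \<in> alt_forms W 0" by (simp add: restrict_form_def fun_eq_iff)
next
  case (Suc k)
  interpret W: local_calculus B W
    using finite_B expand W(1) by unfold_locales
  note a = alt_forms_SucD[OF Suc.prems]
  have contract_const: "restrict_form W (contract_const u a) \<in> alt_forms W k" for u by (rule
    Suc.IH[OF a(5)])
  have sm: "smooth_on W (restrict_form W a [])"
    by (rule smooth_on_cong[OF W(1) _ smooth_on_subset[OF alt_forms_smooth_on[OF Suc.prems] W(2)]])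
      (simp add: restrict_form_def)
  show "restrict_form W a \<in> alt_forms W (Suc k)"
  proof (rule W.alt_forms_SucI)
    show "supported_smooth W (restrict_form W a [])"
      using sm by (simp add: supported_smooth_def restrict_form_def)
    show "restrict_form W a [] = 0" if "k \<noteq> 0"
      using a(2)[OF that] by (simp add: restrict_form_def fun_eq_iff)
    show "contract_const u (restrict_form W a) \<in> alt_forms W k" for u
      unfolding contract_const_restrict_form by (rule contract_const)
  qed (simp_all add: restrict_form_def a(3,4,6))
qed

lemma lie_form_restrict:
  assumes W: "open W" "W \<subseteq> S" and X: "smooth_on S X" "\<And>x. x \<in> W
    \<Longrightarrow> X x = X' x" and x: "x \<in> W"
  shows "a \<in> alt_forms S k \<Longrightarrow> lie_form S X a us x = lie_form W X' (restrict_form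
    W a) us x"
proof (induction us arbitrary: a k)
  case Nil
  have "lie S X (a []) x = lie W X (restrict_form W a []) x"
    by (rule lie_cong[OF W(2,1) _ x alt_forms_smooth_on[OF Nil]]) (simp add: restrict_form_def)
  also have "\<dots> = lie W X' (restrict_form W a []) x" using X(2)[OF x] by (simp add: lie_def)
  finally show "lie_form S X a [] x = lie_form W X' (restrict_form W a) [] x" by simp
next
  case (Cons u us)
  have IH: "lie_form S X (contract_const u a) us x = lie_form W X' (restrict_form W (contract_const
    u a)) us x"
    by (rule Cons.IH[OF alt_forms_contract_const[OF Cons.prems]])
  have "lie S (\<lambda>_. u) X x = lie W (\<lambda>_. u) X' x"
    by (rule lie_cong[OF W(2,1) X(2) x X(1)])
  then show "lie_form S X a (u # us) x = lie_form W X' (restrict_form W a) (u # us) x"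
    using x by (simp only: lie_form.simps plus_fun_apply IH contract_const_restrict_form
      contract_restrict_form contract_apply restrict_form_apply)
qed

lemma ext_d_restrict:
  assumes W: "open W" "W \<subseteq> S" and x: "x \<in> W"
  shows "a \<in> alt_forms S k \<Longrightarrow> ext_d S a us x = ext_d W (restrict_form W a) us x"
proof (induction us arbitrary: a k)
  case Nil
  show "ext_d S a [] x = ext_d W (restrict_form W a) [] x" by simp
next
  case (Cons u us)
  have IH: "ext_d S (contract_const u a) us x = ext_d W (restrict_form W (contract_const u a)) us x"
    by (rule Cons.IH[OF alt_forms_contract_const[OF Cons.prems]])
  have "lie S (\<lambda>_. u) (a us) x = lie W (\<lambda>_. u) (restrict_form W a us) x"
    by (rule lie_cong[OF W(2,1) _ x alt_forms_smooth_on[OF Cons.prems]]) (simp add: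
      restrict_form_def)
  then show "ext_d S a (u # us) x = ext_d W (restrict_form W a) (u # us) x"
    by (simp only: ext_d.simps minus_apply IH contract_const_restrict_form)
qed

end

section \<open>Related fields and forms\<close>

locale local_diffeo = W: local_calculus B W + W': local_calculus B W'
  for B :: "'b::real_inner set" and W W' +
  fixes \<phi> \<psi> :: "'b \<Rightarrow> 'b"
  assumes smooth_map: "smooth_on W \<phi>" "smooth_on W' \<psi>"
    and maps: "\<phi> ` W \<subseteq> W'" "\<psi> ` W' \<subseteq> W"
    and inverse: "\<And>x. x \<in> W \<Longrightarrow> \<psi> (\<phi> x) = x" "\<And>y. y \<in> W'
      \<Longrightarrow> \<phi> (\<psi> y) = y"
begin

abbreviation D :: "'b \<Rightarrow> 'b \<Rightarrow> 'b" where
  "D x \<equiv> frechet_derivative \<phi> (at x)"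

definition field_related :: "('b \<Rightarrow> 'b) \<Rightarrow> ('b \<Rightarrow> 'b)
  \<Rightarrow> bool" where
  "field_related X X' \<longleftrightarrow> (\<forall>x\<in>W. X' (\<phi> x) = D x (X x))"

definition form_related :: "'b lform \<Rightarrow> 'b lform \<Rightarrow> bool" where
  "form_related a a' \<longleftrightarrow> (\<forall>x\<in>W. \<forall>us. a us x = a' (map (D x)
    us) (\<phi> x))"

text \<open>The inverse \<open>\<psi>\<close> appears because a field on \<open>W'\<close> takes the
  image point as its argument; at \<open>\<phi> x\<close> its value is \<open>D x u\<close>.\<close>

definition push :: "'b \<Rightarrow> 'b \<Rightarrow> 'b" where
  "push u y = D (\<psi> y) u"

lemma smooth_push: "smooth_on W' (push u)"
  unfolding push_def
  by (rule W.smooth_on_compose[OF W'.open_S smooth_map(2) maps(2) smooth_on_frechet_derivative[OF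
    smooth_map(1)]])

lemma push_related: "field_related (\<lambda>_. u) (push u)"
  by (simp add: field_related_def push_def inverse)

lemma lie_natural:
  assumes "smooth_on W' f" "field_related X X'" "x \<in> W"
  shows "lie W X (\<lambda>x. f (\<phi> x)) x = lie W' X' f (\<phi> x)"
proof -
  have y: "\<phi> x \<in> W'" using maps assms(3) by blast
  have "((\<lambda>x. f (\<phi> x)) has_derivative frechet_derivative f (at (\<phi> x)) \<circ> D
    x) (at x)"
    using diff_chain_at[OF smooth_on_has_derivative[OF smooth_map(1) assms(3)]
      smooth_on_has_derivative[OF assms(1) y]]
    by (simp only: o_def)
  from W.lie_eqI[OF assms(3) this, of X] show ?thesis
    using assms(2,3) y by (simp add: lie_def field_related_def)
qed

text \<open>If \<open>Y'\<close> is related to \<open>Y\<close>, then \<open>Y' \<circ> \<phi>\<close> is the derivative of \<open>\<phi>\<close> along \<open>Y\<close>. So the claim is the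
  commutator formula for derivations, applied to \<open>\<phi>\<close>.\<close>

lemma vbracket_natural:
  assumes X: "smooth_on W X" "smooth_on W' X'" "field_related X X'"
    and Y: "smooth_on W Y" "smooth_on W' Y'" "field_related Y Y'"
  shows "field_related (vbracket W X Y) (vbracket W' X' Y')"
  unfolding field_related_def
proof
  fix x assume x: "x \<in> W"
  have *: "lie W' X' Y' (\<phi> x) = lie W X (lie W Y \<phi>) x"
    if "field_related X X'" "smooth_on W' Y'" "field_related Y Y'" "smooth_on W Y" for X X' Y Y'
  proof -
    have "lie W' X' Y' (\<phi> x) = lie W X (\<lambda>x. Y' (\<phi> x)) x"
      using lie_natural[OF that(2,1) x] by simp
    also have "\<dots> = lie W X (lie W Y \<phi>) x"
      by (rule sym, rule W.lie_cong[OF _ W.open_S _ x W.smooth_lie[OF that(4) smooth_map(1)]])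
        (use that(3) in \<open>auto simp: field_related_def lie_def\<close>)
    finally show ?thesis .
  qed
  have "vbracket W' X' Y' (\<phi> x) = lie W' X' Y' (\<phi> x) - lie W' Y' X' (\<phi> x)" by (simp
    add: vbracket_def)
  also have "\<dots> = (lie W X (lie W Y \<phi>) - lie W Y (lie W X \<phi>)) x"
    by (simp only: *[OF X(3) Y(2,3,1)] *[OF Y(3) X(2,3,1)] minus_apply)
  also have "\<dots> = lie W (vbracket W X Y) \<phi> x" by (simp only: W.lie_lie[OF X(1) Y(1)
    smooth_map(1)])
  also have "\<dots> = D x (vbracket W X Y x)" using x by (simp add: lie_def)
  finally show "vbracket W' X' Y' (\<phi> x) = D x (vbracket W X Y x)" .
qed

lemma form_related_contract_const: "form_related a a' \<Longrightarrow> form_related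
  (contract_const u a) (contract (push u) a')"
  by (simp add: form_related_def push_def inverse)

lemma lie_form_natural:
  assumes X: "smooth_on W X" "smooth_on W' X'" "field_related X X'" and x: "x \<in> W"
  shows "a \<in> alt_forms W k \<Longrightarrow> a' \<in> alt_forms W' k \<Longrightarrow>
    form_related a a' \<Longrightarrow>
    lie_form W X a us x = lie_form W' X' a' (map (D x) us) (\<phi> x)"
proof (induction us arbitrary: a a' k)
  case Nil
  have "lie W X (a []) x = lie W X (\<lambda>x. a' [] (\<phi> x)) x"
    by (rule W.lie_cong[OF _ W.open_S _ x W.alt_forms_smooth_on[OF Nil(1)]])
      (use Nil(3) in \<open>auto simp: form_related_def\<close>)
  also have "\<dots> = lie W' X' (a' []) (\<phi> x)"
    by (rule lie_natural[OF W'.alt_forms_smooth_on[OF Nil(2)] X(3) x])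
  finally show "lie_form W X a [] x = lie_form W' X' a' (map (D x) []) (\<phi> x)" by simp
next
  case (Cons u us)
  let ?us = "map (D x) us" and ?y = "\<phi> x"
  have IH: "lie_form W X (contract_const u a) us x = lie_form W' X' (contract (push u) a') ?us ?y"
    by (rule Cons.IH[OF W.alt_forms_contract_const[OF Cons.prems(1)] W'.alt_forms_contract[OF
      smooth_push Cons.prems(2)] form_related_contract_const[OF Cons.prems(3)]])
  have pu: "push u ?y = D x u" using x by (simp add: push_def inverse)
  have "vbracket W' (push u) X' ?y = D x (lie W (\<lambda>_. u) X x)"
    using vbracket_natural[OF smooth_on_const smooth_push push_related X, of u] x
    by (simp add: field_related_def W.vbracket_const)
  moreover have "vbracket W' X' (push u) ?y = - vbracket W' (push u) X' ?y" by (simp add: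
    vbracket_def)
  ultimately have br: "vbracket W' X' (push u) ?y = - D x (lie W (\<lambda>_. u) X x)" by simp
  have a: "a (lie W (\<lambda>_. u) X x # us) x = a' (D x (lie W (\<lambda>_. u) X x) # ?us) ?y"
    using Cons.prems(3) x by (simp add: form_related_def)
  \<comment> \<open>Moving the contraction with \<open>push u\<close> past the Lie derivative
    produces [X', push u], which \<open>br\<close> identifies with the image of -[u, X]. The term
    subtracted here is the one that the recursion adds on the side of W.\<close>
  have "lie_form W' X' (contract (push u) a') ?us ?y = lie_form W' X' a' (D x u # ?us) ?y - a' (D x
    (lie W (\<lambda>_. u) X x) # ?us) ?y"
    unfolding W'.lie_form_contract[OF X(2) smooth_push Cons.prems(2)] plus_fun_apply contract_apply
      pu br
      linear_neg[OF W'.alt_forms_head_linear[OF Cons.prems(2)]] by simp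
  then show "lie_form W X a (u # us) x = lie_form W' X' a' (map (D x) (u # us)) ?y"
    by (simp only: lie_form.simps(2)[of W] plus_fun_apply contract_apply IH a list.map
      diff_add_cancel)
qed

text \<open>On \<open>W\<close> the recursion expresses i_u d as L_u - d i_u. On \<open>W'\<close>
  the same expression for the nonconstant field \<open>push u\<close> is its contraction with the
  exterior derivative, by Cartan's formula.\<close>

lemma ext_d_natural:
  assumes x: "x \<in> W"
  shows "a \<in> alt_forms W k \<Longrightarrow> a' \<in> alt_forms W' k \<Longrightarrow>
    form_related a a' \<Longrightarrow>
    ext_d W a us x = ext_d W' a' (map (D x) us) (\<phi> x)"
proof (induction us arbitrary: a a' k)
  case Nil
  show "ext_d W a [] x = ext_d W' a' (map (D x) []) (\<phi> x)" by simp
next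
  case (Cons u us)
  let ?us = "map (D x) us" and ?y = "\<phi> x"
  note a = Cons.prems
  have IH: "ext_d W (contract_const u a) us x = ext_d W' (contract (push u) a') ?us ?y"
    by (rule Cons.IH[OF W.alt_forms_contract_const[OF a(1)] W'.alt_forms_contract[OF smooth_push
      a(2)] form_related_contract_const[OF a(3)]])
  have L: "lie_form W (\<lambda>_. u) a us x = lie_form W' (push u) a' ?us ?y"
    by (rule lie_form_natural[OF smooth_on_const smooth_push push_related x a])
  have pu: "push u ?y = D x u" using x by (simp add: push_def inverse)
  have "ext_d W a (u # us) x = contract_const u (ext_d W a) us x" by (simp only:
    contract_const_apply)
  also have "\<dots> = lie_form W (\<lambda>_. u) a us x - ext_d W (contract_const u a) us x"
    unfolding W.contract_const_ext_d[OF a(1)] by (simp only: minus_apply)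
  also have "\<dots> = contract (push u) (ext_d W' a') ?us ?y"
    unfolding L IH W'.cartan[OF smooth_push a(2)] by (simp only: plus_fun_apply
      add_diff_cancel_right')
  also have "\<dots> = ext_d W' a' (map (D x) (u # us)) ?y" by (simp only: contract_apply pu
    list.map)
  finally show "ext_d W a (u # us) x = ext_d W' a' (map (D x) (u # us)) ?y" .
qed

end

section \<open>Representation of forms and fields in charts\<close>


context local_calculus
begin

text \<open>\<open>alt_forms\<close> states linearity in the leading argument, whereas
  \<open>alternating_multilinear\<close> asks for it in every argument; the others become leading
  after contraction with the vectors before them.\<close>

lemma alt_forms_insert_linear:
  assumes "a \<in> alt_forms S k"
  shows "a (us @ (u + v) # ws) x = a (us @ u # ws) x + a (us @ v # ws) x"
    and "a (us @ (r *\<^sub>R u) # ws) x = r * a (us @ u # ws) x"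
proof -
  have "a (us @ (u + v) # ws) x = a (us @ u # ws) x + a (us @ v # ws) x \<and>
    a (us @ (r *\<^sub>R u) # ws) x = r * a (us @ u # ws) x"
    using assms
  proof (induction us arbitrary: a k)
    case Nil
    then show ?case by (simp add: alt_forms_head_add alt_forms_head_scale)
  next
    case (Cons w us)
    from Cons.IH[OF alt_forms_contract_const[OF Cons.prems], of w] show ?case by simp
  qed
  then show "a (us @ (u + v) # ws) x = a (us @ u # ws) x + a (us @ v # ws) x"
    and "a (us @ (r *\<^sub>R u) # ws) x = r * a (us @ u # ws) x" by auto
qed

text \<open>The definition covers equal adjacent vectors; in general the leading vector is moved
  towards its copy by transpositions.\<close>

lemma alt_forms_repeated_head: "a \<in> alt_forms S k \<Longrightarrow> a (u # ys @ u # zs) x = 0"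
proof (induction ys arbitrary: a k)
  case Nil
  then show ?case by (simp add: alt_forms_double)
next
  case (Cons y ys)
  have "contract_const y a (u # ys @ u # zs) x = 0" by (rule Cons.IH[OF alt_forms_contract_const[OF
    Cons.prems]])
  then show ?case using alt_forms_swap[OF Cons.prems, of u y "ys @ u # zs" x] by simp
qed

lemma alt_forms_not_distinct: "a \<in> alt_forms S k \<Longrightarrow> \<not> distinct us
  \<Longrightarrow> a us x = 0"
proof (induction us arbitrary: a k)
  case (Cons u us)
  show ?case
  proof (cases "distinct us")
    case True
    then have "u \<in> set us" using Cons.prems by simp
    then obtain ys zs where "us = ys @ u # zs" using split_list by metis
    then show ?thesis using alt_forms_repeated_head[OF Cons.prems(1)] by simp
  next
    case False
    have "contract_const u a us x = 0" by (rule Cons.IH[OF alt_forms_contract_const[OF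
      Cons.prems(1)] False])
    then show ?thesis by simp
  qed
qed simp

text \<open>A criterion without recursion, whose conditions match those of
  \<open>alternating_multilinear\<close> argument by argument.\<close>

lemma alt_formsI:
  assumes "\<And>us. supported_smooth S (a us)" "\<And>us x. Suc (length us) \<noteq> k
    \<Longrightarrow> a us x = 0"
    "\<And>us ws u v x. a (us @ (u + v) # ws) x = a (us @ u # ws) x + a (us @ v # ws) x"
    "\<And>us ws r u x. a (us @ (r *\<^sub>R u) # ws) x = r * a (us @ u # ws) x"
    "\<And>us ws u x. a (us @ u # u # ws) x = 0"
  shows "a \<in> alt_forms S k"
  using assms
proof (induction k arbitrary: a)
  case 0
  have "a = 0" by (intro ext) (simp add: 0(2))
  then show "a \<in> alt_forms S 0" by simp
next
  case (Suc k)
  show "a \<in> alt_forms S (Suc k)"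
  proof (rule alt_forms_SucI)
    show "supported_smooth S (a [])" by (rule Suc.prems(1))
    show "a [] = 0" if "k \<noteq> 0" using Suc.prems(2)[of "[]"] that by (intro ext) simp
    show "a ((u + v) # us) x = a (u # us) x + a (v # us) x" for u v us x
      using Suc.prems(3)[of "[]"] by simp
    show "a (r *\<^sub>R u # us) x = r * a (u # us) x" for r u us x
      using Suc.prems(4)[of "[]"] by simp
    show "a (u # u # us) x = 0" for u us x
      using Suc.prems(5)[of "[]"] by simp
    show "contract_const u a \<in> alt_forms S k" for u
    proof (rule Suc.IH)
      show "supported_smooth S (contract_const u a us)" for us using Suc.prems(1)[of "u # us"] by
        simp
      show "contract_const u a us x = 0" if "Suc (length us) \<noteq> k" for us x
        using Suc.prems(2)[of "u # us"] that by simp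
      show "contract_const u a (us @ (v + w) # ws) x = contract_const u a (us @ v # ws) x +
        contract_const u a (us @ w # ws) x" for us ws v w x
        using Suc.prems(3)[of "u # us"] by simp
      show "contract_const u a (us @ (r *\<^sub>R v) # ws) x = r * contract_const u a (us @ v # ws)
        x" for us ws r v x
        using Suc.prems(4)[of "u # us"] by simp
      show "contract_const u a (us @ v # v # ws) x = 0" for us ws v x
        using Suc.prems(5)[of "u # us"] by simp
    qed
  qed
qed

end

section \<open>Agreement of the recursions with the coordinate sums\<close>

lemma lie_form_eq_sum:
  assumes "x \<in> S"
  shows "lie_form S X a us x = frechet_derivative (a us) (at x) (X x) +
    (\<Sum>i<length us. a (us[i := frechet_derivative X (at x) (us ! i)]) x)"
proof (induction us arbitrary: a)
  case Nil
  then show ?case using assms by (simp add: lie_def)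
next
  case (Cons u us)
  have "lie_form S X (contract_const u a) us x = frechet_derivative (contract_const u a us) (at x)
    (X x) +
    (\<Sum>i<length us. contract_const u a (us[i := frechet_derivative X (at x) (us ! i)]) x)" by
      (rule Cons.IH)
  then show "lie_form S X a (u # us) x = frechet_derivative (a (u # us)) (at x) (X x) +
    (\<Sum>i<length (u # us). a ((u # us)[i := frechet_derivative X (at x) ((u # us) ! i)]) x)"
    using assms by (simp add: lie_def sum.lessThan_Suc_shift del: sum.lessThan_Suc)
qed

lemma omit_Cons: "omit 0 (u # us) = us" "omit (Suc i) (u # us) = u # omit i us"
  by (simp_all add: omit_def)

lemma ext_d_eq_sum:
  assumes "x \<in> S"
  shows "ext_d S a us x = (\<Sum>i<length us. (-1) ^ i * frechet_derivative (a (omit i us)) (at x)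
    (us ! i))"
proof (induction us arbitrary: a)
  case (Cons u us)
  have "ext_d S (contract_const u a) us x = (\<Sum>i<length us. (-1) ^ i * frechet_derivative
    (contract_const u a (omit i us)) (at x) (us ! i))"
    by (rule Cons.IH)
  then show "ext_d S a (u # us) x =
    (\<Sum>i<length (u # us). (-1) ^ i * frechet_derivative (a (omit i (u # us))) (at x) ((u # us)
      ! i))"
    using assms by (simp add: lie_def sum.lessThan_Suc_shift omit_Cons sum_negf del:
      sum.lessThan_Suc)
qed simp

lemma wedge_d_eq_sum:
  "wedge_d S f a us x = (\<Sum>i<length us. (-1) ^ i * lie S (\<lambda>_. us ! i) f x * a (omit i
    us) x)"
proof (induction us arbitrary: a)
  case (Cons u us)
  have "wedge_d S f (contract_const u a) us x = (\<Sum>i<length us. (-1) ^ i * lie S (\<lambda>_.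
    us ! i) f x * contract_const u a (omit i us) x)"
    by (rule Cons.IH)
  then show "wedge_d S f a (u # us) x =
    (\<Sum>i<length (u # us). (-1) ^ i * lie S (\<lambda>_. (u # us) ! i) f x * a (omit i (u # us))
      x)"
    by (simp add: sum.lessThan_Suc_shift omit_Cons sum_negf del: sum.lessThan_Suc)
qed simp

section \<open>Model space, charts and tangent spaces\<close>

text \<open>The remainder of the expansion is orthogonal to \<open>B\<close>, hence to its span,
  which is the whole space, and in particular to itself.\<close>

lemma euclidean_model_expand:
  assumes "euclidean_model TYPE('b::real_inner) m"
  shows "\<exists>B::'b set. finite B \<and> (\<forall>x. (\<Sum>b\<in>B. (x \<bullet> b) *\<^sub>R
    b) = x)"
proof -
  obtain B :: "'b set" where B: "finite B" "span B = UNIV" "\<And>b. b \<in> B \<Longrightarrow>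
    norm b = 1" "pairwise orthogonal B"
    using assms unfolding euclidean_model_def by auto
  have "(\<Sum>b\<in>B. (x \<bullet> b) *\<^sub>R b) = x" for x
  proof -
    let ?z = "x - (\<Sum>b\<in>B. (x \<bullet> b) *\<^sub>R b)"
    have "?z \<bullet> c = 0" if c: "c \<in> B" for c
    proof -
      have "(\<Sum>b\<in>B. (x \<bullet> b) * (b \<bullet> c)) = (\<Sum>b\<in>B. if b = c then x
        \<bullet> c else 0)"
      proof (rule sum.cong[OF refl])
        fix b assume b: "b \<in> B"
        show "(x \<bullet> b) * (b \<bullet> c) = (if b = c then x \<bullet> c else 0)"
          using B(3)[OF c] B(4) b c by (auto simp: pairwise_def orthogonal_def norm_eq_1)
      qed
      then show ?thesis using B(1) c by (simp add: inner_diff_left inner_sum_left)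
    qed
    then have "orthogonal ?z y" for y
      using B(2) orthogonal_to_span[of y B ?z] by (auto simp: orthogonal_def)
    then have "?z = 0" by (metis orthogonal_self)
    then show ?thesis by simp
  qed
  then show ?thesis using B(1) by blast
qed

locale manifold =
  fixes m :: nat and A :: "('a::{t2_space,second_countable_topology}, 'b::real_inner) chart set"
  assumes smooth_manifold: "smooth_manifold m A"
begin

definition B :: "'b set" where
  "B = (SOME B. finite B \<and> (\<forall>x. (\<Sum>b\<in>B. (x \<bullet> b) *\<^sub>R b) = x))"

lemma B: "finite B" "(\<Sum>b\<in>B. (x \<bullet> b) *\<^sub>R b) = x"
proof -
  have "euclidean_model TYPE('b) m" using smooth_manifold by (simp add: smooth_manifold_def)
  from someI_ex[OF euclidean_model_expand[OF this], folded B_def]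
  show "finite B" "(\<Sum>b\<in>B. (x \<bullet> b) *\<^sub>R b) = x" by auto
qed

abbreviation U :: "('a, 'b) chart \<Rightarrow> 'b set" where
  "U c \<equiv> coord c ` cdom c"

lemma chart:
  assumes "c \<in> A"
  shows "open (cdom c)" "open (U c)" "continuous_on (U c) (cinv c)"
    and "p \<in> cdom c \<Longrightarrow> cinv c (coord c p) = p"
    and "x \<in> U c \<Longrightarrow> cinv c x \<in> cdom c" "x \<in> U c \<Longrightarrow> coord
      c (cinv c x) = x"
proof -
  have "open (cdom c)" "open (U c)" "homeomorphism (cdom c) (U c) (coord c) (cinv c)"
    using smooth_manifold assms by (auto simp: smooth_manifold_def)
  then show "open (cdom c)" "open (U c)" "continuous_on (U c) (cinv c)"
    "p \<in> cdom c \<Longrightarrow> cinv c (coord c p) = p"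
    "x \<in> U c \<Longrightarrow> cinv c x \<in> cdom c" "x \<in> U c \<Longrightarrow> coord c
      (cinv c x) = x"
    by (auto simp: homeomorphism_def)
qed

lemma local_calculus: "open S \<Longrightarrow> local_calculus B S"
  by (simp add: local_calculus_def B)

lemma chart_calculus: "c \<in> A \<Longrightarrow> local_calculus B (U c)"
  by (intro local_calculus chart)

lemma some_chart: "(SOME c. c \<in> A \<and> p \<in> cdom c) \<in> A" "p \<in> cdom (SOME c. c
  \<in> A \<and> p \<in> cdom c)"
proof -
  have "p \<in> (\<Union>c\<in>A. cdom c)" using smooth_manifold by (simp add: smooth_manifold_def)
  then have "\<exists>c. c \<in> A \<and> p \<in> cdom c" by blast
  from someI_ex[OF this] show "(SOME c. c \<in> A \<and> p \<in> cdom c) \<in> A" "p \<in> cdom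
    (SOME c. c \<in> A \<and> p \<in> cdom c)"
    by auto
qed

abbreviation W :: "('a, 'b) chart \<Rightarrow> ('a, 'b) chart \<Rightarrow> 'b set" where
  "W c c' \<equiv> coord c ` (cdom c \<inter> cdom c')"

abbreviation transition :: "('a, 'b) chart \<Rightarrow> ('a, 'b) chart \<Rightarrow> 'b
  \<Rightarrow> 'b" where
  "transition c c' \<equiv> coord c' \<circ> cinv c"

lemma overlap_subset: "W c c' \<subseteq> U c"
  by blast

lemma open_overlap:
  assumes "c \<in> A" "c' \<in> A"
  shows "open (W c c')"
proof -
  have "W c c' = U c \<inter> cinv c -` cdom c'"
    using chart(4)[OF assms(1)] by (auto simp: image_iff)
  then show ?thesis
    using continuous_open_preimage[OF chart(3,2)[OF assms(1)] chart(1)[OF assms(2)]] by simp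
qed

lemma smooth_transition: "c \<in> A \<Longrightarrow> c' \<in> A \<Longrightarrow> smooth_on (W c
  c') (transition c c')"
  using smooth_manifold by (auto simp: smooth_manifold_def)

lemma transition_apply: "c \<in> A \<Longrightarrow> p \<in> cdom c \<Longrightarrow> transition c
  c' (coord c p) = coord c' p"
  by (simp add: chart)

lemma local_diffeo:
  assumes "c \<in> A" "c' \<in> A"
  shows "local_diffeo B (W c c') (W c' c) (transition c c') (transition c' c)"
proof -
  have "local_diffeo_axioms (W c c') (W c' c) (transition c c') (transition c' c)"
    unfolding local_diffeo_axioms_def using assms
    by (auto simp: smooth_transition chart)
  then show ?thesis
    using assms by (simp add: local_diffeo_def local_calculus open_overlap)
qed

lemma transition_has_derivative:
  assumes "c \<in> A" "c' \<in> A" "p \<in> cdom c" "p \<in> cdom c'"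
  shows "(transition c c' has_derivative trans_deriv c c' p) (at (coord c p))"
  unfolding trans_deriv_def
  by (rule smooth_on_has_derivative[OF smooth_transition[OF assms(1,2)]]) (use assms in blast)

lemma trans_deriv_linear:
  assumes "c \<in> A" "c' \<in> A" "p \<in> cdom c" "p \<in> cdom c'"
  shows "linear (trans_deriv c c' p)"
  using has_derivative_linear[OF transition_has_derivative[OF assms]] .

text \<open>The cocycle condition of the tangent bundle. It is the chain rule, combined with the
  fact that the composite of two transition maps agrees with the third on an open overlap.\<close>

lemma trans_deriv_trans:
  assumes "c \<in> A" "c' \<in> A" "c'' \<in> A" "p \<in> cdom c" "p \<in> cdom c'" "p \<in> cdom
    c''"
  shows "trans_deriv c' c'' p (trans_deriv c c' p u) = trans_deriv c c'' p u"
proof -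
  have "(transition c' c'' has_derivative trans_deriv c' c'' p) (at (transition c c' (coord c p)))"
    unfolding transition_apply[OF assms(1,4)]
    by (rule transition_has_derivative) (use assms in auto)
  from diff_chain_at[OF transition_has_derivative[OF assms(1,2,4,5)] this]
  have "(transition c c'' has_derivative trans_deriv c' c'' p \<circ> trans_deriv c c' p) (at
    (coord c p))"
    by (rule has_derivative_transform_within_open[OF _ open_overlap[OF assms(1,2)]])
      (use assms in \<open>auto simp: chart\<close>)
  then have "trans_deriv c' c'' p \<circ> trans_deriv c c' p = trans_deriv c c'' p"
    by (rule has_derivative_unique[OF _ transition_has_derivative[OF assms(1,3,4,6)]])
  then show ?thesis by (metis o_apply)
qed

lemma tangent_spaceD:
  assumes "v \<in> tangent_space A p"
  shows "c \<in> A \<Longrightarrow> c' \<in> A \<Longrightarrow> p \<in> cdom c \<Longrightarrow>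
    p \<in> cdom c' \<Longrightarrow> v c' = trans_deriv c c' p (v c)"
    and "\<not> (c \<in> A \<and> p \<in> cdom c) \<Longrightarrow> v c = 0"
  using assms unfolding tangent_space_def by blast+

lemma tangent_spaceI:
  assumes "\<And>c c'. c \<in> A \<Longrightarrow> c' \<in> A \<Longrightarrow> p \<in> cdom c
    \<Longrightarrow> p \<in> cdom c' \<Longrightarrow> v c' = trans_deriv c c' p (v c)"
    and "\<And>c. \<not> (c \<in> A \<and> p \<in> cdom c) \<Longrightarrow> v c = 0"
  shows "v \<in> tangent_space A p"
  using assms unfolding tangent_space_def by blast

lemma tangent_space_add:
  assumes v: "v \<in> tangent_space A p" and w: "w \<in> tangent_space A p"
  shows "v + w \<in> tangent_space A p"
proof (rule tangent_spaceI)
  fix c c' assume c: "c \<in> A" "c' \<in> A" "p \<in> cdom c" "p \<in> cdom c'"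
  show "(v + w) c' = trans_deriv c c' p ((v + w) c)"
    unfolding plus_fun_apply linear_add[OF trans_deriv_linear[OF c]]
      tangent_spaceD(1)[OF v c] tangent_spaceD(1)[OF w c] ..
next
  fix c assume c: "\<not> (c \<in> A \<and> p \<in> cdom c)"
  show "(v + w) c = 0"
    unfolding plus_fun_apply tangent_spaceD(2)[OF v c] tangent_spaceD(2)[OF w c] by (rule
      add_0_left)
qed

lemma tangent_space_scale:
  assumes v: "v \<in> tangent_space A p"
  shows "tv_scale r v \<in> tangent_space A p"
proof (rule tangent_spaceI)
  fix c c' assume c: "c \<in> A" "c' \<in> A" "p \<in> cdom c" "p \<in> cdom c'"
  show "tv_scale r v c' = trans_deriv c c' p (tv_scale r v c)"
    unfolding tv_scale_def linear_scale[OF trans_deriv_linear[OF c]] tangent_spaceD(1)[OF v c] ..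
next
  fix c assume c: "\<not> (c \<in> A \<and> p \<in> cdom c)"
  show "tv_scale r v c = 0"
    unfolding tv_scale_def tangent_spaceD(2)[OF v c] by (rule scaleR_zero_right)
qed

lemma coord_tvec_apply:
  "c' \<in> A \<Longrightarrow> p \<in> cdom c' \<Longrightarrow> coord_tvec A c p u c' =
    trans_deriv c c' p u"
  by (simp add: coord_tvec_def)

lemma coord_tvec_tangent:
  assumes "c \<in> A" "p \<in> cdom c"
  shows "coord_tvec A c p u \<in> tangent_space A p"
  using assms by (auto simp: tangent_space_def coord_tvec_def trans_deriv_trans)

lemma coord_tvec_component:
  assumes "c \<in> A" "p \<in> cdom c" "v \<in> tangent_space A p"
  shows "coord_tvec A c p (v c) = v"
proof
  fix c'
  show "coord_tvec A c p (v c) c' = v c'"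
  proof (cases "c' \<in> A \<and> p \<in> cdom c'")
    case True
    then have "v c' = trans_deriv c c' p (v c)"
      using assms unfolding tangent_space_def by blast
    then show ?thesis using True by (simp add: coord_tvec_def)
  next
    case False
    then have "v c' = 0" using assms(3) unfolding tangent_space_def by blast
    then show ?thesis using False by (simp only: coord_tvec_def if_False)
  qed
qed

lemma coord_tvec_trans_deriv:
  assumes "c \<in> A" "c' \<in> A" "p \<in> cdom c" "p \<in> cdom c'"
  shows "coord_tvec A c' p (trans_deriv c c' p u) = coord_tvec A c p u"
  using assms by (auto simp: coord_tvec_def fun_eq_iff trans_deriv_trans)

lemma coord_tvec_add:
  assumes "c \<in> A" "p \<in> cdom c"
  shows "coord_tvec A c p (u + v) = coord_tvec A c p u + coord_tvec A c p v"
  using assms by (auto simp: coord_tvec_def fun_eq_iff linear_add[OF trans_deriv_linear])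

lemma coord_tvec_scale:
  assumes "c \<in> A" "p \<in> cdom c"
  shows "coord_tvec A c p (r *\<^sub>R u) = tv_scale r (coord_tvec A c p u)"
  using assms by (auto simp: coord_tvec_def tv_scale_def fun_eq_iff linear_scale[OF
    trans_deriv_linear])

section \<open>Local representatives of fields and forms\<close>

definition local_vf :: "('a, 'b) chart \<Rightarrow> ('a, 'b) vfield \<Rightarrow> 'b \<Rightarrow>
  'b" where
  "local_vf c X = (\<lambda>x. if x \<in> U c then vf_rep c X x else 0)"

definition local_form :: "('a, 'b) chart \<Rightarrow> ('a, 'b) form \<Rightarrow> 'b lform" where
  "local_form c \<alpha> = (\<lambda>us x. if x \<in> U c then form_rep A c \<alpha> us x else 0)"

text \<open>Local representatives determine a form on lists of tangent vectors; its values on other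
  lists must be fixed separately. The condition is weaker than membership in \<open>forms\<close>,
  so that \<open>form_eqI\<close> also applies to expressions such as X(f) times a form.\<close>

definition tangential :: "('a, 'b) form \<Rightarrow> bool" where
  "tangential \<alpha> \<longleftrightarrow> (\<forall>p vs. \<not> set vs \<subseteq>
    tangent_space A p \<longrightarrow> \<alpha> p vs = 0)"

lemma local_vf_coord: "c \<in> A \<Longrightarrow> p \<in> cdom c \<Longrightarrow> local_vf c X
  (coord c p) = X p c"
  by (auto simp: local_vf_def vf_rep_def chart)

lemma local_form_coord:
  "c \<in> A \<Longrightarrow> p \<in> cdom c \<Longrightarrow> local_form c \<alpha> us (coord c
    p) = \<alpha> p (map (coord_tvec A c p) us)"
  by (auto simp: local_form_def form_rep_def chart)

lemma local_form_component:
  assumes "c \<in> A" "p \<in> cdom c" "set vs \<subseteq> tangent_space A p"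
  shows "local_form c \<alpha> (map (\<lambda>v. v c) vs) (coord c p) = \<alpha> p vs"
proof -
  have "map (coord_tvec A c p) (map (\<lambda>v. v c) vs) = vs"
    using assms by (auto simp: coord_tvec_component intro!: map_idI)
  then show ?thesis using local_form_coord[OF assms(1,2)] by simp
qed

lemma form_eqI:
  assumes "tangential \<alpha>" "tangential \<beta>" "\<And>c. c \<in> A \<Longrightarrow>
    local_form c \<alpha> = local_form c \<beta>"
  shows "\<alpha> = \<beta>"
proof (intro ext)
  fix p vs
  show "\<alpha> p vs = \<beta> p vs"
  proof (cases "set vs \<subseteq> tangent_space A p")
    case True
    show ?thesis
      unfolding local_form_component[OF some_chart True, symmetric] assms(3)[OF some_chart(1)] ..
  next
    case False
    then show ?thesis using assms(1,2) by (simp add: tangential_def)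
  qed
qed

lemma local_form_outside: "x \<notin> U c \<Longrightarrow> local_form c \<alpha> us x = 0"
  by (simp add: local_form_def)

lemma local_form_eqI:
  assumes "c \<in> A" "\<And>us x. x \<notin> U c \<Longrightarrow> a us x = 0"
    "\<And>us p. p \<in> cdom c \<Longrightarrow> \<alpha> p (map (coord_tvec A c p) us) = a us
      (coord c p)"
  shows "local_form c \<alpha> = a"
proof (intro ext)
  fix us x
  show "local_form c \<alpha> us x = a us x"
  proof (cases "x \<in> U c")
    case True
    then obtain p where "p \<in> cdom c" "x = coord c p" by blast
    then show ?thesis using local_form_coord[OF assms(1)] assms(3) by simp
  qed (simp add: local_form_outside assms(2))
qed

text \<open>As for \<open>alt_forms\<close>, the index is the degree plus 1.\<close>

abbreviation kforms :: "nat \<Rightarrow> ('a, 'b) form set" where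
  "kforms k \<equiv> forms A (int k - 1)"

lemma tangential_forms: "\<alpha> \<in> forms A k \<Longrightarrow> tangential \<alpha>"
  by (auto simp: forms_def alternating_multilinear_def tangential_def)

lemma local_form_forms:
  assumes "\<alpha> \<in> kforms k" "c \<in> A"
  shows "local_form c \<alpha> \<in> alt_forms (U c) k"
proof -
  interpret local_calculus B "U c" by (rule chart_calculus[OF assms(2)])
  have am: "alternating_multilinear (tangent_space A p) (int k - 1) (\<alpha> p)" for p
    using assms(1) by (simp add: forms_def)
  have sm: "smooth_on (U c) (form_rep A c \<alpha> us)" for us
    using assms by (simp add: forms_def)
  have T: "set (map (coord_tvec A c p) us) \<subseteq> tangent_space A p" if "p \<in> cdom c" for p
    us
    using coord_tvec_tangent[OF assms(2) that] by auto
  show ?thesis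
  proof (rule alt_formsI)
    show "supported_smooth (U c) (local_form c \<alpha> us)" for us
    proof -
      have "smooth_on (U c) (local_form c \<alpha> us)"
        by (rule smooth_on_cong[OF open_S _ sm[of us]]) (simp add: local_form_def)
      then show ?thesis by (simp add: supported_smooth_def local_form_outside)
    qed
    show "local_form c \<alpha> us x = 0" if "Suc (length us) \<noteq> k" for us x
    proof (cases "x \<in> U c")
      case True
      have "int (length us) \<noteq> int k - 1" using that by linarith
      then have "\<alpha> p (map (coord_tvec A c p) us) = 0" for p
        using am[of p] unfolding alternating_multilinear_def by (metis length_map)
      then show ?thesis by (simp add: local_form_def form_rep_def)
    qed (simp add: local_form_outside)
    fix us ws u v x and r :: real
    have "local_form c \<alpha> (us @ (u + v) # ws) x = local_form c \<alpha> (us @ u # ws) x +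
      local_form c \<alpha> (us @ v # ws) x
      \<and> local_form c \<alpha> (us @ (r *\<^sub>R u) # ws) x = r * local_form c \<alpha> (us @
        u # ws) x
      \<and> local_form c \<alpha> (us @ u # u # ws) x = 0"
    proof (cases "x \<in> U c")
      case True
      then obtain p where p: "p \<in> cdom c" "x = coord c p" by blast
      note t = coord_tvec_tangent[OF assms(2) p(1)]
      have 1: "\<alpha> p (vs @ (y + z) # ws) = \<alpha> p (vs @ y # ws) + \<alpha> p (vs @ z # ws)"
        and 2: "\<alpha> p (vs @ tv_scale r y # ws) = r * \<alpha> p (vs @ y # ws)"
        if "set vs \<subseteq> tangent_space A p" "set ws \<subseteq> tangent_space A p" "y \<in>
          tangent_space A p" "z \<in> tangent_space A p"
        for vs ws y z
        using am[of p] that unfolding alternating_multilinear_def by blast+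
      have 3: "\<alpha> p vs = 0" if "\<not> distinct vs" for vs
        using am[of p] that unfolding alternating_multilinear_def by blast
      show ?thesis
        unfolding p(2) local_form_coord[OF assms(2) p(1)] map_append list.map
          coord_tvec_add[OF assms(2) p(1)] coord_tvec_scale[OF assms(2) p(1)]
        using 1[OF T[OF p(1)] T[OF p(1)] t t] 2[OF T[OF p(1)] T[OF p(1)] t t] 3 by simp
    qed (simp add: local_form_outside)
    then show "local_form c \<alpha> (us @ (u + v) # ws) x = local_form c \<alpha> (us @ u # ws) x
      + local_form c \<alpha> (us @ v # ws) x"
      "local_form c \<alpha> (us @ (r *\<^sub>R u) # ws) x = r * local_form c \<alpha> (us @ u #
        ws) x"
      "local_form c \<alpha> (us @ u # u # ws) x = 0" by auto
  qed
qed

text \<open>Converse to \<open>local_form_forms\<close>. The algebraic conditions at p can be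
  checked in a single chart because taking components of tangent vectors is linear; smoothness is
  read off in every chart.\<close>

lemma formsI:
  assumes "tangential \<alpha>" "\<And>c. c \<in> A \<Longrightarrow> local_form c \<alpha> \<in>
    alt_forms (U c) k"
  shows "\<alpha> \<in> kforms k"
proof -
  have "alternating_multilinear (tangent_space A p) (int k - 1) (\<alpha> p)" for p
  proof -
    let ?c = "SOME c. c \<in> A \<and> p \<in> cdom c"
    interpret local_calculus B "U ?c" by (rule chart_calculus[OF some_chart(1)])
    note a = assms(2)[OF some_chart(1), of p]
    note val = local_form_component[OF some_chart, symmetric, of _ p \<alpha>]
    show ?thesis
      unfolding alternating_multilinear_def
    proof (intro conjI allI ballI impI)
      fix vs assume vs: "\<not> (int (length vs) = int k - 1 \<and> set vs \<subseteq>
        tangent_space A p)"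
      show "\<alpha> p vs = 0"
      proof (cases "set vs \<subseteq> tangent_space A p")
        case True
        then have "Suc (length (map (\<lambda>v. v ?c) vs)) \<noteq> k" using vs by auto
        from alt_forms_length[OF a this] show ?thesis using val[OF True] by simp
      next
        case False
        then show ?thesis using assms(1) by (simp add: tangential_def)
      qed
    next
      fix us ws v w assume T: "v \<in> tangent_space A p" "w \<in> tangent_space A p"
        "set us \<subseteq> tangent_space A p" "set ws \<subseteq> tangent_space A p"
      have vw: "v + w \<in> tangent_space A p"
        by (rule tangent_space_add[OF T(1,2)])
      have *: "\<alpha> p (us @ z # ws) = local_form ?c \<alpha> (map (\<lambda>v. v ?c) us @ z ?c
        # map (\<lambda>v. v ?c) ws) (coord ?c p)"
        if "z \<in> tangent_space A p" for z
        using val[of "us @ z # ws"] T that by simp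
      show "\<alpha> p (us @ (v + w) # ws) = \<alpha> p (us @ v # ws) + \<alpha> p (us @ w # ws)"
        unfolding *[OF vw] *[OF T(1)] *[OF T(2)] plus_fun_apply by (rule
          alt_forms_insert_linear(1)[OF a])
    next
      fix us ws v r assume T: "v \<in> tangent_space A p"
        "set us \<subseteq> tangent_space A p" "set ws \<subseteq> tangent_space A p"
      have rv: "tv_scale r v \<in> tangent_space A p"
        by (rule tangent_space_scale[OF T(1)])
      have *: "\<alpha> p (us @ z # ws) = local_form ?c \<alpha> (map (\<lambda>v. v ?c) us @ z ?c
        # map (\<lambda>v. v ?c) ws) (coord ?c p)"
        if "z \<in> tangent_space A p" for z
        using val[of "us @ z # ws"] T that by simp
      show "\<alpha> p (us @ tv_scale r v # ws) = r * \<alpha> p (us @ v # ws)"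
        unfolding *[OF rv] *[OF T(1)] unfolding tv_scale_def by (rule alt_forms_insert_linear(2)[OF
          a])
    next
      fix vs :: "('a, 'b) tvec list" assume vs: "\<not> distinct vs"
      show "\<alpha> p vs = 0"
      proof (cases "set vs \<subseteq> tangent_space A p")
        case True
        have "\<not> distinct (map (\<lambda>v. v ?c) vs)" using vs by (simp add: distinct_map)
        from alt_forms_not_distinct[OF a this] show ?thesis using val[OF True] by simp
      next
        case False
        then show ?thesis using assms(1) by (simp add: tangential_def)
      qed
    qed
  qed
  moreover have "smooth_on (U c) (form_rep A c \<alpha> us)" if c: "c \<in> A" for c us
  proof -
    interpret local_calculus B "U c" by (rule chart_calculus[OF c])
    show ?thesis
      by (rule smooth_on_cong[OF open_S _ alt_forms_smooth_on[OF assms(2)[OF c]]]) (simp add: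
        local_form_def)
  qed
  ultimately show ?thesis by (simp add: forms_def)
qed

end

section \<open>Operations in charts\<close>


context manifold
begin

lemma local_vf_outside: "x \<notin> U c \<Longrightarrow> local_vf c X x = 0"
  by (simp add: local_vf_def)

lemma local_vf_smooth:
  assumes "X \<in> vector_fields A" "c \<in> A"
  shows "smooth_on (U c) (local_vf c X)"
proof -
  have "smooth_on (U c) (vf_rep c X)" using assms by (simp add: vector_fields_def)
  then show ?thesis
    by (rule smooth_on_cong[OF chart(2)[OF assms(2)], rotated]) (simp add: local_vf_def)
qed

lemma vector_fields_tangent: "X \<in> vector_fields A \<Longrightarrow> X p \<in> tangent_space A p"
  by (simp add: vector_fields_def)

lemma vector_fieldsI:
  assumes "\<And>p. X p \<in> tangent_space A p" "\<And>c. c \<in> A \<Longrightarrow> smooth_on (U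
    c) (local_vf c X)"
  shows "X \<in> vector_fields A"
proof -
  have "smooth_on (U c) (vf_rep c X)" if "c \<in> A" for c
    by (rule smooth_on_cong[OF chart(2)[OF that] _ assms(2)[OF that]]) (simp add: local_vf_def)
  then show ?thesis using assms(1) by (simp add: vector_fields_def)
qed

lemma local_vf_eqI:
  assumes "c \<in> A" "\<And>x. x \<notin> U c \<Longrightarrow> Z x = 0" "\<And>p. p \<in> cdom c
    \<Longrightarrow> X p c = Z (coord c p)"
  shows "local_vf c X = Z"
proof
  fix x
  show "local_vf c X x = Z x"
  proof (cases "x \<in> U c")
    case True
    then obtain p where "p \<in> cdom c" "x = coord c p" by blast
    then show ?thesis using local_vf_coord[OF assms(1)] assms(3) by simp
  qed (simp add: local_vf_outside assms(2))
qed

lemma vector_field_eqI: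
  assumes "\<And>p c. \<not> (c \<in> A \<and> p \<in> cdom c) \<Longrightarrow> X p c = 0"
    "\<And>p c. \<not> (c \<in> A \<and> p \<in> cdom c) \<Longrightarrow> Y p c = 0"
    "\<And>c. c \<in> A \<Longrightarrow> local_vf c X = local_vf c Y"
  shows "X = Y"
proof (intro ext)
  fix p c
  show "X p c = Y p c"
  proof (cases "c \<in> A \<and> p \<in> cdom c")
    case True
    then show ?thesis using local_vf_coord[of c p X] local_vf_coord[of c p Y] assms(3)[of c] by simp
  qed (simp add: assms(1,2))
qed

section \<open>Independence of the chart\<close>

lemma field_related_local_vf:
  assumes "c \<in> A" "c' \<in> A" "X \<in> vector_fields A"
  shows "local_diffeo.field_related (W c c') (transition c c') (local_vf c X) (local_vf c' X)"
proof -
  interpret T: local_diffeo B "W c c'" "W c' c" "transition c c'" "transition c' c"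
    by (rule local_diffeo[OF assms(1,2)])
  show ?thesis
    unfolding T.field_related_def
  proof
    fix x assume "x \<in> W c c'"
    then obtain p where p: "p \<in> cdom c" "p \<in> cdom c'" "x = coord c p" by blast
    show "local_vf c' X (transition c c' x) = T.D x (local_vf c X x)"
      unfolding p(3) transition_apply[OF assms(1) p(1)] local_vf_coord[OF assms(1) p(1)]
        local_vf_coord[OF assms(2) p(2)]
        tangent_spaceD(1)[OF vector_fields_tangent[OF assms(3)] assms(1,2) p(1,2)] trans_deriv_def
          ..
  qed
qed

text \<open>Both sides evaluate the form on the same tangent vectors, since \<open>T.D x\<close>
  converts components in c into components in c'.\<close>

lemma form_related_local_form:
  assumes "c \<in> A" "c' \<in> A"
  shows "local_diffeo.form_related (W c c') (transition c c')
    (local_calculus.restrict_form (W c c') (local_form c \<alpha>)) (local_calculus.restrict_form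
      (W c' c) (local_form c' \<alpha>))"
proof -
  interpret T: local_diffeo B "W c c'" "W c' c" "transition c c'" "transition c' c"
    by (rule local_diffeo[OF assms(1,2)])
  show ?thesis
    unfolding T.form_related_def
  proof (intro ballI allI)
    fix x us assume x: "x \<in> W c c'"
    then obtain p where p: "p \<in> cdom c" "p \<in> cdom c'" "x = coord c p" by blast
    have y: "transition c c' x = coord c' p" unfolding p(3) by (rule transition_apply[OF assms(1)
      p(1)])
    have y': "coord c' p \<in> W c' c" using p by blast
    have "map (coord_tvec A c' p) (map (T.D x) us) = map (coord_tvec A c p) us"
      using coord_tvec_trans_deriv[OF assms p(1,2)] by (simp add: p(3) trans_deriv_def)
    then show "T.W.restrict_form (W c c') (local_form c \<alpha>) us x =
      T.W.restrict_form (W c' c) (local_form c' \<alpha>) (map (T.D x) us) (transition c c' x)"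
      unfolding T.W.restrict_form_apply[OF x] y T.W.restrict_form_apply[OF y']
        local_form_coord[OF assms(2) p(2)] by (simp only: p(3) local_form_coord[OF assms(1) p(1)])
  qed
qed

text \<open>A transition map is a diffeomorphism between the two images of the overlap only. Each
  side is therefore restricted to its image, where naturality applies.\<close>

lemma lie_form_chart_independent:
  assumes c: "c \<in> A" "c' \<in> A" "p \<in> cdom c" "p \<in> cdom c'" and X: "X \<in>
    vector_fields A" and a: "\<alpha> \<in> kforms k"
  shows "lie_form (U c) (local_vf c X) (local_form c \<alpha>) us (coord c p) =
    lie_form (U c') (local_vf c' X) (local_form c' \<alpha>) (map (trans_deriv c c' p) us) (coord
      c' p)"
proof -
  interpret T: local_diffeo B "W c c'" "W c' c" "transition c c'" "transition c' c"
    by (rule local_diffeo[OF c(1,2)])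
  interpret C: local_calculus B "U c" by (rule chart_calculus[OF c(1)])
  interpret C': local_calculus B "U c'" by (rule chart_calculus[OF c(2)])
  have x: "coord c p \<in> W c c'" "coord c' p \<in> W c' c" using c by blast+
  note sX = local_vf_smooth[OF X c(1)] local_vf_smooth[OF X c(2)]
  note fa = local_form_forms[OF a c(1)] local_form_forms[OF a c(2)]
  have "lie_form (U c) (local_vf c X) (local_form c \<alpha>) us (coord c p) =
    lie_form (W c c') (local_vf c X) (C.restrict_form (W c c') (local_form c \<alpha>)) us (coord c
      p)"
    by (rule C.lie_form_restrict[OF T.W.open_S overlap_subset sX(1) refl x(1) fa(1)])
  also have "\<dots> = lie_form (W c' c) (local_vf c' X) (C'.restrict_form (W c' c) (local_form c'
    \<alpha>)) (map (T.D (coord c p)) us)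
      (transition c c' (coord c p))"
    by (rule T.lie_form_natural[OF smooth_on_subset[OF sX(1) overlap_subset] smooth_on_subset[OF
      sX(2) overlap_subset]
        field_related_local_vf[OF c(1,2) X] x(1) C.alt_forms_restrict_form[OF T.W.open_S
          overlap_subset fa(1)]
        C'.alt_forms_restrict_form[OF T.W'.open_S overlap_subset fa(2)] form_related_local_form[OF
          c(1,2)]])
  also have "\<dots> = lie_form (W c' c) (local_vf c' X) (C'.restrict_form (W c' c) (local_form c'
    \<alpha>)) (map (trans_deriv c c' p) us) (coord c' p)"
    unfolding transition_apply[OF c(1,3)] trans_deriv_def ..
  also have "\<dots> = lie_form (U c') (local_vf c' X) (local_form c' \<alpha>) (map (trans_deriv c
    c' p) us) (coord c' p)"
    by (rule C'.lie_form_restrict[OF T.W'.open_S overlap_subset sX(2) refl x(2) fa(2), symmetric])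
  finally show ?thesis .
qed

lemma ext_d_chart_independent:
  assumes c: "c \<in> A" "c' \<in> A" "p \<in> cdom c" "p \<in> cdom c'" and a: "\<alpha> \<in>
    kforms k"
  shows "ext_d (U c) (local_form c \<alpha>) us (coord c p) =
    ext_d (U c') (local_form c' \<alpha>) (map (trans_deriv c c' p) us) (coord c' p)"
proof -
  interpret T: local_diffeo B "W c c'" "W c' c" "transition c c'" "transition c' c"
    by (rule local_diffeo[OF c(1,2)])
  interpret C: local_calculus B "U c" by (rule chart_calculus[OF c(1)])
  interpret C': local_calculus B "U c'" by (rule chart_calculus[OF c(2)])
  have x: "coord c p \<in> W c c'" "coord c' p \<in> W c' c" using c by blast+
  note fa = local_form_forms[OF a c(1)] local_form_forms[OF a c(2)]
  have "ext_d (U c) (local_form c \<alpha>) us (coord c p) =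
    ext_d (W c c') (C.restrict_form (W c c') (local_form c \<alpha>)) us (coord c p)"
    by (rule C.ext_d_restrict[OF T.W.open_S overlap_subset x(1) fa(1)])
  also have "\<dots> = ext_d (W c' c) (C'.restrict_form (W c' c) (local_form c' \<alpha>)) (map
    (T.D (coord c p)) us)
      (transition c c' (coord c p))"
    by (rule T.ext_d_natural[OF x(1) C.alt_forms_restrict_form[OF T.W.open_S overlap_subset fa(1)]
        C'.alt_forms_restrict_form[OF T.W'.open_S overlap_subset fa(2)] form_related_local_form[OF
          c(1,2)]])
  also have "\<dots> = ext_d (W c' c) (C'.restrict_form (W c' c) (local_form c' \<alpha>)) (map
    (trans_deriv c c' p) us) (coord c' p)"
    unfolding transition_apply[OF c(1,3)] trans_deriv_def ..
  also have "\<dots> = ext_d (U c') (local_form c' \<alpha>) (map (trans_deriv c c' p) us) (coord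
    c' p)"
    by (rule C'.ext_d_restrict[OF T.W'.open_S overlap_subset x(2) fa(2), symmetric])
  finally show ?thesis .
qed

section \<open>Local representatives of the operations\<close>

text \<open>The coordinate definitions differentiate representatives that are not cut off; inside
  the open set \<open>U c\<close> the cut-off does not affect derivatives.\<close>

lemma frechet_derivative_form_rep:
  assumes "c \<in> A" "\<alpha> \<in> kforms k" "x \<in> U c"
  shows "frechet_derivative (form_rep A c \<alpha> us) (at x) = frechet_derivative (local_form c
    \<alpha> us) (at x)"
proof (rule frechet_derivative_transform_within_open[OF _ chart(2)[OF assms(1)] assms(3)])
  show "form_rep A c \<alpha> us differentiable at x"
    using assms smooth_on_differentiable by (fastforce simp: forms_def)
qed (simp add: local_form_def)

lemma frechet_derivative_vf_rep:
  assumes "c \<in> A" "X \<in> vector_fields A" "x \<in> U c"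
  shows "frechet_derivative (vf_rep c X) (at x) = frechet_derivative (local_vf c X) (at x)"
proof (rule frechet_derivative_transform_within_open[OF _ chart(2)[OF assms(1)] assms(3)])
  show "vf_rep c X differentiable at x"
    using assms smooth_on_differentiable by (fastforce simp: vector_fields_def)
qed (simp add: local_vf_def)

lemma map_component:
  assumes "c' \<in> A" "p \<in> cdom c'"
  shows "map (\<lambda>v. v c') (map (coord_tvec A c p) us) = map (trans_deriv c c' p) us"
  using assms by (simp add: coord_tvec_apply)

lemma coord_tvecs_tangent:
  assumes "c \<in> A" "p \<in> cdom c"
  shows "set (map (coord_tvec A c p) us) \<subseteq> tangent_space A p"
  using coord_tvec_tangent[OF assms] by auto

text \<open>\<open>lie_deriv\<close> is computed in some chosen chart c' at p. There the coordinate
  sum is \<open>lie_form\<close>, and chart independence carries it over to the given chart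
  c.\<close>

lemma local_form_lie_deriv:
  assumes c: "c \<in> A" and X: "X \<in> vector_fields A" and a: "\<alpha> \<in> kforms k"
  shows "local_form c (lie_deriv A X \<alpha>) = lie_form (U c) (local_vf c X) (local_form c
    \<alpha>)"
proof (rule local_form_eqI[OF c])
  interpret C: local_calculus B "U c" by (rule chart_calculus[OF c])
  show "lie_form (U c) (local_vf c X) (local_form c \<alpha>) us x = 0" if "x \<notin> U c" for us x
    by (rule C.alt_forms_outside[OF C.alt_forms_lie_form[OF local_vf_smooth[OF X c]
      local_form_forms[OF a c]] that])
next
  fix us p assume p: "p \<in> cdom c"
  define c' where "c' = (SOME c. c \<in> A \<and> p \<in> cdom c)"
  have c': "c' \<in> A" "p \<in> cdom c'" unfolding c'_def by (rule some_chart)+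
  have x: "coord c' p \<in> U c'" using c' by blast
  have r: "form_rep A c' \<alpha> us (coord c' p) = local_form c' \<alpha> us (coord c' p)" for us
    using x by (simp add: local_form_def)
  have "lie_deriv A X \<alpha> p (map (coord_tvec A c p) us) =
    lie_form (U c') (local_vf c' X) (local_form c' \<alpha>) (map (trans_deriv c c' p) us) (coord
      c' p)"
    unfolding lie_deriv_def Let_def c'_def[symmetric] map_component[OF c']
      lie_form_eq_sum[OF x] frechet_derivative_form_rep[OF c'(1) a x] frechet_derivative_vf_rep[OF
        c'(1) X x]
      local_vf_coord[OF c'] r
    using coord_tvecs_tangent[OF c p, of us] by (simp only: if_True)
  also have "\<dots> = lie_form (U c) (local_vf c X) (local_form c \<alpha>) us (coord c p)"
    by (rule lie_form_chart_independent[OF c c'(1) p c'(2) X a, symmetric])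
  finally show "lie_deriv A X \<alpha> p (map (coord_tvec A c p) us) = lie_form (U c) (local_vf c
    X) (local_form c \<alpha>) us (coord c p)" .
qed

lemma local_form_ext_deriv:
  assumes c: "c \<in> A" and a: "\<alpha> \<in> kforms k"
  shows "local_form c (ext_deriv A \<alpha>) = ext_d (U c) (local_form c \<alpha>)"
proof (rule local_form_eqI[OF c])
  interpret C: local_calculus B "U c" by (rule chart_calculus[OF c])
  show "ext_d (U c) (local_form c \<alpha>) us x = 0" if "x \<notin> U c" for us x
    by (rule C.alt_forms_outside[OF C.alt_forms_ext_d[OF local_form_forms[OF a c]] that])
next
  fix us p assume p: "p \<in> cdom c"
  define c' where "c' = (SOME c. c \<in> A \<and> p \<in> cdom c)"
  have c': "c' \<in> A" "p \<in> cdom c'" unfolding c'_def by (rule some_chart)+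
  have x: "coord c' p \<in> U c'" using c' by blast
  have "ext_deriv A \<alpha> p (map (coord_tvec A c p) us) =
    ext_d (U c') (local_form c' \<alpha>) (map (trans_deriv c c' p) us) (coord c' p)"
    unfolding ext_deriv_def Let_def c'_def[symmetric] map_component[OF c']
      ext_d_eq_sum[OF x] frechet_derivative_form_rep[OF c'(1) a x]
    using coord_tvecs_tangent[OF c p, of us] by (simp only: if_True)
  also have "\<dots> = ext_d (U c) (local_form c \<alpha>) us (coord c p)"
    by (rule ext_d_chart_independent[OF c c'(1) p c'(2) a, symmetric])
  finally show "ext_deriv A \<alpha> p (map (coord_tvec A c p) us) = ext_d (U c) (local_form c
    \<alpha>) us (coord c p)" .
qed

lemma local_form_interior_prod:
  assumes c: "c \<in> A" and X: "X \<in> vector_fields A"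
  shows "local_form c (interior_prod X \<alpha>) = contract (local_vf c X) (local_form c \<alpha>)"
proof (rule local_form_eqI[OF c])
  fix us p assume p: "p \<in> cdom c"
  show "interior_prod X \<alpha> p (map (coord_tvec A c p) us) = contract (local_vf c X)
    (local_form c \<alpha>) us (coord c p)"
    unfolding interior_prod_def contract_apply local_form_coord[OF c p] local_vf_coord[OF c p]
      list.map
      coord_tvec_component[OF c p vector_fields_tangent[OF X]] ..
qed (simp add: local_form_outside)

lemma local_form_add: "local_form c (\<alpha> + \<beta>) = local_form c \<alpha> + local_form c
  \<beta>"
  by (intro ext) (simp add: local_form_def form_rep_def)

lemma local_form_diff: "local_form c (\<alpha> - \<beta>) = local_form c \<alpha> - local_form c
  \<beta>"
  by (intro ext) (simp add: local_form_def form_rep_def)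

lemma local_form_form_scale: "local_form c (form_scale r \<alpha>) = fun_scale (\<lambda>_. r)
  (local_form c \<alpha>)"
  by (intro ext) (simp add: local_form_def form_rep_def form_scale_def)

lemma local_vf_add: "local_vf c (X + Y) = local_vf c X + local_vf c Y"
  by (intro ext) (simp add: local_vf_def vf_rep_def)

lemma local_form_function_scale:
  assumes "c \<in> A" "\<And>p. p \<in> cdom c \<Longrightarrow> f p = g (coord c p)"
  shows "local_form c (\<lambda>p vs. f p * \<alpha> p vs) = fun_scale g (local_form c \<alpha>)"
  by (rule local_form_eqI[OF assms(1)]) (simp_all add: local_form_outside local_form_coord[OF
    assms(1)] assms(2))

lemma local_vf_function_scale:
  assumes "c \<in> A" "\<And>p. p \<in> cdom c \<Longrightarrow> f p = g (coord c p)"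
  shows "local_vf c (\<lambda>p. tv_scale (f p) (X p)) = (\<lambda>x. g x *\<^sub>R local_vf c X x)"
  by (rule local_vf_eqI[OF assms(1)]) (simp_all add: local_vf_outside local_vf_coord[OF assms(1)]
    assms(2) tv_scale_def)

section \<open>Closure of forms and fields under the operations\<close>

lemma kforms_lie_deriv:
  assumes "X \<in> vector_fields A" "\<alpha> \<in> kforms k"
  shows "lie_deriv A X \<alpha> \<in> kforms k"
proof (rule formsI)
  show "tangential (lie_deriv A X \<alpha>)" by (simp add: tangential_def lie_deriv_def)
  fix c assume c: "c \<in> A"
  then interpret C: local_calculus B "U c" by (rule chart_calculus)
  show "local_form c (lie_deriv A X \<alpha>) \<in> alt_forms (U c) k"
    unfolding local_form_lie_deriv[OF c assms] by (rule C.alt_forms_lie_form[OF local_vf_smooth[OF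
      assms(1) c] local_form_forms[OF assms(2) c]])
qed

lemma kforms_ext_deriv:
  assumes "\<alpha> \<in> kforms k"
  shows "ext_deriv A \<alpha> \<in> kforms (Suc k)"
proof (rule formsI)
  show "tangential (ext_deriv A \<alpha>)" by (simp add: tangential_def ext_deriv_def)
  fix c assume c: "c \<in> A"
  then interpret C: local_calculus B "U c" by (rule chart_calculus)
  show "local_form c (ext_deriv A \<alpha>) \<in> alt_forms (U c) (Suc k)"
    unfolding local_form_ext_deriv[OF c assms] by (rule C.alt_forms_ext_d[OF local_form_forms[OF
      assms c]])
qed

lemma kforms_interior_prod:
  assumes "X \<in> vector_fields A" "\<alpha> \<in> kforms (Suc k)"
  shows "interior_prod X \<alpha> \<in> kforms k"
proof (rule formsI)
  show "tangential (interior_prod X \<alpha>)"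
    using tangential_forms[OF assms(2)] by (auto simp: tangential_def interior_prod_def)
  fix c assume c: "c \<in> A"
  then interpret C: local_calculus B "U c" by (rule chart_calculus)
  show "local_form c (interior_prod X \<alpha>) \<in> alt_forms (U c) k"
    unfolding local_form_interior_prod[OF c assms(1)] by (rule C.alt_forms_contract_Suc[OF
      local_vf_smooth[OF assms(1) c] local_form_forms[OF assms(2) c]])
qed

lemma kforms_add:
  assumes "\<alpha> \<in> kforms k" "\<beta> \<in> kforms k"
  shows "\<alpha> + \<beta> \<in> kforms k"
proof (rule formsI)
  show "tangential (\<alpha> + \<beta>)"
    using tangential_forms[OF assms(1)] tangential_forms[OF assms(2)] by (simp add: tangential_def)
  fix c assume c: "c \<in> A"
  then interpret C: local_calculus B "U c" by (rule chart_calculus)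
  show "local_form c (\<alpha> + \<beta>) \<in> alt_forms (U c) k"
    unfolding local_form_add by (rule C.alt_forms_add[OF local_form_forms[OF assms(1) c]
      local_form_forms[OF assms(2) c]])
qed

lemma kforms_function_scale:
  assumes "smooth_function A f" "\<alpha> \<in> kforms k"
  shows "(\<lambda>p vs. f p * \<alpha> p vs) \<in> kforms k"
proof (rule formsI)
  show "tangential (\<lambda>p vs. f p * \<alpha> p vs)"
    using tangential_forms[OF assms(2)] by (simp add: tangential_def)
  fix c assume c: "c \<in> A"
  then interpret C: local_calculus B "U c" by (rule chart_calculus)
  have "local_form c (\<lambda>p vs. f p * \<alpha> p vs) = fun_scale (f \<circ> cinv c)
    (local_form c \<alpha>)"
    by (rule local_form_function_scale[OF c]) (simp add: chart(4)[OF c])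
  moreover have "smooth_on (U c) (f \<circ> cinv c)" using assms(1) c by (simp add:
    smooth_function_def)
  ultimately show "local_form c (\<lambda>p vs. f p * \<alpha> p vs) \<in> alt_forms (U c) k"
    using C.alt_forms_fun_scale[OF _ local_form_forms[OF assms(2) c], of "f \<circ> cinv c"] by simp
qed

lemma kforms_form_scale:
  assumes "\<alpha> \<in> kforms k"
  shows "form_scale r \<alpha> \<in> kforms k"
  using kforms_function_scale[OF _ assms, of "\<lambda>_. r"]
  by (simp add: smooth_function_def o_def form_scale_def)

lemma kforms_diff:
  assumes "\<alpha> \<in> kforms k" "\<beta> \<in> kforms k"
  shows "\<alpha> - \<beta> \<in> kforms k"
proof -
  have eq: "\<alpha> - \<beta> = \<alpha> + form_scale (- 1) \<beta>" by (intro ext) (simp add: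
    form_scale_def)
  show ?thesis unfolding eq by (rule kforms_add[OF assms(1) kforms_form_scale[OF assms(2)]])
qed

lemma local_vf_lie_bracket:
  assumes "c \<in> A" "X \<in> vector_fields A" "Y \<in> vector_fields A"
  shows "local_vf c (lie_bracket A X Y) = vbracket (U c) (local_vf c X) (local_vf c Y)"
proof (rule local_vf_eqI[OF assms(1)])
  show "vbracket (U c) (local_vf c X) (local_vf c Y) x = 0" if "x \<notin> U c" for x
    unfolding vbracket_def minus_apply lie_outside[OF that] by (rule diff_zero)
  fix p assume p: "p \<in> cdom c"
  then have x: "coord c p \<in> U c" by blast
  show "lie_bracket A X Y p c = vbracket (U c) (local_vf c X) (local_vf c Y) (coord c p)"
    using p x assms(1)
    by (simp add: lie_bracket_def vbracket_def lie_def local_vf_coord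
        frechet_derivative_vf_rep[OF assms(1,2) x] frechet_derivative_vf_rep[OF assms(1,3) x])
qed

text \<open>The bracket is defined separately in each chart. That its components fit together into
  tangent vectors is naturality of the bracket under transition maps.\<close>

lemma vector_fields_lie_bracket:
  assumes X: "X \<in> vector_fields A" and Y: "Y \<in> vector_fields A"
  shows "lie_bracket A X Y \<in> vector_fields A"
proof (rule vector_fieldsI)
  fix c assume c: "c \<in> A"
  then interpret C: local_calculus B "U c" by (rule chart_calculus)
  show "smooth_on (U c) (local_vf c (lie_bracket A X Y))"
    unfolding local_vf_lie_bracket[OF c assms] by (rule C.smooth_vbracket[OF local_vf_smooth[OF X
      c] local_vf_smooth[OF Y c]])
next
  fix p
  show "lie_bracket A X Y p \<in> tangent_space A p"
  proof (rule tangent_spaceI)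
    fix c c' assume c: "c \<in> A" "c' \<in> A" "p \<in> cdom c" "p \<in> cdom c'"
    interpret T: local_diffeo B "W c c'" "W c' c" "transition c c'" "transition c' c"
      by (rule local_diffeo[OF c(1,2)])
    have x: "coord c p \<in> W c c'" "coord c' p \<in> W c' c" using c by blast+
    \<comment> \<open>The bracket is local, so it may be computed on the overlap, where fields in
      two charts are related by the transition map.\<close>
    have res: "lie_bracket A X Y p d = vbracket (W d d') (local_vf d X) (local_vf d Y) (coord d p)"
      if d: "d \<in> A" "d' \<in> A" "p \<in> cdom d" "p \<in> cdom d'" for d d'
    proof -
      interpret C: local_calculus B "U d" by (rule chart_calculus[OF d(1)])
      have x: "coord d p \<in> W d d'" using d by blast
      note l = C.lie_cong[OF overlap_subset open_overlap[OF d(1,2)] refl x]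
      have "vbracket (U d) (local_vf d X) (local_vf d Y) (coord d p) = vbracket (W d d') (local_vf
        d X) (local_vf d Y) (coord d p)"
        unfolding vbracket_def minus_apply l[OF local_vf_smooth[OF X d(1)]] l[OF local_vf_smooth[OF
          Y d(1)]] ..
      then show ?thesis
        unfolding local_vf_coord[OF d(1,3), of "lie_bracket A X Y", symmetric]
          local_vf_lie_bracket[OF d(1) assms] .
    qed
    have s: "smooth_on (W d d') (local_vf d Z)" if "d \<in> A" "Z \<in> vector_fields A" for d d' Z
      by (rule smooth_on_subset[OF local_vf_smooth[OF that(2,1)] overlap_subset])
    have "T.field_related (vbracket (W c c') (local_vf c X) (local_vf c Y)) (vbracket (W c' c)
      (local_vf c' X) (local_vf c' Y))"
      by (rule T.vbracket_natural[OF s[OF c(1) X] s[OF c(2) X] field_related_local_vf[OF c(1,2) X]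
          s[OF c(1) Y] s[OF c(2) Y] field_related_local_vf[OF c(1,2) Y]])
    then show "lie_bracket A X Y p c' = trans_deriv c c' p (lie_bracket A X Y p c)"
      unfolding res[OF c] res[OF c(2,1,4,3)] trans_deriv_def T.field_related_def
      using x(1) transition_apply[OF c(1,3), of c'] by (metis (no_types, lifting))
  next
    fix c assume c: "\<not> (c \<in> A \<and> p \<in> cdom c)"
    show "lie_bracket A X Y p c = 0" unfolding lie_bracket_def using c by (simp only: if_False)
  qed
qed

end

section \<open>The Courant bracket on the manifold\<close>


context manifold
begin

lemma sectionsD:
  assumes "e \<in> sections A n"
  shows "fst e \<in> vector_fields A" "snd e \<in> kforms (Suc n)"
  using assms by (auto simp: sections_def)

lemma sectionsI:
  assumes "X \<in> vector_fields A" "\<alpha> \<in> kforms (Suc n)"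
  shows "(X, \<alpha>) \<in> sections A n"
  using assms by (auto simp: sections_def)

lemma kforms_pairing:
  assumes "e1 \<in> sections A n" "e2 \<in> sections A n"
  shows "pairing e1 e2 \<in> kforms n"
  unfolding pairing_def
  by (intro kforms_form_scale kforms_add kforms_interior_prod
      sectionsD[OF assms(1)] sectionsD[OF assms(2)])

lemma local_form_pairing:
  assumes c: "c \<in> A" and e: "e1 \<in> sections A n" "e2 \<in> sections A n"
  shows "local_form c (pairing e1 e2) = local_calculus.local_pairing (local_vf c (fst e1))
    (local_form c (snd e1)) (local_vf c (fst e2)) (local_form c (snd e2))"
proof -
  interpret C: local_calculus B "U c" by (rule chart_calculus[OF c])
  show ?thesis
    unfolding pairing_def C.local_pairing_def local_form_form_scale local_form_add
      local_form_interior_prod[OF c sectionsD(1)[OF e(1)]] local_form_interior_prod[OF c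
        sectionsD(1)[OF e(2)]] ..
qed

lemma sections_courant_bracket:
  assumes "e1 \<in> sections A n" "e2 \<in> sections A n"
  shows "courant_bracket A e1 e2 \<in> sections A n"
  unfolding courant_bracket_def
  by (intro sectionsI vector_fields_lie_bracket kforms_add kforms_diff kforms_form_scale
      kforms_lie_deriv kforms_ext_deriv kforms_interior_prod
      sectionsD[OF assms(1)] sectionsD[OF assms(2)])

lemma fst_courant_bracket: "fst (courant_bracket A e1 e2) = lie_bracket A (fst e1) (fst e2)"
  by (simp add: courant_bracket_def)

lemma local_form_courant_bracket:
  assumes c: "c \<in> A" and e: "e1 \<in> sections A n" "e2 \<in> sections A n"
  shows "local_form c (snd (courant_bracket A e1 e2)) =
    local_calculus.courant_form (U c) (local_vf c (fst e1)) (local_form c (snd e1)) (local_vf c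
      (fst e2)) (local_form c (snd e2))"
proof -
  interpret C: local_calculus B "U c" by (rule chart_calculus[OF c])
  note s = sectionsD[OF e(1)] sectionsD[OF e(2)]
  show ?thesis
    unfolding courant_bracket_def C.courant_form_def snd_conv local_form_form_scale local_form_add
      local_form_diff
      local_form_lie_deriv[OF c s(1,4)] local_form_lie_deriv[OF c s(3,2)]
      local_form_ext_deriv[OF c kforms_interior_prod[OF s(1,4)]] local_form_ext_deriv[OF c
        kforms_interior_prod[OF s(3,2)]]
      local_form_interior_prod[OF c s(1)] local_form_interior_prod[OF c s(3)] ..
qed

lemma local_vf_courant_bracket:
  assumes c: "c \<in> A" and e: "e1 \<in> sections A n" "e2 \<in> sections A n"
  shows "local_vf c (fst (courant_bracket A e1 e2)) = vbracket (U c) (local_vf c (fst e1))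
    (local_vf c (fst e2))"
  unfolding fst_courant_bracket by (rule local_vf_lie_bracket[OF c sectionsD(1)[OF e(1)]
    sectionsD(1)[OF e(2)]])

lemma kforms_courant_T:
  assumes "e1 \<in> sections A n" "e2 \<in> sections A n" "e3 \<in> sections A n"
  shows "courant_T A e1 e2 e3 \<in> kforms n"
  unfolding courant_T_def
  by (intro kforms_form_scale kforms_add kforms_pairing sections_courant_bracket assms)

lemma local_form_courant_T:
  assumes c: "c \<in> A" and e: "e1 \<in> sections A n" "e2 \<in> sections A n" "e3 \<in> sections
    A n"
  shows "local_form c (courant_T A e1 e2 e3) = local_calculus.local_T (U c) (local_vf c (fst e1))
    (local_form c (snd e1))
    (local_vf c (fst e2)) (local_form c (snd e2)) (local_vf c (fst e3)) (local_form c (snd e3))"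
proof -
  interpret C: local_calculus B "U c" by (rule chart_calculus[OF c])
  show ?thesis
    unfolding courant_T_def C.local_T_def local_form_form_scale local_form_add
      local_form_pairing[OF c sections_courant_bracket[OF e(1,2)] e(3)]
      local_form_pairing[OF c sections_courant_bracket[OF e(2,3)] e(1)]
      local_form_pairing[OF c sections_courant_bracket[OF e(3,1)] e(2)]
      local_vf_courant_bracket[OF c e(1,2)] local_vf_courant_bracket[OF c e(2,3)]
        local_vf_courant_bracket[OF c e(3,1)]
      local_form_courant_bracket[OF c e(1,2)] local_form_courant_bracket[OF c e(2,3)]
        local_form_courant_bracket[OF c e(3,1)] ..
qed

lemma vector_fields_outside:
  "X \<in> vector_fields A \<Longrightarrow> \<not> (c \<in> A \<and> p \<in> cdom c)
    \<Longrightarrow> X p c = 0"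
  by (rule tangent_spaceD(2)[OF vector_fields_tangent])

section \<open>Jacobi identity and invariance of the pairing\<close>

lemma courant_jacobi:
  assumes e: "e1 \<in> sections A n" "e2 \<in> sections A n" "e3 \<in> sections A n"
  shows "courant_bracket A e1 (courant_bracket A e2 e3) +
     courant_bracket A e2 (courant_bracket A e3 e1) +
     courant_bracket A e3 (courant_bracket A e1 e2) =
       form_section (ext_deriv A (courant_T A e1 e2 e3))" (is "?b1 + ?b2 + ?b3 = _")
proof (rule prod_eqI)
  note b = sections_courant_bracket[OF e(2,3)] sections_courant_bracket[OF e(3,1)]
    sections_courant_bracket[OF e(1,2)]
  note bb = sections_courant_bracket[OF e(1) b(1)] sections_courant_bracket[OF e(2) b(2)]
    sections_courant_bracket[OF e(3) b(3)]
  have "fst ?b1 + fst ?b2 + fst ?b3 = 0"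
  proof (rule vector_field_eqI)
    show "(fst ?b1 + fst ?b2 + fst ?b3) p c = 0" if "\<not> (c \<in> A \<and> p \<in> cdom c)" for
      p c
      unfolding plus_fun_apply using bb[THEN sectionsD(1), THEN vector_fields_outside, OF that] by
        simp
    fix c assume c: "c \<in> A"
    interpret C: local_calculus B "U c" by (rule chart_calculus[OF c])
    note s = e[THEN sectionsD(1), THEN local_vf_smooth, OF c]
    have "local_vf c (fst ?b1 + fst ?b2 + fst ?b3) = 0"
      unfolding local_vf_add local_vf_courant_bracket[OF c e(1) b(1)] local_vf_courant_bracket[OF c
        e(2) b(2)]
        local_vf_courant_bracket[OF c e(3) b(3)] local_vf_courant_bracket[OF c e(1,2)]
          local_vf_courant_bracket[OF c e(2,3)]
        local_vf_courant_bracket[OF c e(3,1)]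
      by (rule C.vbracket_jacobi[OF s])
    also have "0 = local_vf c 0" by (intro ext) (simp add: local_vf_def vf_rep_def)
    finally show "local_vf c (fst ?b1 + fst ?b2 + fst ?b3) = local_vf c 0" .
  qed simp
  then show "fst (?b1 + ?b2 + ?b3) = fst (form_section (ext_deriv A (courant_T A e1 e2 e3)))"
    by (simp only: fst_add form_section_def fst_conv)
  have "snd ?b1 + snd ?b2 + snd ?b3 = ext_deriv A (courant_T A e1 e2 e3)"
  proof (rule form_eqI)
    show "tangential (snd ?b1 + snd ?b2 + snd ?b3)"
      by (intro tangential_forms[of _ "int (Suc n) - 1"] kforms_add bb[THEN sectionsD(2)])
    show "tangential (ext_deriv A (courant_T A e1 e2 e3))"
      by (rule tangential_forms, rule kforms_ext_deriv[OF kforms_courant_T[OF e]])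
    fix c assume c: "c \<in> A"
    interpret C: local_calculus B "U c" by (rule chart_calculus[OF c])
    note s = e[THEN sectionsD(1), THEN local_vf_smooth, OF c]
    note f = e[THEN sectionsD(2), THEN local_form_forms, OF c]
    show "local_form c (snd ?b1 + snd ?b2 + snd ?b3) = local_form c (ext_deriv A (courant_T A e1 e2
      e3))"
      unfolding local_form_add local_form_courant_bracket[OF c e(1) b(1)]
        local_form_courant_bracket[OF c e(2) b(2)]
        local_form_courant_bracket[OF c e(3) b(3)] local_form_courant_bracket[OF c e(1,2)]
          local_form_courant_bracket[OF c e(2,3)]
        local_form_courant_bracket[OF c e(3,1)] local_vf_courant_bracket[OF c e(1,2)]
          local_vf_courant_bracket[OF c e(2,3)]
        local_vf_courant_bracket[OF c e(3,1)] local_form_ext_deriv[OF c kforms_courant_T[OF e]]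
          local_form_courant_T[OF c e]
      by (rule C.courant_form_jacobi[OF s f])
  qed
  then show "snd (?b1 + ?b2 + ?b3) = snd (form_section (ext_deriv A (courant_T A e1 e2 e3)))"
    by (simp only: snd_add form_section_def snd_conv)
qed

text \<open>The local formula for the pairing is about sections, so the corrected brackets in (iv)
  must first be recognized as such.\<close>

lemma add_form_section:
  assumes "e \<in> sections A n" "\<omega> \<in> kforms (Suc n)"
  shows "e + form_section \<omega> \<in> sections A n" "fst (e + form_section \<omega>) = fst e"
    "snd (e + form_section \<omega>) = snd e + \<omega>"
proof -
  show f: "fst (e + form_section \<omega>) = fst e" and s: "snd (e + form_section \<omega>) = snd e
    + \<omega>"
    by (simp_all only: fst_add snd_add form_section_def fst_conv snd_conv add_0_right)
  have "(fst (e + form_section \<omega>), snd (e + form_section \<omega>)) \<in> sections A n"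
    unfolding f s by (intro sectionsI kforms_add sectionsD[OF assms(1)] assms(2))
  then show "e + form_section \<omega> \<in> sections A n" unfolding prod.collapse .
qed

lemma lie_deriv_pairing:
  assumes e: "e1 \<in> sections A n" "e2 \<in> sections A n" "e3 \<in> sections A n"
  shows "lie_deriv A (anchor e1) (pairing e2 e3) =
       pairing (courant_bracket A e1 e2 + form_section (ext_deriv A (pairing e1 e2))) e3
       + pairing e2 (courant_bracket A e1 e3 + form_section (ext_deriv A (pairing e1 e3)))"
  (is "_ = pairing ?d2 e3 + pairing e2 ?d3")
proof (rule form_eqI)
  note X = sectionsD(1)[OF e(1), folded anchor_def]
  note w2 = kforms_ext_deriv[OF kforms_pairing[OF e(1,2)]]
  note w3 = kforms_ext_deriv[OF kforms_pairing[OF e(1,3)]]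
  note d2 = add_form_section[OF sections_courant_bracket[OF e(1,2)] w2]
  note d3 = add_form_section[OF sections_courant_bracket[OF e(1,3)] w3]
  show "tangential (lie_deriv A (anchor e1) (pairing e2 e3))"
    by (rule tangential_forms, rule kforms_lie_deriv[OF X kforms_pairing[OF e(2,3)]])
  show "tangential (pairing ?d2 e3 + pairing e2 ?d3)"
    by (rule tangential_forms, rule kforms_add[OF kforms_pairing[OF d2(1) e(3)] kforms_pairing[OF
      e(2) d3(1)]])
  fix c assume c: "c \<in> A"
  interpret C: local_calculus B "U c" by (rule chart_calculus[OF c])
  note s = e[THEN sectionsD(1), THEN local_vf_smooth, OF c]
  note f = e[THEN sectionsD(2), THEN local_form_forms, OF c]
  show "local_form c (lie_deriv A (anchor e1) (pairing e2 e3)) = local_form c (pairing ?d2 e3 +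
    pairing e2 ?d3)"
    unfolding anchor_def local_form_lie_deriv[OF c sectionsD(1)[OF e(1)] kforms_pairing[OF e(2,3)]]
      local_form_add
      local_form_pairing[OF c e(2,3)] local_form_pairing[OF c d2(1) e(3)] local_form_pairing[OF c
        e(2) d3(1)] d2(2,3) d3(2,3)
      local_form_add local_vf_courant_bracket[OF c e(1,2)] local_vf_courant_bracket[OF c e(1,3)]
      local_form_courant_bracket[OF c e(1,2)] local_form_courant_bracket[OF c e(1,3)]
      local_form_ext_deriv[OF c kforms_pairing[OF e(1,2)]] local_form_ext_deriv[OF c
        kforms_pairing[OF e(1,3)]]
      local_form_pairing[OF c e(1,2)] local_form_pairing[OF c e(1,3)]
    by (rule C.lie_form_local_pairing[OF s f])
qed

section \<open>Functions as forms of degree 0\<close>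

lemma function_form_forms:
  assumes "smooth_function A f"
  shows "function_form f \<in> kforms (Suc 0)"
proof -
  have "form_rep A c (function_form f) us = (if us = [] then f \<circ> cinv c else (\<lambda>_.
    0))" for c us
    by (intro ext) (simp add: form_rep_def function_form_def)
  moreover have "alternating_multilinear V 0 (function_form f p)" for V :: "('a, 'b) tvec set" and p
    by (auto simp: alternating_multilinear_def function_form_def)
  ultimately show ?thesis
    using assms by (simp add: forms_def smooth_function_def del: zero_fun_fold)
qed

lemma local_form_function_form:
  assumes "c \<in> A" "x \<in> U c"
  shows "local_form c (function_form f) [] x = (f \<circ> cinv c) x"
  using assms by (simp add: local_form_def form_rep_def function_form_def)

lemma smooth_function_chart: "smooth_function A f \<Longrightarrow> c \<in> A \<Longrightarrow>
  smooth_on (U c) (f \<circ> cinv c)"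
  by (simp add: smooth_function_def)

text \<open>Viewing f as a form of degree 0 makes X(f) its Lie derivative, so that independence of
  the chosen chart is inherited from \<open>lie_deriv\<close>.\<close>

lemma vf_apply_coord:
  assumes f: "smooth_function A f" and X: "X \<in> vector_fields A" and c: "c \<in> A" "p \<in>
    cdom c"
  shows "vf_apply A X f p = lie (U c) (local_vf c X) (f \<circ> cinv c) (coord c p)"
proof -
  interpret C: local_calculus B "U c" by (rule chart_calculus[OF c(1)])
  have x: "coord c p \<in> U c" using c by blast
  have fr: "form_rep A c (function_form f) [] = f \<circ> cinv c" for c
    by (intro ext) (simp add: form_rep_def function_form_def)
  \<comment> \<open>On the empty list the sum in \<open>lie_deriv\<close> is empty, and both
    definitions choose the same chart.\<close>
  have "vf_apply A X f p = lie_deriv A X (function_form f) p (map (coord_tvec A c p) [])"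
    by (simp add: vf_apply_def lie_deriv_def Let_def fr)
  also have "\<dots> = local_form c (lie_deriv A X (function_form f)) [] (coord c p)"
    by (rule local_form_coord[OF c, symmetric])
  also have "\<dots> = lie (U c) (local_vf c X) (local_form c (function_form f) []) (coord c p)"
    unfolding local_form_lie_deriv[OF c(1) X function_form_forms[OF f]] lie_form.simps ..
  also have "\<dots> = lie (U c) (local_vf c X) (f \<circ> cinv c) (coord c p)"
    by (rule C.lie_cong[OF subset_refl C.open_S local_form_function_form[OF c(1)] x
          C.alt_forms_smooth_on[OF local_form_forms[OF function_form_forms[OF f] c(1)]]])
  finally show ?thesis .
qed

lemma omit_map: "omit i (map g xs) = map g (omit i xs)"
  by (simp add: omit_def take_map drop_map)

text \<open>On a coordinate vector df is the derivative of f in that direction, so the sum defining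
  the wedge product becomes the expanded recursion \<open>wedge_d_eq_sum\<close>.\<close>

lemma local_form_one_form_wedge:
  assumes f: "smooth_function A f" and c: "c \<in> A"
  shows "local_form c (one_form_wedge (ext_deriv A (function_form f)) \<beta>) = wedge_d (U c) (f
    \<circ> cinv c) (local_form c \<beta>)"
proof (rule local_form_eqI[OF c])
  interpret C: local_calculus B "U c" by (rule chart_calculus[OF c])
  show "wedge_d (U c) (f \<circ> cinv c) (local_form c \<beta>) us x = 0" if "x \<notin> U c" for
    us x
    unfolding wedge_d_eq_sum lie_outside[OF that] by simp
  fix us p assume p: "p \<in> cdom c"
  then have x: "coord c p \<in> U c" by blast
  have df: "ext_deriv A (function_form f) p [coord_tvec A c p u] = lie (U c) (\<lambda>_. u) (f
    \<circ> cinv c) (coord c p)" for u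
  proof -
    have "ext_deriv A (function_form f) p [coord_tvec A c p u] = local_form c (ext_deriv A
      (function_form f)) [u] (coord c p)"
      unfolding local_form_coord[OF c p] by simp
    also have "\<dots> = lie (U c) (\<lambda>_. u) (local_form c (function_form f) []) (coord c p)"
      unfolding local_form_ext_deriv[OF c function_form_forms[OF f]] by simp
    also have "\<dots> = lie (U c) (\<lambda>_. u) (f \<circ> cinv c) (coord c p)"
      by (rule C.lie_cong[OF subset_refl C.open_S local_form_function_form[OF c] x
            C.alt_forms_smooth_on[OF local_form_forms[OF function_form_forms[OF f] c]]])
    finally show ?thesis .
  qed
  show "one_form_wedge (ext_deriv A (function_form f)) \<beta> p (map (coord_tvec A c p) us) =
    wedge_d (U c) (f \<circ> cinv c) (local_form c \<beta>) us (coord c p)"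
    unfolding one_form_wedge_def wedge_d_eq_sum length_map
    by (rule sum.cong[OF refl]) (simp only: lessThan_iff nth_map df local_form_coord[OF c p]
      omit_map)
qed

text \<open>In each summand, an entry outside the tangent space is either the argument of \<theta>
  or among the arguments of \<beta>.\<close>

lemma tangential_one_form_wedge:
  assumes "tangential \<theta>" "tangential \<beta>"
  shows "tangential (one_form_wedge \<theta> \<beta>)"
  unfolding tangential_def one_form_wedge_def
proof (intro allI impI sum.neutral ballI)
  fix p vs i assume vs: "\<not> set vs \<subseteq> tangent_space A p" and i: "i \<in> {..<length
    vs}"
  have "vs = take i vs @ vs ! i # drop (Suc i) vs" using i by (simp add: id_take_nth_drop)
  then have "set vs = insert (vs ! i) (set (omit i vs))"
    unfolding omit_def by (metis Un_insert_right list.simps(15) set_append)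
  then have "\<not> set [vs ! i] \<subseteq> tangent_space A p \<or> \<not> set (omit i vs)
    \<subseteq> tangent_space A p"
    using vs by auto
  then show "(- 1) ^ i * \<theta> p [vs ! i] * \<beta> p (omit i vs) = 0"
    using assms unfolding tangential_def by (metis mult_zero_left mult_zero_right)
qed

section \<open>The bracket with a multiple of a section\<close>

lemma section_scale_simps:
  "fst (section_scale f e) = (\<lambda>p. tv_scale (f p) (fst e p))"
  "snd (section_scale f e) = (\<lambda>p vs. f p * snd e p vs)"
  by (simp_all add: section_scale_def)

lemma tangential_add: "tangential \<alpha> \<Longrightarrow> tangential \<beta> \<Longrightarrow>
  tangential (\<alpha> + \<beta>)"
  and tangential_diff: "tangential \<alpha> \<Longrightarrow> tangential \<beta> \<Longrightarrow>
    tangential (\<alpha> - \<beta>)"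
  by (simp_all add: tangential_def)

lemma tangential_function_scale: "tangential \<alpha> \<Longrightarrow> tangential (\<lambda>p vs.
  f p * \<alpha> p vs)"
  by (simp add: tangential_def)

lemma sections_section_scale:
  assumes f: "smooth_function A f" and e: "e \<in> sections A n"
  shows "section_scale f e \<in> sections A n"
  unfolding section_scale_def
proof (rule sectionsI)
  show "(\<lambda>p vs. f p * snd e p vs) \<in> kforms (Suc n)"
    by (rule kforms_function_scale[OF f sectionsD(2)[OF e]])
  show "(\<lambda>p. tv_scale (f p) (fst e p)) \<in> vector_fields A"
  proof (rule vector_fieldsI)
    show "tv_scale (f p) (fst e p) \<in> tangent_space A p" for p
      by (rule tangent_space_scale[OF vector_fields_tangent[OF sectionsD(1)[OF e]]])
    fix c assume c: "c \<in> A"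
    have "local_vf c (\<lambda>p. tv_scale (f p) (fst e p)) = (\<lambda>x. (f \<circ> cinv c) x
      *\<^sub>R local_vf c (fst e) x)"
      by (rule local_vf_function_scale[OF c]) (simp add: chart(4)[OF c])
    then show "smooth_on (U c) (local_vf c (\<lambda>p. tv_scale (f p) (fst e p)))"
      using smooth_on_scaleR[OF chart(2)[OF c] smooth_function_chart[OF f c] local_vf_smooth[OF
        sectionsD(1)[OF e] c]]
      by (simp only:)
  qed
qed

text \<open>The df-term has no vector component, so the first component is just the Leibniz rule of
  the Lie bracket; the second is \<open>courant_form_scaleR\<close> in each chart.\<close>

lemma courant_bracket_section_scale:
  assumes e: "e1 \<in> sections A n" "e2 \<in> sections A n" and f: "smooth_function A f"
  shows "courant_bracket A e1 (section_scale f e2) =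
       section_scale f (courant_bracket A e1 e2)
       + section_scale (vf_apply A (anchor e1) f) e2
       - form_section (one_form_wedge (ext_deriv A (function_form f)) (pairing e1 e2))"
proof (rule prod_eqI)
  note X = sectionsD(1)[OF e(1)] and Y = sectionsD(1)[OF e(2)]
  let ?g = "vf_apply A (anchor e1) f"
  note fe = sections_section_scale[OF f e(2)]
  note b = sections_courant_bracket[OF e] and bf = sections_courant_bracket[OF e(1) fe]
  have fc: "f p = (f \<circ> cinv c) (coord c p)" if "c \<in> A" "p \<in> cdom c" for c p
    using that by (simp add: chart(4))
  \<comment> \<open>This makes multiplication by X(f) a local multiplication by the derivative of
    the chart expression of f, which is how it appears in the identities on open sets.\<close>
  have gc: "?g p = lie (U c) (local_vf c (fst e1)) (f \<circ> cinv c) (coord c p)" if "c \<in> A"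
    "p \<in> cdom c" for c p
    unfolding anchor_def by (rule vf_apply_coord[OF f X that])
  have V: "local_vf c (\<lambda>p. tv_scale (f p) (Z p)) = (\<lambda>x. (f \<circ> cinv c) x
    *\<^sub>R local_vf c Z x)"
    "local_vf c (\<lambda>p. tv_scale (?g p) (Z p)) =
      (\<lambda>x. lie (U c) (local_vf c (fst e1)) (f \<circ> cinv c) x *\<^sub>R local_vf c Z x)"
    and F: "local_form c (\<lambda>p vs. f p * \<gamma> p vs) = fun_scale (f \<circ> cinv c)
      (local_form c \<gamma>)"
    "local_form c (\<lambda>p vs. ?g p * \<gamma> p vs) = fun_scale (lie (U c) (local_vf c (fst
      e1)) (f \<circ> cinv c)) (local_form c \<gamma>)"
    if c: "c \<in> A" for c Z \<gamma>
    by (rule local_vf_function_scale[OF c], erule fc[OF c], rule local_vf_function_scale[OF c],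
      erule gc[OF c],
        rule local_form_function_scale[OF c], erule fc[OF c], rule local_form_function_scale[OF c],
          erule gc[OF c])
  have "fst (courant_bracket A e1 (section_scale f e2)) =
    (\<lambda>p. tv_scale (f p) (fst (courant_bracket A e1 e2) p)) + (\<lambda>p. tv_scale (?g p)
      (fst e2 p))" (is "?l = ?r1 + ?r2")
  proof (rule vector_field_eqI)
    show "?l p c = 0" if "\<not> (c \<in> A \<and> p \<in> cdom c)" for p c
      by (rule vector_fields_outside[OF sectionsD(1)[OF bf] that])
    show "(?r1 + ?r2) p c = 0" if "\<not> (c \<in> A \<and> p \<in> cdom c)" for p c
      using vector_fields_outside[OF sectionsD(1)[OF b] that] vector_fields_outside[OF Y that]
      by (simp add: tv_scale_def)
    fix c assume c: "c \<in> A"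
    interpret C: local_calculus B "U c" by (rule chart_calculus[OF c])
    show "local_vf c ?l = local_vf c (?r1 + ?r2)"
      unfolding local_vf_add local_vf_courant_bracket[OF c e(1) fe] section_scale_simps
        V[OF c] local_vf_courant_bracket[OF c e]
        C.vbracket_scaleR[OF smooth_function_chart[OF f c] local_vf_smooth[OF X c]
          local_vf_smooth[OF Y c]]
      by (intro ext) (simp only: plus_fun_apply)
  qed
  then show "fst (courant_bracket A e1 (section_scale f e2)) = fst (section_scale f
    (courant_bracket A e1 e2)
       + section_scale ?g e2 - form_section (one_form_wedge (ext_deriv A (function_form f))
         (pairing e1 e2)))"
    by (simp only: fst_add fst_diff form_section_def fst_conv section_scale_simps diff_zero)
  have "snd (courant_bracket A e1 (section_scale f e2)) =
    (\<lambda>p vs. f p * snd (courant_bracket A e1 e2) p vs) + (\<lambda>p vs. ?g p * snd e2 p vs)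
    - one_form_wedge (ext_deriv A (function_form f)) (pairing e1 e2)" (is "?l = ?r1 + ?r2 - ?r3")
  proof (rule form_eqI)
    show "tangential ?l" by (rule tangential_forms[OF sectionsD(2)[OF bf]])
    show "tangential (?r1 + ?r2 - ?r3)"
      by (intro tangential_diff tangential_add tangential_function_scale tangential_forms[OF
        sectionsD(2)[OF b]] tangential_forms[OF sectionsD(2)[OF e(2)]]
          tangential_one_form_wedge tangential_forms[OF kforms_ext_deriv[OF function_form_forms[OF
            f]]]
          tangential_forms[OF kforms_pairing[OF e]])
    fix c assume c: "c \<in> A"
    interpret C: local_calculus B "U c" by (rule chart_calculus[OF c])
    show "local_form c ?l = local_form c (?r1 + ?r2 - ?r3)"
      unfolding local_form_add local_form_diff local_form_courant_bracket[OF c e(1) fe]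
        section_scale_simps
        V[OF c] F[OF c] local_form_courant_bracket[OF c e] local_form_one_form_wedge[OF f c]
          local_form_pairing[OF c e]
      by (rule C.courant_form_scaleR[OF smooth_function_chart[OF f c] local_vf_smooth[OF X c]
        local_vf_smooth[OF Y c]
            local_form_forms[OF sectionsD(2)[OF e(1)] c] local_form_forms[OF sectionsD(2)[OF e(2)]
              c]])
  qed
  then show "snd (courant_bracket A e1 (section_scale f e2)) = snd (section_scale f
    (courant_bracket A e1 e2)
       + section_scale ?g e2 - form_section (one_form_wedge (ext_deriv A (function_form f))
         (pairing e1 e2)))"
    by (simp only: snd_add snd_diff form_section_def snd_conv section_scale_simps)
qed

end

theorem theorem2p2:
  fixes A :: "('a::{t2_space,second_countable_topology}, 'b::real_inner) chart set"
    and m n :: nat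
    and e1 e2 e3 :: "('a, 'b) csection"
    and f :: "'a \<Rightarrow> real"
  assumes "smooth_manifold m A"
    and "e1 \<in> sections A n" and "e2 \<in> sections A n" and "e3 \<in> sections A n"
    and "smooth_function A f"
  shows
    "(courant_T A e1 e2 e3 \<in> forms A (int n - 1) \<and>
     courant_bracket A e1 (courant_bracket A e2 e3) +
     courant_bracket A e2 (courant_bracket A e3 e1) +
     courant_bracket A e3 (courant_bracket A e1 e2) =
       form_section (ext_deriv A (courant_T A e1 e2 e3))) \<and>
     (courant_bracket A e1 (section_scale f e2) =
       section_scale f (courant_bracket A e1 e2)
       + section_scale (vf_apply A (anchor e1) f) e2
       - form_section (one_form_wedge (ext_deriv A (function_form f)) (pairing e1 e2))) \<and>
     (anchor (courant_bracket A e1 e2) = lie_bracket A (anchor e1) (anchor e2)) \<and>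
     (lie_deriv A (anchor e1) (pairing e2 e3) =
       pairing (courant_bracket A e1 e2 + form_section (ext_deriv A (pairing e1 e2))) e3
       + pairing e2 (courant_bracket A e1 e3 + form_section (ext_deriv A (pairing e1 e3))))"
proof -
  interpret manifold m A by (rule manifold.intro[OF assms(1)])
  show ?thesis
    by (intro conjI kforms_courant_T[OF assms(2-4)] courant_jacobi[OF assms(2-4)]
        courant_bracket_section_scale[OF assms(2,3,5)] lie_deriv_pairing[OF assms(2-4)])
      (simp only: anchor_def fst_courant_bracket)
qed

end
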